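(* Let $\Lambda=\{\lambda_j\}_{j\ge 0}$ be a sequence in the open unit disk $\mathbb D$ with $\lambda_0=0$, and let $B_N$, $\nu_N$, $T_{B_N}(\varphi)$ and $\mathcal X_\Lambda$ be the associated objects defined in the context. Let $\varphi\in L^\infty(\mathbb T)\cap\mathcal X_\Lambda$ and let $f$ be an analytic function on a neighbourhood of $\operatorname{conv}\mathcal R(\varphi)$. Then $$\lim_{N\to\infty}\left|\frac1N\operatorname{Tr} f(T_{B_N}(\varphi))-\int_{\mathbb T} f(\varphi(\zeta))\,\mathrm d\nu_N(\zeta)\right|=0 .$$ Moreover, if $\varphi$ is real-valued, the same limit relation holds for any $f$ which is continuous on $[\operatorname{ess\,inf}\varphi,\operatorname{ess\,sup}\varphi]$.
   Context: $\mathbb T=\partial\mathbb D$ is the unit circle, with normalized Lebesgue measure $m$, written $\mathrm d\zeta$. $L^p(\mathbb T)$ is taken with respect to $m$. $H^2=H^2(\mathbb D)$ is the Hardy space, regarded as a closed subspace of $L^2(\mathbb T)$ via boundary values. For $\varphi\in L^\infty(\mathbb T)$, $\mathcal R(\varphi)$ is its essential range and $\operatorname{conv}\mathcal R(\varphi)$ is the closed convex hull of $\mathcal R(\varphi)$. For a sequence $\Lambda=\{\lambda_j\}_{j\ge0}$ in $\mathbb D$ with $\lambda_0=0$ and $N\ge1$, $B_N$ is the finite Blaschke product with zeros $\lambda_0,\dots,\lambda_{N-1}$: $$B_N(\zeta)=\prod_{j=0}^{N-1}\frac{\overline{\lambda_j}}{|\lambda_j|}\,\frac{\zeta-\lambda_j}{1-\overline{\lambda_j}\zeta},$$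 with the convention $\overline{\lambda_j}/|\lambda_j|=1$ when $\lambda_j=0$. For an inner function $B$, the model space is $K_B=H^2\ominus BH^2$, and for $\varphi\in L^\infty(\mathbb T)$ the truncated Toeplitz operator $T_B(\varphi)$ is the operator on $K_B$ given by $T_B(\varphi)g=P_B(\varphi g)$, where $P_B$ is the orthogonal projection of $L^2(\mathbb T)$ onto $K_B$. The space $K_{B_N}$ has dimension $N$. The operator $f(T_{B_N}(\varphi))$ is defined by the holomorphic functional calculus, or by the continuous functional calculus for self-adjoint operators when $\varphi$ is real-valued and $f$ is continuous. The probability measure $\nu_N$ on $\mathbb T$ is $$\mathrm d\nu_N(\zeta)=\frac1N|B_N'(\zeta)|\,\mathrm d\zeta=\frac1N\sum_{j=0}^{N-1}\frac{1-|\lambda_j|^2}{|\zeta-\lambda_j|^2}\,\mathrm d\zeta .$$ The space $\mathcal X_\Lambda$ is the closure of $C(\mathbb T)$ in the norm $\|g\|_\Lambda=\sup_{N\ge1}\|g\|_{L^2(\nu_N)}$. Since $\lambda_0=0$, $\nu_1=m$, so $\mathcal X_\Lambda\subseteq L^2(\mathbb T)$. *)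

theory Defs
  imports "HOL-Complex_Analysis.Complex_Analysis" "HOL-Probability.Probability"
begin

text \<open>
  Elements of \<open>L\<^sup>p\<close> of the circle are represented by functions, and equality in \<open>L\<^sup>p\<close> is equality
  almost everywhere. All operators below are maps on such representatives.
\<close>

section \<open>The unit circle and its function spaces\<close>

text \<open>
  The completion makes the measurable sets the Lebesgue measurable ones. This matters for
  \<open>f \<circ> \<phi>\<close>: \<open>f\<close> is arbitrary outside a neighbourhood of the essential range of \<open>\<phi>\<close>, so the
  composition is only a.e. equal to a Borel function.
\<close>

definition circ :: "complex measure" where
  "circ = completion
     (distr (uniform_measure lborel {0..2 * pi}) (restrict_space borel (sphere 0 1)) cis)"

definition L2 :: "(complex \<Rightarrow> complex) set" where
  "L2 = {g. g \<in> borel_measurable circ \<and> integrable circ (\<lambda>\<zeta>. (cmod (g \<zeta>))\<^sup>2)}"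

definition Linf :: "(complex \<Rightarrow> complex) set" where
  "Linf = {g. g \<in> borel_measurable circ \<and> (\<exists>C. AE \<zeta> in circ. cmod (g \<zeta>) \<le> C)}"

definition l2_inner :: "(complex \<Rightarrow> complex) \<Rightarrow> (complex \<Rightarrow> complex) \<Rightarrow> complex" where
  "l2_inner g h = (LINT \<zeta>|circ. g \<zeta> * cnj (h \<zeta>))"

definition l2_norm :: "complex measure \<Rightarrow> (complex \<Rightarrow> complex) \<Rightarrow> real" where
  "l2_norm M g = sqrt (LINT \<zeta>|M. (cmod (g \<zeta>))\<^sup>2)"

definition ess_range :: "(complex \<Rightarrow> complex) \<Rightarrow> complex set" where
  "ess_range \<phi> = {w. \<forall>e>0. emeasure circ {\<zeta> \<in> space circ. dist (\<phi> \<zeta>) w < e} > 0}"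

definition conv_ess_range :: "(complex \<Rightarrow> complex) \<Rightarrow> complex set" where
  "conv_ess_range \<phi> = closure (convex hull (ess_range \<phi>))"

definition ess_sup :: "(complex \<Rightarrow> real) \<Rightarrow> real" where
  "ess_sup u = real_of_ereal (esssup circ (\<lambda>\<zeta>. ereal (u \<zeta>)))"

definition ess_inf :: "(complex \<Rightarrow> real) \<Rightarrow> real" where
  "ess_inf u = - ess_sup (\<lambda>\<zeta>. - u \<zeta>)"

text \<open>
  The Hardy space of the disk, as a space of functions on the circle: \<open>g\<close> is the (radial) boundary
  function of some \<open>F\<close> in the Hardy space of the disk.
\<close>

definition H2 :: "(complex \<Rightarrow> complex) set" where
  "H2 = {g \<in> L2. \<exists>F. F holomorphic_on ball 0 1
           \<and> (\<exists>C. \<forall>r\<in>{0<..<1}. (LINT \<zeta>|circ. (cmod (F (complex_of_real r * \<zeta>)))\<^sup>2) \<le> C)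
           \<and> (AE \<zeta> in circ. ((\<lambda>r. F (complex_of_real r * \<zeta>)) \<longlongrightarrow> g \<zeta>) (at_left 1))}"


section \<open>Blaschke products, model spaces, truncated Toeplitz operators\<close>

definition blaschke :: "(nat \<Rightarrow> complex) \<Rightarrow> nat \<Rightarrow> complex \<Rightarrow> complex" where
  "blaschke \<Lambda> N \<zeta> =
     (\<Prod>j<N. (if \<Lambda> j = 0 then 1 else cnj (\<Lambda> j) / complex_of_real (cmod (\<Lambda> j)))
            * ((\<zeta> - \<Lambda> j) / (1 - cnj (\<Lambda> j) * \<zeta>)))"

definition model_space :: "(complex \<Rightarrow> complex) \<Rightarrow> (complex \<Rightarrow> complex) set" where
  "model_space B = {g \<in> H2. \<forall>h\<in>H2. l2_inner g (\<lambda>\<zeta>. B \<zeta> * h \<zeta>) = 0}"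

definition orth_proj :: "(complex \<Rightarrow> complex) set \<Rightarrow> (complex \<Rightarrow> complex) \<Rightarrow> complex \<Rightarrow> complex" where
  "orth_proj V h = (SOME g. g \<in> V \<and> (\<forall>k\<in>V. l2_inner (\<lambda>\<zeta>. h \<zeta> - g \<zeta>) k = 0))"

definition tto ::
  "(complex \<Rightarrow> complex) \<Rightarrow> (complex \<Rightarrow> complex) \<Rightarrow> (complex \<Rightarrow> complex) \<Rightarrow> complex \<Rightarrow> complex" where
  "tto B \<phi> g = orth_proj (model_space B) (\<lambda>\<zeta>. \<phi> \<zeta> * g \<zeta>)"


section \<open>Functional calculus and trace on a finite-dimensional subspace of \<open>L\<^sup>2\<close>\<close>

type_synonym l2_op = "(complex \<Rightarrow> complex) \<Rightarrow> complex \<Rightarrow> complex"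

text \<open>\<open>is_preimage V T z h g\<close>: the element \<open>g\<close> of \<open>V\<close> solves \<open>(z - T) g = h\<close>.\<close>

definition is_preimage ::
  "(complex \<Rightarrow> complex) set \<Rightarrow> l2_op \<Rightarrow> complex \<Rightarrow> (complex \<Rightarrow> complex) \<Rightarrow> (complex \<Rightarrow> complex) \<Rightarrow> bool"
  where
  "is_preimage V T z h g \<longleftrightarrow> g \<in> V \<and> (AE \<zeta> in circ. z * g \<zeta> - T g \<zeta> = h \<zeta>)"

text \<open>
  \<open>z\<close> is in the spectrum iff \<open>z - T\<close> is not bijective on \<open>V\<close> (modulo a.e. equality); as \<open>V\<close> is
  finite-dimensional, boundedness of the inverse is automatic.
\<close>

definition op_spectrum :: "(complex \<Rightarrow> complex) set \<Rightarrow> l2_op \<Rightarrow> complex set" where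
  "op_spectrum V T = - {z. \<forall>h\<in>V. \<exists>g. is_preimage V T z h g \<and>
      (\<forall>g'. is_preimage V T z h g' \<longrightarrow> (AE \<zeta> in circ. g' \<zeta> = g \<zeta>))}"

definition op_resolvent :: "(complex \<Rightarrow> complex) set \<Rightarrow> l2_op \<Rightarrow> complex \<Rightarrow> l2_op" where
  "op_resolvent V T z h = (SOME g. is_preimage V T z h g)"

text \<open>
  The Riesz-Dunford integral \<open>f(T) = (1 / 2\<pi>i) \<integral>\<^sub>\<Gamma> f(z) (z - T)\<^sup>-\<^sup>1 dz\<close>, understood weakly. The spectrum
  of \<open>T\<close> is finite, and \<open>\<Gamma>\<close> is the union of small circles around its points; \<^const>\<open>residue\<close> is by
  definition the normalized integral over all sufficiently small circles.
\<close>

definition hol_calculus ::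
  "(complex \<Rightarrow> complex) set \<Rightarrow> l2_op \<Rightarrow> (complex \<Rightarrow> complex) \<Rightarrow> l2_op" where
  "hol_calculus V T f h = (SOME g. g \<in> V \<and> (\<forall>k\<in>V. l2_inner g k =
     (\<Sum>w\<in>op_spectrum V T. residue (\<lambda>z. f z * l2_inner (op_resolvent V T z h) k) w)))"

definition poly_op :: "complex poly \<Rightarrow> l2_op \<Rightarrow> l2_op" where
  "poly_op p T h = (\<lambda>\<zeta>. \<Sum>i\<le>degree p. coeff p i * (T ^^ i) h \<zeta>)"

text \<open>
  The continuous functional calculus of a self-adjoint \<open>T\<close>, obtained from \<open>p \<mapsto> p(T)\<close> by continuity:
  \<open>f(T) h\<close> is the limit of \<open>p\<^sub>n(T) h\<close> whenever the polynomials \<open>p\<^sub>n\<close> converge to \<open>f\<close> uniformly on the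
  spectrum. The spectrum is a set of real numbers, embedded in the complex plane.
\<close>

definition cont_calculus ::
  "(complex \<Rightarrow> complex) set \<Rightarrow> l2_op \<Rightarrow> (real \<Rightarrow> complex) \<Rightarrow> l2_op" where
  "cont_calculus V T f h = (SOME g. g \<in> V \<and> (\<forall>p :: nat \<Rightarrow> complex poly.
      uniform_limit (op_spectrum V T) (\<lambda>n. poly (p n)) (\<lambda>z. f (Re z)) sequentially \<longrightarrow>
      (\<lambda>n. l2_norm circ (\<lambda>\<zeta>. poly_op (p n) T h \<zeta> - g \<zeta>)) \<longlonglongrightarrow> 0))"

definition orthonormal_basis :: "(complex \<Rightarrow> complex) set \<Rightarrow> nat \<Rightarrow> (nat \<Rightarrow> complex \<Rightarrow> complex) \<Rightarrow> bool"
  where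
  "orthonormal_basis V n e \<longleftrightarrow> (\<forall>i<n. e i \<in> V)
     \<and> (\<forall>i<n. \<forall>j<n. l2_inner (e i) (e j) = (if i = j then 1 else 0))
     \<and> (\<forall>g\<in>V. AE \<zeta> in circ. g \<zeta> = (\<Sum>i<n. l2_inner g (e i) * e i \<zeta>))"

definition op_trace :: "(complex \<Rightarrow> complex) set \<Rightarrow> l2_op \<Rightarrow> complex" where
  "op_trace V S =
     (THE s. \<exists>n e. orthonormal_basis V n e \<and> s = (\<Sum>i<n. l2_inner (S (e i)) (e i)))"


section \<open>The measures \<open>\<nu>\<^sub>N\<close> and the space \<open>\<X>\<^sub>\<Lambda>\<close>\<close>

definition nu :: "(nat \<Rightarrow> complex) \<Rightarrow> nat \<Rightarrow> complex measure" where
  "nu \<Lambda> N = density circ (\<lambda>\<zeta>. ennreal (1 / real N * cmod (deriv (blaschke \<Lambda> N) \<zeta>)))"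

text \<open>
  The density of \<open>\<nu>\<^sub>N\<close> is bounded, so the norms below are genuine integrals for every \<open>g\<close> in \<^const>\<open>L2\<close>;
  the supremum over \<open>N\<close> may be infinite.
\<close>

definition Lambda_norm :: "(nat \<Rightarrow> complex) \<Rightarrow> (complex \<Rightarrow> complex) \<Rightarrow> ereal" where
  "Lambda_norm \<Lambda> g = (SUP N\<in>{1..}. ereal (l2_norm (nu \<Lambda> N) g))"

definition X_space :: "(nat \<Rightarrow> complex) \<Rightarrow> (complex \<Rightarrow> complex) set" where
  "X_space \<Lambda> = {\<phi> \<in> L2. \<forall>\<epsilon>>0. \<exists>g. continuous_on (sphere 0 1) g
                     \<and> Lambda_norm \<Lambda> (\<lambda>\<zeta>. \<phi> \<zeta> - g \<zeta>) < ereal \<epsilon>}"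

end

theory Submission
  imports Defs "Jordan_Normal_Form.Schur_Decomposition"
begin

text \<open>
  Let \<open>e\<^sub>j\<close> be the normalized Szego kernel at \<open>\<Lambda> j\<close> times \<open>B\<^sub>j\<close> (the constant \<open>tm j\<close> below). The functions
  \<open>e\<^sub>0, \<dots>, e\<^sub>N\<^sub>-\<^sub>1\<close> are an orthonormal basis of the model space of \<open>B\<^sub>N\<close>, and logarithmic differentiation
  of the Blaschke product gives \<open>|B\<^sub>N'| = |e\<^sub>0|\<^sup>2 + \<dots> + |e\<^sub>N\<^sub>-\<^sub>1|\<^sup>2\<close> on the circle. Hence, for every bounded
  \<open>\<psi>\<close>, the integral of \<open>\<psi>\<close> against \<open>\<nu>\<^sub>N\<close> is exactly the normalized trace of the truncated Toeplitz
  operator \<open>T(\<psi>)\<close> (\<open>integral_nu_symbol\<close>). What has to be shown for \<open>f(z) = z\<^sup>k\<close> is therefore that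
  \<open>T(\<phi>)\<^sup>k\<close> and \<open>T(\<phi>\<^sup>k)\<close> have asymptotically the same normalized trace.

  This is measured by the \<^emph>\<open>defect\<close> of a symbol \<open>\<psi>\<close>: with \<open>P\<^sub>N\<close> the projection onto the model space,
  the sum over \<open>j < N\<close> of the squared norms of \<open>(1 - P\<^sub>N) (\<psi> e\<^sub>j)\<close>, a squared Hilbert-Schmidt norm. Since
  Hilbert-Schmidt operators form an ideal, the symbols with defect \<open>o(N)\<close> form an algebra
  (\<open>defect_mult\<close>), and they are closed under approximation in the \<open>\<Lambda>\<close>-norm. As \<open>\<Lambda> 0 = 0\<close>, the backward
  shift maps every \<open>e\<^sub>j\<close> with \<open>j > 0\<close> into the model space, so that the symbol \<open>cnj\<close> has defect at most 1
  (\<open>backward_shift_tm\<close>), and so has the identity, because a unimodular symbol and its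
  conjugate have the same defect. Stone-Weierstrass adds the continuous symbols and the closure
  property the symbols in \<open>X_space\<close> (\<open>negligible_X_space\<close>). For a symbol of defect \<open>o(N)\<close> an induction
  on \<open>k\<close> bounds the distance of \<open>T(\<phi>)\<^sup>k e\<^sub>j\<close> from \<open>\<phi>\<^sup>k e\<^sub>j\<close> in quadratic mean over \<open>j\<close>
  (\<open>compress_power_limit\<close>), which settles all polynomials \<open>f\<close>.

  To reach general \<open>f\<close>, choose by Schur's theorem an orthonormal basis \<open>f\<^sub>i\<close> of the model space in which
  \<open>T(\<phi>)\<close> is triangular. Its diagonal entries \<open>\<mu>\<^sub>i\<close> are the means of \<open>\<phi>\<close> with respect to the densities
  \<open>|f\<^sub>i|\<^sup>2\<close>, and thus lie in every closed convex set that contains almost all values of \<open>\<phi>\<close>. For both functional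
  calculi the trace of \<open>f(T(\<phi>))\<close> is the sum of the \<open>f(\<mu>\<^sub>i)\<close>: the resolvent of a triangular matrix has the
  diagonal entries \<open>1 / (z - \<mu>\<^sub>i)\<close>, and a triangular self-adjoint matrix is diagonal. Consequently the
  difference in the theorem is a linear functional of \<open>f\<close> that is bounded by twice the supremum of \<open>|f|\<close> on a
  compact convex set \<open>K\<close> (\<open>gap_bound\<close>), and it tends to zero for every uniform limit of polynomials
  on \<open>K\<close>. Functions holomorphic near \<open>K\<close> are such limits by Runge's theorem, which for convex \<open>K\<close>
  has a direct proof (\<open>runge_compact_convex\<close>): Cauchy's formula on a loop around \<open>K\<close> makes \<open>f\<close> a
  uniform limit of combinations of functions \<open>1 / (w - z)\<close> with \<open>w \<notin> K\<close>, and each of these has a power series in a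
  disc that contains \<open>K\<close> but not \<open>w\<close>. For real symbols \<open>K\<close> is an interval, and Weierstrass' theorem
  takes the place of Runge's.
\<close>

section \<open>Unitary triangularization and resolvents of triangular matrices\<close>

text \<open>
  Gram-Schmidt, applied to a basis that starts with an eigenvector, keeps that vector as its first
  output. The output is orthogonal only, so the columns are divided by their lengths.
\<close>

lemma eigenvector_orthonormal_extension:
  fixes a :: "nat \<Rightarrow> nat \<Rightarrow> complex"
  assumes n: "n > 0"
  obtains w e where
    "\<And>i j. i < n \<Longrightarrow> j < n \<Longrightarrow> (\<Sum>k<n. cnj (w k i) * w k j) = (if i = j then 1 else 0)"
    "\<And>k. k < n \<Longrightarrow> (\<Sum>l<n. a k l * w l 0) = e * w k 0"
proof -
  define A where "A = Matrix.mat n n (\<lambda>(i,j). a i j)"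
  have A: "A \<in> carrier_mat n n" by (simp add: A_def)
  from char_poly_factorized[OF A] obtain as where as: "char_poly A = (\<Prod>x\<leftarrow>as. [:- x, 1:])" "length as = n"
    by blast
  with n obtain e es where ees: "as = e # es" by (cases as) auto
  have "eigenvalue A e"
    unfolding eigenvalue_root_char_poly[OF A] as ees by simp
  then obtain v where ev: "eigenvector A v e" unfolding eigenvalue_def by blast
  have v: "v \<in> carrier_vec n" and v0: "v \<noteq> 0\<^sub>v n" and Av: "A *\<^sub>v v = e \<cdot>\<^sub>v v"
    using ev A unfolding eigenvector_def by auto
  define b where "b = basis_completion v"
  define ws where "ws = gram_schmidt n b"
  interpret cof_vec_space n "TYPE(complex)" .
  from basis_completion[OF v v0, folded b_def]
  have dist_b: "distinct b" and indep: "\<not> lin_dep (set b)" and b: "set b \<subseteq> carrier_vec n"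
    and hdb: "hd b = v" and len_b: "length b = n" by auto
  from hdb len_b n obtain vs where bv: "b = v # vs" by (cases b, auto)
  from gram_schmidt_result[OF b dist_b indep refl, folded ws_def]
  have ws: "set ws \<subseteq> carrier_vec n" "corthogonal ws" "length ws = n"
    by (auto simp: len_b)
  from gram_schmidt_hd[OF v, of vs, folded bv] have hdws: "hd ws = v" unfolding ws_def .
  have wsi: "ws ! i \<in> carrier_vec n" if "i < n" for i using ws that by auto
  have ws0: "ws ! 0 = v" using hdws ws(3) n by (cases ws) auto
  define c where "c j = (\<Sum>k<n. (cmod (vec_index (ws ! j) k))\<^sup>2)" for j
  define w where "w k j = vec_index (ws ! j) k / of_real (sqrt (c j))" for k j
  have ip: "(\<Sum>k<n. cnj (vec_index (ws ! i) k) * vec_index (ws ! j) k) = ws ! j \<bullet>c ws ! i" if "i < n" "j < n" for i j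
    using wsi[OF that(1)] wsi[OF that(2)]
    by (simp add: scalar_prod_def mult.commute atLeast0LessThan)
  have cc: "(\<Sum>k<n. cnj (vec_index (ws ! i) k) * vec_index (ws ! i) k) = of_real (c i)" for i
    unfolding c_def of_real_sum
    by (rule sum.cong) (simp_all add: complex_norm_square mult.commute del: of_real_power)
  have c0: "c i > 0" if i: "i < n" for i
  proof -
    have "ws ! i \<bullet>c ws ! i \<noteq> 0" using corthogonalD[OF ws(2)] i ws(3) by auto
    then have "c i \<noteq> 0" using ip[OF i i] cc by auto
    moreover have "c i \<ge> 0" unfolding c_def by (rule sum_nonneg) auto
    ultimately show ?thesis by simp
  qed
  show ?thesis
  proof (rule that)
    fix i j assume i: "i < n" and j: "j < n"
    have "(\<Sum>k<n. cnj (w k i) * w k j)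
        = (\<Sum>k<n. cnj (vec_index (ws ! i) k) * vec_index (ws ! j) k) / (of_real (sqrt (c i)) * of_real (sqrt (c j)))"
      unfolding w_def sum_divide_distrib by simp
    also have "\<dots> = (if i = j then 1 else 0)"
    proof (cases "i = j")
      case True
      then show ?thesis using c0[OF i] cc[of i]
        by (simp flip: of_real_mult)
    next
      case False
      then show ?thesis using ip[OF i j] corthogonalD[OF ws(2)] i j ws(3) by auto
    qed
    finally show "(\<Sum>k<n. cnj (w k i) * w k j) = (if i = j then 1 else 0)" .
  next
    fix k assume k: "k < n"
    have "(\<Sum>l<n. a k l * vec_index v l) = vec_index (A *\<^sub>v v) k"
      using k v by (simp add: A_def scalar_prod_def atLeast0LessThan)
    also have "\<dots> = e * vec_index v k" unfolding Av using k v by simp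
    finally have "(\<Sum>l<n. a k l * vec_index v l) = e * vec_index v k" .
    then show "(\<Sum>l<n. a k l * w l 0) = e * w k 0"
      unfolding w_def ws0 by (simp flip: sum_divide_distrib)
  qed
qed

text \<open>
  Schur's theorem by deflation: in an orthonormal basis that starts with an eigenvector, the first column
  of the matrix vanishes below the diagonal, and the induction hypothesis triangularizes the remaining block.
  Matrices are plain functions on indices, because the size is the dimension of a model space and varies.
\<close>

lemma unitary_triangularization:
  fixes a :: "nat \<Rightarrow> nat \<Rightarrow> complex"
  shows "\<exists>u. (\<forall>i<n. \<forall>j<n. (\<Sum>k<n. cnj (u k i) * u k j) = (if i = j then 1 else 0))
     \<and> (\<forall>i<n. \<forall>j<i. (\<Sum>k<n. \<Sum>l<n. cnj (u k i) * a k l * u l j) = 0)"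
proof (induction n arbitrary: a)
  case 0
  then show ?case by simp
next
  case (Suc m)
  let ?n = "Suc m"
  obtain w e where w: "\<And>i j. i < ?n \<Longrightarrow> j < ?n \<Longrightarrow> (\<Sum>k<?n. cnj (w k i) * w k j) = (if i = j then 1 else 0)"
    and e: "\<And>k. k < ?n \<Longrightarrow> (\<Sum>l<?n. a k l * w l 0) = e * w k 0"
    using eigenvector_orthonormal_extension[of ?n a] by blast
  \<comment> \<open>the block left after deflation, i.e. the matrix in the columns 1, ..., m of w\<close>
  define a' where "a' p q = (\<Sum>k<?n. \<Sum>l<?n. cnj (w k (Suc p)) * a k l * w l (Suc q))" for p q
  from Suc[of a'] obtain u3 where
    u3: "\<And>i j. i < m \<Longrightarrow> j < m \<Longrightarrow> (\<Sum>k<m. cnj (u3 k i) * u3 k j) = (if i = j then 1 else 0)"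
    and u3': "\<And>i j. i < m \<Longrightarrow> j < i \<Longrightarrow> (\<Sum>k<m. \<Sum>l<m. cnj (u3 k i) * a' k l * u3 l j) = 0" by blast
  \<comment> \<open>the product of w with the block diagonal matrix made of 1 and u3\<close>
  define u where "u k j = (case j of 0 \<Rightarrow> w k 0 | Suc j' \<Rightarrow> (\<Sum>p<m. w k (Suc p) * u3 p j'))" for k j
  \<comment> \<open>stated for an arbitrary form b: the identity matrix yields orthonormality, a yields triangularity\<close>
  have bil: "(\<Sum>k<?n. \<Sum>l<?n. cnj (u k (Suc i)) * b k l * u l (Suc j))
     = (\<Sum>p<m. \<Sum>q<m. cnj (u3 p i) * (\<Sum>k<?n. \<Sum>l<?n. cnj (w k (Suc p)) * b k l * w l (Suc q)) * u3 q j)"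
    for b :: "nat \<Rightarrow> nat \<Rightarrow> complex" and i j
  proof -
    have "(\<Sum>k<?n. \<Sum>l<?n. cnj (u k (Suc i)) * b k l * u l (Suc j))
      = (\<Sum>k<?n. \<Sum>l<?n. \<Sum>p<m. \<Sum>q<m. cnj (u3 p i) * (cnj (w k (Suc p)) * b k l * w l (Suc q)) * u3 q j)"
      unfolding u_def nat.case cnj_sum complex_cnj_mult sum_distrib_right
      unfolding sum_distrib_left
      by (intro sum.cong refl) (simp only: mult_ac)
    also have "\<dots> = (\<Sum>k<?n. \<Sum>p<m. \<Sum>l<?n. \<Sum>q<m. cnj (u3 p i) * (cnj (w k (Suc p)) * b k l * w l (Suc q)) * u3 q j)"
      by (intro sum.cong refl sum.swap)
    also have "\<dots> = (\<Sum>p<m. \<Sum>k<?n. \<Sum>l<?n. \<Sum>q<m. cnj (u3 p i) * (cnj (w k (Suc p)) * b k l * w l (Suc q)) * u3 q j)"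
      by (rule sum.swap)
    also have "\<dots> = (\<Sum>p<m. \<Sum>k<?n. \<Sum>q<m. \<Sum>l<?n. cnj (u3 p i) * (cnj (w k (Suc p)) * b k l * w l (Suc q)) * u3 q j)"
      by (intro sum.cong refl sum.swap)
    also have "\<dots> = (\<Sum>p<m. \<Sum>q<m. \<Sum>k<?n. \<Sum>l<?n. cnj (u3 p i) * (cnj (w k (Suc p)) * b k l * w l (Suc q)) * u3 q j)"
      by (intro sum.cong refl sum.swap)
    finally show ?thesis
      by (simp only: sum_distrib_left sum_distrib_right)
  qed
  have delta: "(\<Sum>k<N. \<Sum>l<N. f k * (if k = l then 1 else 0) * g l) = (\<Sum>k<N. f k * g k)"
    for f g :: "nat \<Rightarrow> complex" and N
    by (intro sum.cong refl) (simp add: if_distrib [of "\<lambda>x. _ * x"] if_distrib [of "\<lambda>x. x * _"] cong: if_cong)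
  have on: "(\<Sum>k<?n. cnj (u k i) * u k j) = (if i = j then 1 else 0)" if i: "i < ?n" and j: "j < ?n" for i j
  proof -
    have z: "(\<Sum>k<?n. cnj (w k 0) * u k (Suc j)) = 0" if "j < m" for j
    proof -
      have "(\<Sum>k<?n. cnj (w k 0) * u k (Suc j)) = (\<Sum>k<?n. \<Sum>p<m. u3 p j * (cnj (w k 0) * w k (Suc p)))"
        by (simp only: u_def nat.case sum_distrib_left mult_ac)
      also have "\<dots> = (\<Sum>p<m. u3 p j * (\<Sum>k<?n. cnj (w k 0) * w k (Suc p)))"
        by (subst sum.swap) (simp only: sum_distrib_left)
      also have "\<dots> = 0"
        by (rule sum.neutral) (use w[of 0] in auto)
      finally show ?thesis .
    qed
    have "(\<Sum>k<?n. cnj (u k (Suc i)) * w k 0) = cnj (\<Sum>k<?n. cnj (w k 0) * u k (Suc i))" for i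
      by (simp only: cnj_sum complex_cnj_mult complex_cnj_cnj mult.commute)
    with z have z': "(\<Sum>k<?n. cnj (u k (Suc i)) * w k 0) = 0" if "i < m" for i
      using that by (simp only: complex_cnj_zero)
    have s: "(\<Sum>k<?n. cnj (u k (Suc i)) * u k (Suc j)) = (if i = j then 1 else 0)" if "i < m" "j < m" for i j
    proof -
      have "(\<Sum>k<?n. cnj (u k (Suc i)) * u k (Suc j))
        = (\<Sum>k<?n. \<Sum>l<?n. cnj (u k (Suc i)) * (if k = l then 1 else 0) * u l (Suc j))"
        by (rule delta[symmetric])
      also have "\<dots> = (\<Sum>p<m. \<Sum>q<m. cnj (u3 p i) * (if p = q then 1 else 0) * u3 q j)"
      proof -
        have "(\<Sum>k<?n. cnj (w k (Suc p)) * w k (Suc q)) = (if p = q then 1 else 0)" if "p < m" "q < m" for p q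
          using w[of "Suc p" "Suc q"] that by simp
        then show ?thesis
          by (subst bil, intro sum.cong[OF refl]) (simp only: delta lessThan_iff)
      qed
      also have "\<dots> = (if i = j then 1 else 0)" unfolding delta using u3 that by simp
      finally show ?thesis .
    qed
    show ?thesis
    proof (cases i)
      case 0
      with w[of 0 0] z j show ?thesis by (cases j) (simp_all add: u_def del: sum.lessThan_Suc)
    next
      case (Suc i')
      with z'[of i'] s[of i'] i j show ?thesis
        by (cases j) (simp_all add: u_def[of _ 0] del: sum.lessThan_Suc)
    qed
  qed
  moreover have "(\<Sum>k<?n. \<Sum>l<?n. cnj (u k i) * a k l * u l j) = 0" if i: "i < ?n" and j: "j < i" for i j
  proof -
    from j obtain i' where i': "i = Suc i'" by (cases i) auto
    show ?thesis
    proof (cases j)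
      case 0
      have "(\<Sum>k<?n. \<Sum>l<?n. cnj (u k i) * a k l * u l j) = (\<Sum>k<?n. cnj (u k i) * (\<Sum>l<?n. a k l * w l 0))"
        unfolding 0 by (simp only: u_def nat.case sum_distrib_left mult.assoc)
      also have "\<dots> = (\<Sum>k<?n. e * (cnj (u k i) * u k 0))"
        by (intro sum.cong refl) (use e in \<open>simp add: u_def mult_ac\<close>)
      also have "\<dots> = 0" unfolding sum_distrib_left[symmetric] using on[OF i, of 0] i' by simp
      finally show ?thesis .
    next
      case (Suc j')
      have "(\<Sum>p<m. \<Sum>q<m. cnj (u3 p i') * a' p q * u3 q j') = 0"
        using u3' i j i' Suc by auto
      then show ?thesis unfolding i' Suc bil a'_def by blast
    qed
  qed
  ultimately show ?case by blast
qed

text \<open>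
  \<open>G z\<close> is the inverse of \<open>z - a\<close> whenever \<open>z\<close> is not a diagonal entry of the triangular matrix \<open>a\<close>. The four
  parts serve different purposes: a right inverse solves \<open>(z - a) g = h\<close>, a left inverse makes the solution unique,
  holomorphy makes the entries accessible to residues, and the diagonal determines the trace.
\<close>

definition resolvent_matrix ::
  "nat \<Rightarrow> (nat \<Rightarrow> nat \<Rightarrow> complex) \<Rightarrow> (complex \<Rightarrow> nat \<Rightarrow> nat \<Rightarrow> complex) \<Rightarrow> bool" where
  "resolvent_matrix n a G \<longleftrightarrow>
    (\<forall>z i j. (\<forall>m<n. z \<noteq> a m m) \<longrightarrow> i < n \<longrightarrow> j < n \<longrightarrow>
        z * G z i j - (\<Sum>k<n. a i k * G z k j) = (if i = j then 1 else 0)) \<and>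
    (\<forall>z i j. (\<forall>m<n. z \<noteq> a m m) \<longrightarrow> i < n \<longrightarrow> j < n \<longrightarrow>
        z * G z i j - (\<Sum>k<n. G z i k * a k j) = (if i = j then 1 else 0)) \<and>
    (\<forall>i j. (\<lambda>z. G z i j) holomorphic_on - {a m m | m. m < n}) \<and>
    (\<forall>z i. i < n \<longrightarrow> G z i i = 1 / (z - a i i))"

lemma resolvent_matrixD:
  assumes "resolvent_matrix n a G"
  shows "(\<And>m. m < n \<Longrightarrow> z \<noteq> a m m) \<Longrightarrow> i < n \<Longrightarrow> j < n \<Longrightarrow>
      z * G z i j - (\<Sum>k<n. a i k * G z k j) = (if i = j then 1 else 0)"
    and "(\<And>m. m < n \<Longrightarrow> z \<noteq> a m m) \<Longrightarrow> i < n \<Longrightarrow> j < n \<Longrightarrow>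
      z * G z i j - (\<Sum>k<n. G z i k * a k j) = (if i = j then 1 else 0)"
    and "(\<lambda>z. G z i j) holomorphic_on - {a m m | m. m < n}"
    and "i < n \<Longrightarrow> G z i i = 1 / (z - a i i)"
  using assms unfolding resolvent_matrix_def by blast+

text \<open>
  By bordering: if \<open>G\<close> inverts \<open>z - a\<close> for the leading block, the only new entries are those in the last
  column, namely \<open>G\<close> applied to the last column of \<open>a\<close> and divided by the new diagonal entry of \<open>z - a\<close>.
\<close>

lemma triangular_resolvent:
  fixes a :: "nat \<Rightarrow> nat \<Rightarrow> complex"
  assumes tri: "\<And>i j. i < n \<Longrightarrow> j < i \<Longrightarrow> a i j = 0"
  shows "\<exists>G. resolvent_matrix n a G"
  using tri
proof (induction n)
  case 0
  show ?case by (rule exI[of _ "\<lambda>_ _ _. 0"]) (simp add: resolvent_matrix_def)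
next
  case (Suc n)
  have "\<And>i j. i < n \<Longrightarrow> j < i \<Longrightarrow> a i j = 0" using Suc.prems by auto
  from Suc.IH[OF this] obtain G where G: "resolvent_matrix n a G" by blast
  note r = resolvent_matrixD(1)[OF G] and l = resolvent_matrixD(2)[OF G]
    and h = resolvent_matrixD(3)[OF G] and d = resolvent_matrixD(4)[OF G]
  define H where "H z i j =
    (if j < n then (if i < n then G z i j else 0)
     else if i < n then (\<Sum>k<n. G z i k * a k n) / (z - a n n) else 1 / (z - a n n))" for z i j
  have an: "a n j = 0" if "j < n" for j using Suc.prems that by auto
  have "z * H z i j - (\<Sum>k<Suc n. a i k * H z k j) = (if i = j then 1 else 0)"
    if z: "\<forall>m<Suc n. z \<noteq> a m m" and i: "i < Suc n" and j: "j < Suc n" for z i j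
  proof -
    have zn: "z - a n n \<noteq> 0" and z': "\<And>m. m < n \<Longrightarrow> z \<noteq> a m m" using z by auto
    consider "i < n" "j < n" | "i < n" "j = n" | "i = n" "j < n" | "i = n" "j = n" using i j by linarith
    then show ?thesis
    proof cases
      case 1 then show ?thesis using r[OF z', of i j] by (simp add: H_def)
    next
      case 2
      define S where "S p = (\<Sum>k<n. G z p k * a k n)" for p
      have "z * S i - (\<Sum>p<n. a i p * S p) = (\<Sum>k<n. (z * G z i k - (\<Sum>p<n. a i p * G z p k)) * a k n)"
      proof -
        have "(\<Sum>p<n. a i p * S p) = (\<Sum>k<n. \<Sum>p<n. a i p * G z p k * a k n)"
          unfolding S_def sum_distrib_left by (subst sum.swap) (simp add: mult.assoc)
        then show ?thesis
          by (simp add: S_def sum_distrib_left sum_distrib_right left_diff_distrib sum_subtractf mult.assoc)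
      qed
      also have "\<dots> = (\<Sum>k<n. (if i = k then 1 else 0) * a k n)"
        by (intro sum.cong refl) (use r[OF z' \<open>i < n\<close>] in auto)
      also have "\<dots> = a i n" using 2 by (simp add: if_distrib[of "\<lambda>x. x * _"] cong: if_cong)
      finally have "z * S i = (\<Sum>p<n. a i p * S p) + a i n" by (simp add: algebra_simps)
      moreover have "(\<Sum>p<n. a i p * (S p / (z - a n n))) = (\<Sum>p<n. a i p * S p) / (z - a n n)"
        by (simp add: sum_divide_distrib)
      ultimately show ?thesis using 2
        by (simp add: H_def flip: S_def) (simp add: add_divide_distrib)
    next
      case 3 then show ?thesis using an by (simp add: H_def)
    next
      case 4
      have "z / (z - a n n) - a n n / (z - a n n) = 1" using zn by (simp flip: diff_divide_distrib)
      then show ?thesis using 4 an by (simp add: H_def)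
    qed
  qed
  moreover have "z * H z i j - (\<Sum>k<Suc n. H z i k * a k j) = (if i = j then 1 else 0)"
    if z: "\<forall>m<Suc n. z \<noteq> a m m" and i: "i < Suc n" and j: "j < Suc n" for z i j
  proof -
    have zn: "z - a n n \<noteq> 0" and z': "\<And>m. m < n \<Longrightarrow> z \<noteq> a m m" using z by auto
    consider "i < n" "j < n" | "i < n" "j = n" | "i = n" "j < n" | "i = n" "j = n" using i j by linarith
    then show ?thesis
    proof cases
      case 1 then show ?thesis using l[OF z', of i j] an by (simp add: H_def)
    next
      case 2 
      have "z * (s / (z - a n n)) - (s + s / (z - a n n) * a n n) = 0" for s
        using zn by (simp add: divide_simps) (simp add: algebra_simps)
      then show ?thesis using 2 by (simp add: H_def)
    next
      case 3 then show ?thesis using an by (simp add: H_def)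
    next
      case 4
      have "z / (z - a n n) - a n n / (z - a n n) = 1" using zn by (simp flip: diff_divide_distrib)
      then show ?thesis using 4 an by (simp add: H_def)
    qed
  qed
  moreover have "(\<lambda>z. H z i j) holomorphic_on - {a m m | m. m < Suc n}" for i j
  proof -
    have hG: "(\<lambda>z. G z i j) holomorphic_on - {a m m | m. m < Suc n}" for i j
      by (rule holomorphic_on_subset[OF h]) auto
    show ?thesis
      unfolding H_def by (cases "j < n"; cases "i < n") (auto intro!: holomorphic_intros hG)
  qed
  moreover have "H z i i = 1 / (z - a i i)" if "i < Suc n" for z i
    using that d by (auto simp: H_def less_Suc_eq)
  ultimately have "resolvent_matrix (Suc n) a H" unfolding resolvent_matrix_def by blast
  then show ?case by blast
qed

text \<open>
  If \<open>M\<close> is the first position at which the value \<open>a m m\<close> occurs on the diagonal, then \<open>a m m\<close> is not a diagonal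
  entry of the leading \<open>M \<times> M\<close> block, which can therefore be solved for the first \<open>M\<close> entries of an eigenvector whose
  entry at \<open>M\<close> is 1 and whose later entries vanish.
\<close>

lemma triangular_eigenvector:
  fixes a :: "nat \<Rightarrow> nat \<Rightarrow> complex"
  assumes tri: "\<And>i j. i < n \<Longrightarrow> j < i \<Longrightarrow> a i j = 0" and m: "m < n"
  obtains v where "\<And>i. i < n \<Longrightarrow> a m m * v i - (\<Sum>k<n. a i k * v k) = 0" and "\<exists>i<n. v i \<noteq> 0"
proof -
  define M where "M = (LEAST k. a k k = a m m)"
  have M: "a M M = a m m" unfolding M_def by (rule LeastI) simp
  have "M \<le> m" unfolding M_def by (rule Least_le) simp
  with m have Mn: "M < n" by simp
  have less: "a m m \<noteq> a k k" if "k < M" for k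
    using not_less_Least[of k "\<lambda>k. a k k = a m m"] that unfolding M_def by metis
  have triM: "\<And>i j. i < M \<Longrightarrow> j < i \<Longrightarrow> a i j = 0" using tri Mn by auto
  obtain G where "resolvent_matrix M a G" using triangular_resolvent[of M a] triM by blast
  note G = resolvent_matrixD(1)[OF this]
  let ?z = "a m m"
  define v where "v k = (if k < M then (\<Sum>l<M. G ?z k l * a l M) else if k = M then 1 else 0)" for k
  have sumv: "(\<Sum>k<n. a i k * v k) = (\<Sum>k<M. a i k * v k) + a i M" for i
  proof -
    have "(\<Sum>k<n. a i k * v k) = (\<Sum>k<Suc M. a i k * v k)"
      by (rule sum.mono_neutral_right) (use Mn in \<open>auto simp: v_def\<close>)
    then show ?thesis by (simp add: v_def)
  qed
  show ?thesis
  proof (rule that)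
    show "\<exists>i<n. v i \<noteq> 0" using Mn by (auto simp: v_def)
    fix i assume i: "i < n"
    show "?z * v i - (\<Sum>k<n. a i k * v k) = 0"
    proof (cases "i < M")
      case True
      have "(\<Sum>k<M. a i k * v k) = (\<Sum>l<M. (\<Sum>k<M. a i k * G ?z k l) * a l M)"
      proof -
        have "(\<Sum>k<M. a i k * v k) = (\<Sum>k<M. \<Sum>l<M. a i k * G ?z k l * a l M)"
          by (simp add: v_def sum_distrib_left mult.assoc)
        also have "\<dots> = (\<Sum>l<M. \<Sum>k<M. a i k * G ?z k l * a l M)" by (rule sum.swap)
        finally show ?thesis by (simp add: sum_distrib_right)
      qed
      then have "?z * v i - (\<Sum>k<M. a i k * v k) = (\<Sum>l<M. (?z * G ?z i l - (\<Sum>k<M. a i k * G ?z k l)) * a l M)"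
        using True by (simp add: v_def sum_distrib_left sum_subtractf algebra_simps)
      also have "\<dots> = (\<Sum>l<M. (if i = l then 1 else 0) * a l M)"
        by (intro sum.cong refl) (use G[OF less, of i] True in auto)
      also have "\<dots> = a i M" using True by (simp add: if_distrib[of "\<lambda>x. x * _"] cong: if_cong)
      finally show ?thesis unfolding sumv by (simp add: algebra_simps)
    next
      case False
      have "(\<Sum>k<M. a i k * v k) = 0"
        by (rule sum.neutral) (use tri i False in auto)
      with False tri[OF i, of M] M show ?thesis unfolding sumv by (cases "i = M") (auto simp: v_def)
    qed
  qed
qed

section \<open>Integration over the unit circle\<close>

lemma space_circ [simp]: "space circ = sphere 0 1"
  by (simp add: circ_def space_restrict_space)

lemma measurable_cis_circle: "cis \<in> borel \<rightarrow>\<^sub>M restrict_space borel (sphere 0 1)"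
  by (rule measurable_restrict_space2) (auto intro!: borel_measurable_continuous_onI continuous_intros)

lemma prob_space_circ: "prob_space circ"
proof -
  let ?U = "uniform_measure lborel {0..2 * pi :: real}"
  have U: "prob_space ?U" by (rule prob_space_uniform_measure) auto
  have "prob_space (distr ?U (restrict_space borel (sphere 0 1)) cis)"
    by (rule prob_space.prob_space_distr[OF U]) (simp add: measurable_cis_circle cong: measurable_cong_sets)
  then show ?thesis
    unfolding circ_def
    by (intro prob_spaceI)
       (simp only: space_completion, subst emeasure_completion,
        simp_all only: sets_completionI_sets sets.top main_part prob_space.emeasure_space_1)
qed

interpretation circ: prob_space circ by (rule prob_space_circ)

interpretation circ: complete_measure circ
  unfolding circ_def by (rule completion.complete_measure_axioms)

lemma measurable_circ_continuous:
  fixes g :: "complex \<Rightarrow> 'b :: topological_space"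
  assumes "continuous_on (sphere 0 1) g"
  shows "g \<in> borel_measurable circ"
  unfolding circ_def
  by (intro measurable_completion) (simp add: borel_measurable_continuous_on_restrict assms cong: measurable_cong_sets)

text \<open>
  By completeness of the measure. This makes compositions measurable with functions that are controlled only near
  the essential range of a symbol.
\<close>

lemma measurable_circ_AE_cong:
  fixes f g :: "complex \<Rightarrow> 'b :: topological_space"
  assumes f: "f \<in> borel_measurable circ" and ae: "AE \<zeta> in circ. f \<zeta> = g \<zeta>"
  shows "g \<in> borel_measurable circ"
proof (rule measurableI)
  fix A :: "'b set" assume A: "A \<in> sets borel"
  show "g -` A \<inter> space circ \<in> sets circ"
    by (rule circ.in_sets_AE[of "f -` A \<inter> space circ"])
       (use ae measurable_sets[OF f A] in \<open>auto elim!: eventually_mono\<close>)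
qed auto

lemma integrable_circ_bounded:
  fixes f :: "complex \<Rightarrow> 'b :: {banach, second_countable_topology}"
  assumes "f \<in> borel_measurable circ" "AE \<zeta> in circ. norm (f \<zeta>) \<le> C"
  shows "integrable circ f"
  using circ.integrable_const_bound[OF assms(2,1)] .

lemma integrable_circ_continuous:
  fixes g :: "complex \<Rightarrow> 'b :: {banach, second_countable_topology}"
  assumes g: "continuous_on (sphere 0 1) g"
  shows "integrable circ g"
proof -
  have "compact (g ` sphere 0 1)" by (intro compact_continuous_image g) auto
  then obtain C where "\<forall>x\<in>sphere 0 1. norm (g x) \<le> C"
    by (meson bounded_iff compact_imp_bounded imageI)
  then show ?thesis
    by (intro integrable_circ_bounded[of _ C] measurable_circ_continuous g) auto
qed

lemma AE_circI: "(\<And>\<zeta>. cmod \<zeta> = 1 \<Longrightarrow> P \<zeta>) \<Longrightarrow> AE \<zeta> in circ. P \<zeta>"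
  by (rule AE_I2) auto

lemma integral_circ_cong:
  "(\<And>\<zeta>. cmod \<zeta> = 1 \<Longrightarrow> f \<zeta> = g \<zeta>) \<Longrightarrow> (LINT \<zeta>|circ. f \<zeta>) = (LINT \<zeta>|circ. g \<zeta>)"
  by (rule Bochner_Integration.integral_cong) auto

lemma integral_circ_eq_integral_cis:
  fixes g :: "complex \<Rightarrow> complex"
  assumes g: "continuous_on (sphere 0 1) g"
  shows "(LINT \<zeta>|circ. g \<zeta>) = integral {0..2 * pi} (\<lambda>t. g (cis t)) / (2 * pi)"
proof -
  let ?U = "uniform_measure lborel {0..2 * pi :: real}"
  have gm: "g \<in> borel_measurable (restrict_space borel (sphere 0 1))"
    by (intro borel_measurable_continuous_on_restrict g)
  have gc: "(\<lambda>t. g (cis t)) \<in> borel_measurable borel"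
    using measurable_compose[OF measurable_cis_circle gm] .
  have U: "?U = density lborel (\<lambda>x. ennreal (indicator {0..2 * pi} x / (2 * pi)))"
    unfolding uniform_measure_def
    by (intro density_cong) (auto simp: divide_ennreal[symmetric] split: split_indicator)
  have "(LINT \<zeta>|circ. g \<zeta>) = (LINT \<zeta>|distr ?U (restrict_space borel (sphere 0 1)) cis. g \<zeta>)"
    unfolding circ_def by (rule integral_completion) (simp add: gm)
  also have "\<dots> = (LINT t|?U. g (cis t))"
    by (rule integral_distr) (simp_all add: measurable_cis_circle gm cong: measurable_cong_sets)
  also have "\<dots> = (LINT t|lborel. (indicator {0..2 * pi} t / (2 * pi)) *\<^sub>R g (cis t))"
    unfolding U by (rule integral_density) (use gc in auto)
  also have "\<dots> = (LINT t|lborel. (1 / (2 * pi)) *\<^sub>R (indicator {0..2 * pi} t *\<^sub>R g (cis t)))"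
    by simp
  also have "\<dots> = (1 / (2 * pi)) *\<^sub>R (LINT t:{0..2*pi}|lborel. g (cis t))"
    unfolding set_lebesgue_integral_def by (rule integral_scaleR_right)
  also have "(LINT t:{0..2*pi}|lborel. g (cis t)) = integral {0..2*pi} (\<lambda>t. g (cis t))"
    by (intro set_borel_integral_eq_integral borel_integrable_compact[unfolded set_integrable_def[symmetric]]
          continuous_on_compose2[OF g] continuous_intros)
       (auto simp: set_integrable_def intro!: borel_integrable_compact continuous_on_compose2[OF g] continuous_intros)
  finally show ?thesis by (simp add: scaleR_conv_of_real divide_simps)
qed

text \<open>
  Along \<open>\<zeta> = cis t\<close> the normalized measure is \<open>d\<zeta> / (2\<pi>i \<zeta>)\<close>, which is how Cauchy's formula enters.
\<close>

lemma integral_circ_eq_contour_integral: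
  assumes g: "continuous_on (sphere 0 1) g"
  shows "(LINT \<zeta>|circ. g \<zeta>) = contour_integral (circlepath 0 1) (\<lambda>\<zeta>. g \<zeta> / \<zeta>) / (2 * pi * \<i>)"
  unfolding integral_circ_eq_integral_cis[OF g] circlepath_def
  by (subst contour_integral_part_circlepath_eq) (auto simp: field_simps)

section \<open>Square-integrable functions and orthonormal systems\<close>

lemma L2_measurable [measurable_dest]: "g \<in> L2 \<Longrightarrow> g \<in> borel_measurable circ"
  by (simp add: L2_def)

lemma L2_integrable: "g \<in> L2 \<Longrightarrow> integrable circ (\<lambda>\<zeta>. (cmod (g \<zeta>))\<^sup>2)"
  by (simp add: L2_def)

lemma Linf_measurable [measurable_dest]: "g \<in> Linf \<Longrightarrow> g \<in> borel_measurable circ"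
  by (simp add: Linf_def)

lemma LinfE:
  assumes "\<phi> \<in> Linf"
  obtains C where "C \<ge> 0" "AE \<zeta> in circ. cmod (\<phi> \<zeta>) \<le> C"
proof -
  from assms obtain C where "AE \<zeta> in circ. cmod (\<phi> \<zeta>) \<le> C" by (auto simp: Linf_def)
  then have "AE \<zeta> in circ. cmod (\<phi> \<zeta>) \<le> max 0 C" by (auto elim!: eventually_mono)
  then show ?thesis using that[of "max 0 C"] by simp
qed

definition l2_sq :: "(complex \<Rightarrow> complex) \<Rightarrow> real" where
  "l2_sq g = (LINT \<zeta>|circ. (cmod (g \<zeta>))\<^sup>2)"

lemma l2_sq_nonneg [simp]: "l2_sq g \<ge> 0"
  unfolding l2_sq_def by (rule integral_nonneg_AE) simp

lemma L2_inner_integrable: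
  assumes g: "g \<in> L2" and h: "h \<in> L2"
  shows "integrable circ (\<lambda>\<zeta>. g \<zeta> * cnj (h \<zeta>))"
proof (rule Bochner_Integration.integrable_bound)
  show "integrable circ (\<lambda>\<zeta>. (cmod (g \<zeta>))\<^sup>2 + (cmod (h \<zeta>))\<^sup>2)"
    using g h by (intro Bochner_Integration.integrable_add L2_integrable)
  show "(\<lambda>\<zeta>. g \<zeta> * cnj (h \<zeta>)) \<in> borel_measurable circ"
    using g h by (auto dest!: L2_measurable intro!: borel_measurable_times
        measurable_compose[OF _ borel_measurable_continuous_onI[OF continuous_on_cnj[OF continuous_on_id]]])
  have "x * y \<le> x\<^sup>2 + y\<^sup>2" if "x \<ge> 0" "y \<ge> 0" for x y :: real
    using sum_squares_bound[of x y] mult_nonneg_nonneg[OF that] by linarith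
  then show "AE x in circ. norm (g x * cnj (h x)) \<le> norm ((cmod (g x))\<^sup>2 + (cmod (h x))\<^sup>2)"
    by (intro AE_I2) (simp add: norm_mult)
qed

lemma measurable_cnj [measurable]: "f \<in> borel_measurable M \<Longrightarrow> (\<lambda>x. cnj (f x)) \<in> borel_measurable M"
  by (rule measurable_compose[OF _ borel_measurable_continuous_onI[OF continuous_on_cnj[OF continuous_on_id]]])

lemma L2_I:
  assumes "g \<in> borel_measurable circ" "integrable circ B" "\<And>\<zeta>. cmod \<zeta> = 1 \<Longrightarrow> (cmod (g \<zeta>))\<^sup>2 \<le> B \<zeta>"
  shows "g \<in> L2"
  unfolding L2_def
proof (intro CollectI conjI)
  show "integrable circ (\<lambda>\<zeta>. (cmod (g \<zeta>))\<^sup>2)"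
    by (rule Bochner_Integration.integrable_bound[OF assms(2)])
       (use assms in \<open>auto intro!: AE_circI simp: abs_le_iff intro: order_trans[OF _ abs_ge_self]\<close>)
qed fact

lemma cmod_add_sq_le: "(cmod (a + b))\<^sup>2 \<le> 2 * (cmod a)\<^sup>2 + 2 * (cmod b)\<^sup>2"
proof -
  have "(cmod (a + b))\<^sup>2 \<le> (cmod a + cmod b)\<^sup>2"
    by (intro power_mono norm_triangle_ineq) auto
  also have "\<dots> \<le> 2 * (cmod a)\<^sup>2 + 2 * (cmod b)\<^sup>2"
    using sum_squares_bound[of "cmod a" "cmod b"] by (simp add: power2_sum)
  finally show ?thesis .
qed

lemma L2_add [intro]:
  assumes "g \<in> L2" "h \<in> L2"
  shows "(\<lambda>\<zeta>. g \<zeta> + h \<zeta>) \<in> L2"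
  by (rule L2_I[of _ "\<lambda>\<zeta>. 2 * (cmod (g \<zeta>))\<^sup>2 + 2 * (cmod (h \<zeta>))\<^sup>2"])
     (use assms in \<open>auto intro!: cmod_add_sq_le Bochner_Integration.integrable_add L2_integrable
        borel_measurable_add L2_measurable\<close>)

lemma L2_cmult [intro]:
  assumes "g \<in> L2"
  shows "(\<lambda>\<zeta>. c * g \<zeta>) \<in> L2"
  by (rule L2_I[of _ "\<lambda>\<zeta>. (cmod c)\<^sup>2 * (cmod (g \<zeta>))\<^sup>2"])
     (use assms in \<open>auto simp: norm_mult power_mult_distrib dest: L2_measurable L2_integrable\<close>)

lemma L2_zero [intro, simp]: "(\<lambda>\<zeta>. 0) \<in> L2"
  by (simp add: L2_def)

lemma L2_diff [intro]: "g \<in> L2 \<Longrightarrow> h \<in> L2 \<Longrightarrow> (\<lambda>\<zeta>. g \<zeta> - h \<zeta>) \<in> L2"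
  using L2_add[OF _ L2_cmult[of h "-1"], of g] by simp

lemma L2_sum [intro]: "(\<And>i. i \<in> I \<Longrightarrow> g i \<in> L2) \<Longrightarrow> (\<lambda>\<zeta>. \<Sum>i\<in>I. g i \<zeta>) \<in> L2"
  by (induction I rule: infinite_finite_induct) auto

lemma L2_continuous [intro]:
  assumes "continuous_on (sphere 0 1) g"
  shows "g \<in> L2"
  unfolding L2_def
  by (intro CollectI conjI measurable_circ_continuous integrable_circ_continuous assms continuous_intros)

lemma Linf_continuous [intro]:
  assumes g: "continuous_on (sphere 0 1) g"
  shows "g \<in> Linf"
proof -
  have "compact (g ` sphere 0 1)" by (intro compact_continuous_image g) auto
  then obtain C where "\<forall>x\<in>sphere 0 1. norm (g x) \<le> C"
    by (meson bounded_iff compact_imp_bounded imageI)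
  then have "AE \<zeta> in circ. cmod (g \<zeta>) \<le> C" by (intro AE_circI) auto
  then show ?thesis using measurable_circ_continuous[OF g] by (auto simp: Linf_def)
qed

lemma L2_AE_cong:
  assumes g: "g \<in> L2" and ae: "AE \<zeta> in circ. g \<zeta> = h \<zeta>"
  shows "h \<in> L2"
proof -
  have h: "h \<in> borel_measurable circ" by (rule measurable_circ_AE_cong[OF L2_measurable[OF g] ae])
  have "integrable circ (\<lambda>\<zeta>. (cmod (h \<zeta>))\<^sup>2)"
    using L2_integrable[OF g] h L2_measurable[OF g]
    by (subst integrable_cong_AE[of _ _ "\<lambda>\<zeta>. (cmod (g \<zeta>))\<^sup>2"]) (use ae in \<open>auto elim!: eventually_mono\<close>)
  with h show ?thesis by (simp add: L2_def)
qed

lemma L2_mult_bounded: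
  assumes \<phi>: "\<phi> \<in> borel_measurable circ" "AE \<zeta> in circ. cmod (\<phi> \<zeta>) \<le> C" and g: "g \<in> L2"
  shows "(\<lambda>\<zeta>. \<phi> \<zeta> * g \<zeta>) \<in> L2" and "l2_sq (\<lambda>\<zeta>. \<phi> \<zeta> * g \<zeta>) \<le> C\<^sup>2 * l2_sq g"
proof -
  have m: "(\<lambda>\<zeta>. \<phi> \<zeta> * g \<zeta>) \<in> borel_measurable circ"
    using \<phi>(1) L2_measurable[OF g] by measurable
  have b: "AE \<zeta> in circ. (cmod (\<phi> \<zeta> * g \<zeta>))\<^sup>2 \<le> C\<^sup>2 * (cmod (g \<zeta>))\<^sup>2"
    using \<phi>(2) by eventually_elim (auto simp: norm_mult power_mult_distrib intro!: mult_right_mono power_mono)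
  have i: "integrable circ (\<lambda>\<zeta>. C\<^sup>2 * (cmod (g \<zeta>))\<^sup>2)" using L2_integrable[OF g] by simp
  have i2: "integrable circ (\<lambda>\<zeta>. (cmod (\<phi> \<zeta> * g \<zeta>))\<^sup>2)"
    by (rule Bochner_Integration.integrable_bound[OF i]) (use m b in auto)
  show "(\<lambda>\<zeta>. \<phi> \<zeta> * g \<zeta>) \<in> L2" using m i2 by (simp add: L2_def)
  have "l2_sq (\<lambda>\<zeta>. \<phi> \<zeta> * g \<zeta>) \<le> (LINT \<zeta>|circ. C\<^sup>2 * (cmod (g \<zeta>))\<^sup>2)"
    unfolding l2_sq_def by (rule integral_mono_AE[OF i2 i b])
  then show "l2_sq (\<lambda>\<zeta>. \<phi> \<zeta> * g \<zeta>) \<le> C\<^sup>2 * l2_sq g" by (simp add: l2_sq_def)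
qed

lemma L2_mult [intro]: "\<phi> \<in> Linf \<Longrightarrow> g \<in> L2 \<Longrightarrow> (\<lambda>\<zeta>. \<phi> \<zeta> * g \<zeta>) \<in> L2"
  by (auto simp: Linf_def intro: L2_mult_bounded)

lemma Linf_cnj [intro]: "\<phi> \<in> Linf \<Longrightarrow> (\<lambda>\<zeta>. cnj (\<phi> \<zeta>)) \<in> Linf"
  by (auto simp: Linf_def)

lemma Linf_mult [intro]:
  assumes "\<phi> \<in> Linf" "\<psi> \<in> Linf"
  shows "(\<lambda>\<zeta>. \<phi> \<zeta> * \<psi> \<zeta>) \<in> Linf"
proof -
  obtain C D where "C \<ge> 0" and C: "AE \<zeta> in circ. cmod (\<phi> \<zeta>) \<le> C"
    and "D \<ge> 0" and D: "AE \<zeta> in circ. cmod (\<psi> \<zeta>) \<le> D"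
    using assms by (elim LinfE) auto
  have "AE \<zeta> in circ. cmod (\<phi> \<zeta> * \<psi> \<zeta>) \<le> C * D"
    using C D by eventually_elim (use \<open>C \<ge> 0\<close> in \<open>auto simp: norm_mult intro!: mult_mono\<close>)
  then show ?thesis using assms by (auto simp: Linf_def)
qed

lemma Linf_add [intro]:
  assumes "\<phi> \<in> Linf" "\<psi> \<in> Linf"
  shows "(\<lambda>\<zeta>. \<phi> \<zeta> + \<psi> \<zeta>) \<in> Linf"
proof -
  obtain C D where C: "AE \<zeta> in circ. cmod (\<phi> \<zeta>) \<le> C" and D: "AE \<zeta> in circ. cmod (\<psi> \<zeta>) \<le> D"
    using assms by (auto simp: Linf_def)
  have "AE \<zeta> in circ. cmod (\<phi> \<zeta> + \<psi> \<zeta>) \<le> C + D"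
    using C D by eventually_elim (rule norm_triangle_mono)
  then show ?thesis using assms by (auto simp: Linf_def)
qed

lemma Linf_const [intro, simp]: "(\<lambda>\<zeta>. c) \<in> Linf"
  by (rule Linf_continuous) auto

lemma Linf_diff [intro]: "\<phi> \<in> Linf \<Longrightarrow> \<psi> \<in> Linf \<Longrightarrow> (\<lambda>\<zeta>. \<phi> \<zeta> - \<psi> \<zeta>) \<in> Linf"
  using Linf_add[OF _ Linf_mult[OF Linf_const[of "-1"]], of \<phi> \<psi>] by simp

lemma Linf_power [intro]: "\<phi> \<in> Linf \<Longrightarrow> (\<lambda>\<zeta>. \<phi> \<zeta> ^ k) \<in> Linf"
  by (induction k) auto

lemma l2_inner_add_left: "g \<in> L2 \<Longrightarrow> g' \<in> L2 \<Longrightarrow> h \<in> L2 \<Longrightarrow>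
    l2_inner (\<lambda>\<zeta>. g \<zeta> + g' \<zeta>) h = l2_inner g h + l2_inner g' h"
  unfolding l2_inner_def by (simp add: distrib_right L2_inner_integrable)

lemma l2_inner_diff_left: "g \<in> L2 \<Longrightarrow> g' \<in> L2 \<Longrightarrow> h \<in> L2 \<Longrightarrow>
    l2_inner (\<lambda>\<zeta>. g \<zeta> - g' \<zeta>) h = l2_inner g h - l2_inner g' h"
  unfolding l2_inner_def by (simp add: left_diff_distrib L2_inner_integrable)

lemma l2_inner_cmult_left: "l2_inner (\<lambda>\<zeta>. c * g \<zeta>) h = c * l2_inner g h"
  unfolding l2_inner_def by (simp add: mult.assoc)

lemma l2_inner_commute: "l2_inner h g = cnj (l2_inner g h)"
  unfolding l2_inner_def Bochner_Integration.integral_cnj[symmetric] by (simp add: mult.commute)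

lemma l2_inner_cmult_right: "l2_inner g (\<lambda>\<zeta>. c * h \<zeta>) = cnj c * l2_inner g h"
  unfolding l2_inner_commute[of g] l2_inner_cmult_left by simp

lemma l2_inner_add_right: "g \<in> L2 \<Longrightarrow> h \<in> L2 \<Longrightarrow> h' \<in> L2 \<Longrightarrow>
    l2_inner g (\<lambda>\<zeta>. h \<zeta> + h' \<zeta>) = l2_inner g h + l2_inner g h'"
  unfolding l2_inner_commute[of g] by (simp add: l2_inner_add_left)

lemma l2_inner_zero_left [simp]: "l2_inner (\<lambda>\<zeta>. 0) h = 0"
  by (simp add: l2_inner_def)

lemma l2_inner_sum_left: "(\<And>i. i \<in> I \<Longrightarrow> g i \<in> L2) \<Longrightarrow> h \<in> L2 \<Longrightarrow>
    l2_inner (\<lambda>\<zeta>. \<Sum>i\<in>I. g i \<zeta>) h = (\<Sum>i\<in>I. l2_inner (g i) h)"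
  by (induction I rule: infinite_finite_induct) (auto simp: l2_inner_add_left L2_sum)

lemma l2_inner_lincomb_left: "(\<And>i. i \<in> I \<Longrightarrow> g i \<in> L2) \<Longrightarrow> h \<in> L2 \<Longrightarrow>
    l2_inner (\<lambda>\<zeta>. \<Sum>i\<in>I. c i * g i \<zeta>) h = (\<Sum>i\<in>I. c i * l2_inner (g i) h)"
  by (subst l2_inner_sum_left) (auto simp: l2_inner_cmult_left)

lemma l2_inner_lincomb_right: "(\<And>i. i \<in> I \<Longrightarrow> g i \<in> L2) \<Longrightarrow> h \<in> L2 \<Longrightarrow>
    l2_inner h (\<lambda>\<zeta>. \<Sum>i\<in>I. c i * g i \<zeta>) = (\<Sum>i\<in>I. cnj (c i) * l2_inner h (g i))"
  unfolding l2_inner_commute[of h] by (simp add: l2_inner_lincomb_left)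

lemma l2_inner_cong_AE:
  assumes "g \<in> L2" "h \<in> L2" "AE \<zeta> in circ. g \<zeta> = g' \<zeta>" "AE \<zeta> in circ. h \<zeta> = h' \<zeta>"
  shows "l2_inner g h = l2_inner g' h'"
proof -
  have "g' \<in> L2" "h' \<in> L2" using assms L2_AE_cong by blast+
  then show ?thesis unfolding l2_inner_def
    by (intro integral_cong_AE) (use assms in \<open>auto dest!: L2_measurable elim: eventually_elim2\<close>)
qed

lemma l2_inner_cong:
  assumes "\<And>\<zeta>. cmod \<zeta> = 1 \<Longrightarrow> g \<zeta> = g' \<zeta>" "\<And>\<zeta>. cmod \<zeta> = 1 \<Longrightarrow> h \<zeta> = h' \<zeta>"
  shows "l2_inner g h = l2_inner g' h'"
  unfolding l2_inner_def by (rule integral_circ_cong) (simp add: assms)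

lemma l2_inner_mult_left: "l2_inner (\<lambda>\<zeta>. \<phi> \<zeta> * g \<zeta>) h = l2_inner g (\<lambda>\<zeta>. cnj (\<phi> \<zeta>) * h \<zeta>)"
  by (simp add: l2_inner_def mult_ac)

lemma l2_sq_eq_inner: "of_real (l2_sq g) = l2_inner g g"
  unfolding l2_sq_def l2_inner_def integral_complex_of_real[symmetric] complex_norm_square ..

lemma l2_sq_cong_AE:
  assumes "g \<in> L2" "AE \<zeta> in circ. g \<zeta> = g' \<zeta>"
  shows "l2_sq g = l2_sq g'"
  using l2_inner_cong_AE[OF assms(1,1,2,2)] unfolding l2_sq_eq_inner[symmetric] by simp

lemma l2_sq_cmult: "l2_sq (\<lambda>\<zeta>. c * g \<zeta>) = (cmod c)\<^sup>2 * l2_sq g"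
  by (simp add: l2_sq_def norm_mult power_mult_distrib)

lemma l2_sq_add_le:
  assumes "g \<in> L2" "h \<in> L2"
  shows "l2_sq (\<lambda>\<zeta>. g \<zeta> + h \<zeta>) \<le> 2 * l2_sq g + 2 * l2_sq h"
proof -
  have "l2_sq (\<lambda>\<zeta>. g \<zeta> + h \<zeta>) \<le> (LINT \<zeta>|circ. 2 * (cmod (g \<zeta>))\<^sup>2 + 2 * (cmod (h \<zeta>))\<^sup>2)"
    unfolding l2_sq_def
    by (intro integral_mono_AE AE_I2 cmod_add_sq_le)
       (use assms in \<open>auto intro!: L2_integrable L2_add\<close>)
  also have "\<dots> = 2 * l2_sq g + 2 * l2_sq h"
    using assms by (simp add: l2_sq_def L2_integrable)
  finally show ?thesis .
qed

lemma l2_sq_eq_0: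
  assumes "g \<in> L2" "l2_sq g = 0"
  shows "AE \<zeta> in circ. g \<zeta> = 0"
proof -
  have "AE \<zeta> in circ. (cmod (g \<zeta>))\<^sup>2 = 0"
    using assms integral_nonneg_eq_0_iff_AE[OF L2_integrable[OF assms(1)]] unfolding l2_sq_def by auto
  then show ?thesis by eventually_elim simp
qed

definition orthonormal :: "nat \<Rightarrow> (nat \<Rightarrow> complex \<Rightarrow> complex) \<Rightarrow> bool" where
  "orthonormal n e \<longleftrightarrow> (\<forall>i<n. e i \<in> L2) \<and> (\<forall>i<n. \<forall>j<n. l2_inner (e i) (e j) = (if i = j then 1 else 0))"

definition proj :: "nat \<Rightarrow> (nat \<Rightarrow> complex \<Rightarrow> complex) \<Rightarrow> (complex \<Rightarrow> complex) \<Rightarrow> complex \<Rightarrow> complex" where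
  "proj n e h = (\<lambda>\<zeta>. \<Sum>i<n. l2_inner h (e i) * e i \<zeta>)"

lemma orthonormal_L2: "orthonormal n e \<Longrightarrow> i < n \<Longrightarrow> e i \<in> L2"
  by (simp add: orthonormal_def)

lemma orthonormal_inner:
  "orthonormal n e \<Longrightarrow> i < n \<Longrightarrow> j < n \<Longrightarrow> l2_inner (e i) (e j) = (if i = j then 1 else 0)"
  by (simp add: orthonormal_def)

lemma orthonormal_lincomb_L2: "orthonormal n e \<Longrightarrow> (\<lambda>\<zeta>. \<Sum>i<n. c i * e i \<zeta>) \<in> L2"
  by (intro L2_sum L2_cmult) (auto simp: orthonormal_L2)

lemma proj_L2: "orthonormal n e \<Longrightarrow> proj n e h \<in> L2"
  unfolding proj_def by (rule orthonormal_lincomb_L2)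

lemma orthonormal_lincomb_inner:
  assumes "orthonormal n e" "j < n"
  shows "l2_inner (\<lambda>\<zeta>. \<Sum>i<n. c i * e i \<zeta>) (e j) = c j"
proof -
  have "l2_inner (\<lambda>\<zeta>. \<Sum>i<n. c i * e i \<zeta>) (e j) = (\<Sum>i<n. c i * l2_inner (e i) (e j))"
    by (rule l2_inner_lincomb_left) (use assms in \<open>auto simp: orthonormal_L2\<close>)
  also have "\<dots> = (\<Sum>i<n. if i = j then c i else 0)"
    by (intro sum.cong) (use assms in \<open>auto simp: orthonormal_inner\<close>)
  also have "\<dots> = c j" using assms(2) by simp
  finally show ?thesis .
qed

lemma proj_inner: "orthonormal n e \<Longrightarrow> j < n \<Longrightarrow> l2_inner (proj n e h) (e j) = l2_inner h (e j)"
  unfolding proj_def by (rule orthonormal_lincomb_inner)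

lemma orthonormal_lincomb_sq:
  assumes "orthonormal n e"
  shows "l2_sq (\<lambda>\<zeta>. \<Sum>i<n. c i * e i \<zeta>) = (\<Sum>i<n. (cmod (c i))\<^sup>2)"
proof -
  have "complex_of_real (l2_sq (\<lambda>\<zeta>. \<Sum>i<n. c i * e i \<zeta>)) = (\<Sum>i<n. cnj (c i) * c i)"
    unfolding l2_sq_eq_inner
    by (subst l2_inner_lincomb_right)
       (use assms in \<open>auto simp: orthonormal_L2 orthonormal_lincomb_L2 orthonormal_lincomb_inner\<close>)
  also have "\<dots> = complex_of_real (\<Sum>i<n. (cmod (c i))\<^sup>2)"
    by (simp add: complex_norm_square mult.commute del: of_real_power)
  finally show ?thesis unfolding of_real_eq_iff .
qed

lemma orthogonal_lincomb:
  assumes "orthonormal n e" "h \<in> L2" "\<And>i. i < n \<Longrightarrow> l2_inner h (e i) = 0"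
  shows "l2_inner h (\<lambda>\<zeta>. \<Sum>i<n. c i * e i \<zeta>) = 0"
  by (subst l2_inner_lincomb_right) (use assms in \<open>auto simp: orthonormal_L2\<close>)

lemma l2_sq_pythagoras:
  assumes "g \<in> L2" "h \<in> L2" "l2_inner g h = 0"
  shows "l2_sq (\<lambda>\<zeta>. g \<zeta> + h \<zeta>) = l2_sq g + l2_sq h"
proof -
  have "l2_inner h g = 0" using assms(3) by (subst l2_inner_commute) simp
  with assms have "complex_of_real (l2_sq (\<lambda>\<zeta>. g \<zeta> + h \<zeta>)) = complex_of_real (l2_sq g + l2_sq h)"
    unfolding of_real_add l2_sq_eq_inner by (simp add: l2_inner_add_left l2_inner_add_right L2_add)
  then show ?thesis unfolding of_real_eq_iff .
qed

text \<open>
  The projection and the remainder are orthogonal; Bessel's inequality and the contractivity of the projection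
  and of its complement are the two halves of this identity.
\<close>

lemma proj_pythagoras:
  assumes e: "orthonormal n e" and h: "h \<in> L2"
  shows "l2_sq h = (\<Sum>i<n. (cmod (l2_inner h (e i)))\<^sup>2) + l2_sq (\<lambda>\<zeta>. h \<zeta> - proj n e h \<zeta>)"
proof -
  have d: "(\<lambda>\<zeta>. h \<zeta> - proj n e h \<zeta>) \<in> L2" using e h by (intro L2_diff proj_L2)
  have "l2_inner (\<lambda>\<zeta>. h \<zeta> - proj n e h \<zeta>) (proj n e h) = 0"
    unfolding proj_def[of n e h, THEN arg_cong[of _ _ "l2_inner (\<lambda>\<zeta>. h \<zeta> - proj n e h \<zeta>)"]]
    by (rule orthogonal_lincomb[OF e d])
       (use e h in \<open>simp add: l2_inner_diff_left proj_L2 orthonormal_L2 proj_inner\<close>)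
  then have "l2_inner (proj n e h) (\<lambda>\<zeta>. h \<zeta> - proj n e h \<zeta>) = 0" by (subst l2_inner_commute) simp
  from l2_sq_pythagoras[OF proj_L2[OF e] d this]
  show ?thesis by (simp add: orthonormal_lincomb_sq[OF e] proj_def)
qed

lemma bessel:
  assumes "orthonormal n e" "h \<in> L2"
  shows "(\<Sum>i<n. (cmod (l2_inner h (e i)))\<^sup>2) \<le> l2_sq h"
  using proj_pythagoras[OF assms] by simp

lemma proj_sq_le:
  assumes "orthonormal n e" "h \<in> L2"
  shows "l2_sq (proj n e h) \<le> l2_sq h"
  using bessel[OF assms] orthonormal_lincomb_sq[OF assms(1)] by (simp add: proj_def)

lemma coproj_sq_le:
  assumes "orthonormal n e" "h \<in> L2"
  shows "l2_sq (\<lambda>\<zeta>. h \<zeta> - proj n e h \<zeta>) \<le> l2_sq h"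
  using proj_pythagoras[OF assms] by (simp add: sum_nonneg)

text \<open>
  Bessel's inequality for the single vector \<open>h\<close> after normalization.
\<close>

lemma l2_cauchy_schwarz:
  assumes g: "g \<in> L2" and h: "h \<in> L2"
  shows "(cmod (l2_inner g h))\<^sup>2 \<le> l2_sq g * l2_sq h"
proof (cases "l2_sq h = 0")
  case True
  from l2_sq_eq_0[OF h this] have "l2_inner g h = l2_inner g (\<lambda>_. 0)"
    by (intro l2_inner_cong_AE g h) auto
  also have "\<dots> = 0" by (subst l2_inner_commute) simp
  finally show ?thesis by simp
next
  case False
  then have pos: "l2_sq h > 0" by (simp add: order_less_le)
  define c where "c = 1 / sqrt (l2_sq h)"
  have c: "c * c * l2_sq h = 1" "c\<^sup>2 = 1 / l2_sq h" using pos by (simp_all add: c_def power_divide)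
  define e where "e = (\<lambda>(i::nat) \<zeta>. complex_of_real c * h \<zeta>)"
  have "l2_inner (e 0) (e 0) = complex_of_real (c * c * l2_sq h)"
    unfolding e_def l2_inner_cmult_left l2_inner_cmult_right of_real_mult l2_sq_eq_inner by simp
  then have "l2_inner (e 0) (e 0) = 1" unfolding c by simp
  moreover have "e 0 \<in> L2" unfolding e_def by (rule L2_cmult[OF h])
  ultimately have e: "orthonormal 1 e" by (simp only: orthonormal_def less_one) simp
  have "(cmod (l2_inner g h))\<^sup>2 / l2_sq h = (cmod (l2_inner g (e 0)))\<^sup>2"
    by (simp add: e_def l2_inner_cmult_right norm_mult power_mult_distrib c)
  also have "\<dots> \<le> l2_sq g" using bessel[OF e g] by simp
  finally show ?thesis using pos by (simp add: divide_simps)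
qed

section \<open>The Hardy space\<close>

text \<open>
  Membership in \<^const>\<open>H2\<close> with the analytic extension \<open>F\<close> to the disc made explicit: boundary functions are
  compared by evaluating their extensions at the points of \<open>\<Lambda>\<close>.
\<close>

definition hardy_ext :: "(complex \<Rightarrow> complex) \<Rightarrow> (complex \<Rightarrow> complex) \<Rightarrow> bool" where
  "hardy_ext g F \<longleftrightarrow> g \<in> L2 \<and> F holomorphic_on ball 0 1
     \<and> (\<exists>C. \<forall>r\<in>{0<..<1}. (LINT \<zeta>|circ. (cmod (F (complex_of_real r * \<zeta>)))\<^sup>2) \<le> C)
     \<and> (AE \<zeta> in circ. ((\<lambda>r. F (complex_of_real r * \<zeta>)) \<longlongrightarrow> g \<zeta>) (at_left 1))"

lemma H2_iff_hardy_ext: "g \<in> H2 \<longleftrightarrow> (\<exists>F. hardy_ext g F)"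
  by (auto simp: H2_def hardy_ext_def)

lemma hardy_ext_L2: "hardy_ext g F \<Longrightarrow> g \<in> L2"
  by (simp add: hardy_ext_def)

lemma continuous_on_dilation:
  assumes "F holomorphic_on ball 0 1" "0 < r" "r < 1"
  shows "continuous_on (sphere 0 1) (\<lambda>\<zeta>. F (complex_of_real r * \<zeta>))"
  by (rule continuous_on_compose2[OF holomorphic_on_imp_continuous_on[OF assms(1)]])
     (use assms in \<open>auto intro!: continuous_intros simp: norm_mult\<close>)

lemma L2_dilation:
  assumes "F holomorphic_on ball 0 1" "0 < r" "r < 1"
  shows "(\<lambda>\<zeta>. F (complex_of_real r * \<zeta>)) \<in> L2"
  by (rule L2_continuous[OF continuous_on_dilation[OF assms]])

text \<open>
  A bound in \<open>L\<^sup>2\<close> gives uniform integrability, so that almost everywhere convergence is convergence in \<open>L\<^sup>1\<close>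
  (Vitali), which suffices against a bounded \<open>k\<close>. Uniform integrability is used through
  \<open>t \<le> min t M + t\<^sup>2 / M\<close>: the first term is treated by dominated convergence, the second is small for
  large \<open>M\<close>.
\<close>

lemma l2_weak_limit:
  assumes f: "\<And>n. f n \<in> L2" and g: "g \<in> L2" and k: "k \<in> Linf"
    and C: "\<And>n. l2_sq (f n) \<le> C" and lim: "AE \<zeta> in circ. (\<lambda>n. f n \<zeta>) \<longlonglongrightarrow> g \<zeta>"
  shows "(\<lambda>n. l2_inner (f n) k) \<longlonglongrightarrow> l2_inner g k"
proof -
  define x where "x n \<zeta> = cmod (f n \<zeta> - g \<zeta>)" for n \<zeta>
  define D where "D = 2 * C + 2 * l2_sq g"
  have fg: "(\<lambda>\<zeta>. f n \<zeta> - g \<zeta>) \<in> L2" for n using f g by auto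
  have xm: "x n \<in> borel_measurable circ" for n
    unfolding x_def using L2_measurable[OF fg[of n]] by measurable
  have D: "(LINT \<zeta>|circ. (x n \<zeta>)\<^sup>2) \<le> D" for n
  proof -
    have "l2_sq (\<lambda>\<zeta>. f n \<zeta> + (-1) * g \<zeta>) \<le> 2 * l2_sq (f n) + 2 * l2_sq (\<lambda>\<zeta>. (-1) * g \<zeta>)"
      by (intro l2_sq_add_le f L2_cmult g)
    also have "\<dots> \<le> D" using C[of n] unfolding D_def l2_sq_cmult by simp
    finally show ?thesis by (simp add: l2_sq_def x_def)
  qed
  have xsq: "integrable circ (\<lambda>\<zeta>. (x n \<zeta>)\<^sup>2)" for n
    unfolding x_def by (rule L2_integrable[OF fg])
  have minint: "integrable circ (\<lambda>\<zeta>. min (x n \<zeta>) M)" if "M > 0" for n M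
  proof (rule integrable_circ_bounded[of _ M])
    show "(\<lambda>\<zeta>. min (x n \<zeta>) M) \<in> borel_measurable circ" using xm[of n] by measurable
  qed (use that in \<open>auto simp: x_def\<close>)
  have xint: "integrable circ (x n)" for n
  proof -
    have "t \<le> 1 + t\<^sup>2" if "t \<ge> 0" for t :: real
      using sum_squares_bound[of t 1] that by simp
    then have b: "norm (x n \<zeta>) \<le> norm (1 + (x n \<zeta>)\<^sup>2)" for \<zeta> by (simp add: x_def)
    have "integrable circ (\<lambda>\<zeta>. 1 + (x n \<zeta>)\<^sup>2)"
      by (intro Bochner_Integration.integrable_add xsq circ.integrable_const)
    from Bochner_Integration.integrable_bound[OF this xm AE_I2[OF b]] show ?thesis .
  qed
  have L1: "(\<lambda>n. LINT \<zeta>|circ. x n \<zeta>) \<longlonglongrightarrow> 0"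
  proof (unfold LIMSEQ_iff, intro allI impI)
    fix e :: real assume e: "e > 0"
    \<comment> \<open>makes the tail term D / M smaller than e / 2\<close>
    define M where "M = 2 * (\<bar>D\<bar> + 1) / e"
    have M: "M > 0" using e by (simp add: M_def)
    have DM: "D / M < e / 2"
    proof -
      have "D < \<bar>D\<bar> + 1" by simp
      also have "\<dots> = e / 2 * M" using e by (simp add: M_def)
      finally show ?thesis using M by (simp add: pos_divide_less_eq)
    qed
    have le: "t \<le> min t M + t\<^sup>2 / M" if "t \<ge> 0" for t :: real
    proof (cases "t \<le> M")
      case True then show ?thesis using M by simp
    next
      case False
      then have "t * M \<le> t\<^sup>2" using that by (simp add: power2_eq_square mult_left_mono)
      then have "t \<le> t\<^sup>2 / M" using M by (simp add: pos_le_divide_eq)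
      then show ?thesis using M False by simp
    qed
    have "(\<lambda>n. LINT \<zeta>|circ. min (x n \<zeta>) M) \<longlonglongrightarrow> (LINT \<zeta>|circ. 0)"
    proof (rule integral_dominated_convergence[where w = "\<lambda>_. M"])
      show "(\<lambda>\<zeta>. min (x n \<zeta>) M) \<in> borel_measurable circ" for n
        using xm[of n] by measurable
      show "AE \<zeta> in circ. norm (min (x n \<zeta>) M) \<le> M" for n
        using M by (auto simp: x_def)
      show "AE \<zeta> in circ. (\<lambda>n. min (x n \<zeta>) M) \<longlonglongrightarrow> 0"
        using lim
      proof eventually_elim
        case (elim \<zeta>)
        then have "(\<lambda>n. x n \<zeta>) \<longlonglongrightarrow> 0" unfolding x_def by (intro tendsto_norm_zero) (simp add: LIM_zero)
        then show "(\<lambda>n. min (x n \<zeta>) M) \<longlonglongrightarrow> 0"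
          using tendsto_min[OF _ tendsto_const[of M]] M by fastforce
      qed
    qed auto
    then have "(\<lambda>n. LINT \<zeta>|circ. min (x n \<zeta>) M) \<longlonglongrightarrow> 0" by simp
    then have "eventually (\<lambda>n. (LINT \<zeta>|circ. min (x n \<zeta>) M) < e / 2) sequentially"
      using e by (intro order_tendstoD(2)) auto
    then obtain n0 where n0: "\<And>n. n \<ge> n0 \<Longrightarrow> (LINT \<zeta>|circ. min (x n \<zeta>) M) < e / 2"
      by (auto simp: eventually_sequentially)
    have "norm ((LINT \<zeta>|circ. x n \<zeta>) - 0) < e" if "n \<ge> n0" for n
    proof -
      have "(LINT \<zeta>|circ. x n \<zeta>) \<le> (LINT \<zeta>|circ. min (x n \<zeta>) M + (x n \<zeta>)\<^sup>2 / M)"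
        by (intro integral_mono_AE AE_I2 le Bochner_Integration.integrable_add xint xsq minint M integrable_divide_zero)
           (auto simp: x_def xsq)
      also have "\<dots> = (LINT \<zeta>|circ. min (x n \<zeta>) M) + (LINT \<zeta>|circ. (x n \<zeta>)\<^sup>2) / M"
        by (simp add: minint[OF M] xsq)
      also have "\<dots> < e / 2 + e / 2"
        using n0[OF that] divide_right_mono[OF D[of n], of M] DM M by linarith
      finally have "(LINT \<zeta>|circ. x n \<zeta>) < e" by simp
      moreover have "(LINT \<zeta>|circ. x n \<zeta>) \<ge> 0" by (rule integral_nonneg_AE) (auto simp: x_def)
      ultimately show ?thesis by simp
    qed
    then show "\<exists>no. \<forall>n\<ge>no. norm ((LINT \<zeta>|circ. x n \<zeta>) - 0) < e" by blast
  qed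
  obtain K where K: "K \<ge> 0" "AE \<zeta> in circ. cmod (k \<zeta>) \<le> K" using k by (rule LinfE)
  have kL2: "k \<in> L2" using L2_mult[OF k L2_continuous[of "\<lambda>_. 1"]] by simp
  have "cmod (l2_inner (f n) k - l2_inner g k) \<le> (LINT \<zeta>|circ. x n \<zeta>) * K" for n
  proof -
    have "l2_inner (f n) k - l2_inner g k = (LINT \<zeta>|circ. (f n \<zeta> - g \<zeta>) * cnj (k \<zeta>))"
      using l2_inner_diff_left[OF f g kL2, of n] by (simp add: l2_inner_def)
    also have "cmod \<dots> \<le> (LINT \<zeta>|circ. x n \<zeta> * K)"
    proof (rule order_trans[OF integral_norm_bound integral_mono_AE])
      show "integrable circ (\<lambda>\<zeta>. norm ((f n \<zeta> - g \<zeta>) * cnj (k \<zeta>)))"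
        by (rule integrable_norm[OF L2_inner_integrable[OF fg kL2]])
      show "integrable circ (\<lambda>\<zeta>. x n \<zeta> * K)" using xint by simp
      show "AE \<zeta> in circ. norm ((f n \<zeta> - g \<zeta>) * cnj (k \<zeta>)) \<le> x n \<zeta> * K"
        using K(2) by eventually_elim (auto simp: norm_mult x_def intro!: mult_left_mono)
    qed
    finally show ?thesis by simp
  qed
  then have "(\<lambda>n. l2_inner (f n) k - l2_inner g k) \<longlonglongrightarrow> 0"
    by (rule Lim_null_comparison[OF always_eventually[OF allI] tendsto_mult_left_zero[OF L1]])
  then show ?thesis by (rule LIM_zero_cancel)
qed

lemma circle_mult_cnj: "cmod \<zeta> = 1 \<Longrightarrow> \<zeta> * cnj \<zeta> = 1"
  by (simp flip: complex_norm_square)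

definition szego_kernel :: "complex \<Rightarrow> complex \<Rightarrow> complex" where
  "szego_kernel w \<zeta> = 1 / (1 - cnj w * \<zeta>)"

lemma szego_denominator_nonzero: "cmod w < 1 \<Longrightarrow> cmod \<zeta> \<le> 1 \<Longrightarrow> 1 - cnj w * \<zeta> \<noteq> 0"
proof
  assume l: "cmod w < 1" and z: "cmod \<zeta> \<le> 1" and "1 - cnj w * \<zeta> = 0"
  then have "cmod (cnj w * \<zeta>) = 1" by simp
  moreover have "cmod (cnj w * \<zeta>) \<le> cmod w * 1"
    unfolding norm_mult complex_mod_cnj using z by (rule mult_left_mono) simp
  ultimately show False using l by simp
qed

lemma continuous_on_szego_kernel: "cmod w < 1 \<Longrightarrow> continuous_on (sphere 0 1) (szego_kernel w)"
  unfolding szego_kernel_def using szego_denominator_nonzero[of w]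
  by (intro continuous_intros) auto

text \<open>
  On the circle the conjugate of the Szego kernel is \<open>\<zeta> / (\<zeta> - w)\<close>, so for the dilations of \<open>F\<close> this is
  Cauchy's formula; the dilations converge to \<open>g\<close> almost everywhere with bounded norms.
\<close>

lemma hardy_reproducing:
  assumes h: "hardy_ext g F" and l: "cmod w < 1"
  shows "l2_inner g (szego_kernel w) = F w"
proof -
  have g: "g \<in> L2" and F: "F holomorphic_on ball 0 1"
    and lim: "AE \<zeta> in circ. ((\<lambda>r. F (complex_of_real r * \<zeta>)) \<longlongrightarrow> g \<zeta>) (at_left 1)"
    using h by (auto simp: hardy_ext_def)
  from h obtain C where C: "\<And>r. r\<in>{0<..<1} \<Longrightarrow> (LINT \<zeta>|circ. (cmod (F (complex_of_real r * \<zeta>)))\<^sup>2) \<le> C"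
    unfolding hardy_ext_def by blast
  define r where "r n = 1 - inverse (real (Suc (Suc n)))" for n
  have r: "0 < r n" "r n < 1" for n by (auto simp: r_def divide_simps)
  have rlim: "r \<longlonglongrightarrow> 1"
    using tendsto_diff[OF tendsto_const[of 1] LIMSEQ_Suc[OF LIMSEQ_inverse_real_of_nat]]
    unfolding r_def[abs_def] diff_zero .
  then have rleft: "filterlim r (at_left 1) sequentially"
    using r by (intro filterlim_at_withinI) auto
  have kc: "continuous_on (sphere 0 1) (szego_kernel w)" by (rule continuous_on_szego_kernel[OF l])
  have cauchy: "l2_inner (\<lambda>\<zeta>. F (complex_of_real (r n) * \<zeta>)) (szego_kernel w) = F (complex_of_real (r n) * w)" for n
  proof -
    let ?f = "\<lambda>u. F (complex_of_real (r n) * u)"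
    have hol: "?f holomorphic_on cball 0 1"
    proof (rule holomorphic_on_compose[of "\<lambda>u. complex_of_real (r n) * u" _ F, unfolded comp_def])
      show "F holomorphic_on (*) (complex_of_real (r n)) ` cball 0 1"
      proof (rule holomorphic_on_subset[OF F], safe)
        fix u :: complex assume "u \<in> cball 0 1"
        then have "r n * cmod u \<le> r n * 1" using r[of n] by (intro mult_left_mono) auto
        also have "\<dots> < 1" using r by simp
        finally show "complex_of_real (r n) * u \<in> ball 0 1" using r[of n] by (simp add: norm_mult)
      qed
    qed (auto intro!: holomorphic_intros)
    have ne: "\<zeta> \<noteq> w" "\<zeta> \<noteq> 0" if "cmod \<zeta> = 1" for \<zeta> using l that by auto
    have *: "?f \<zeta> * cnj (szego_kernel w \<zeta>) = ?f \<zeta> * (\<zeta> / (\<zeta> - w))" if z: "cmod \<zeta> = 1" for \<zeta>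
    proof -
      have c: "cnj \<zeta> = 1 / \<zeta>" using circle_mult_cnj[OF z] ne[OF z] by (simp add: field_simps)
      have "1 - w * cnj \<zeta> = (\<zeta> - w) / \<zeta>" unfolding c using ne[OF z] by (simp add: diff_divide_distrib)
      then show ?thesis by (simp add: szego_kernel_def)
    qed
    have "l2_inner ?f (szego_kernel w) = (LINT \<zeta>|circ. ?f \<zeta> * (\<zeta> / (\<zeta> - w)))"
      unfolding l2_inner_def by (rule integral_circ_cong) (rule *)
    also have "\<dots> = contour_integral (circlepath 0 1) (\<lambda>\<zeta>. ?f \<zeta> * (\<zeta> / (\<zeta> - w)) / \<zeta>) / (2 * pi * \<i>)"
      by (rule integral_circ_eq_contour_integral)
         (use ne r in \<open>auto intro!: continuous_intros continuous_on_dilation F\<close>)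
    also have "contour_integral (circlepath 0 1) (\<lambda>\<zeta>. ?f \<zeta> * (\<zeta> / (\<zeta> - w)) / \<zeta>)
       = contour_integral (circlepath 0 1) (\<lambda>\<zeta>. ?f \<zeta> / (\<zeta> - w))"
      by (rule contour_integral_eq) (use ne in auto)
    also have "\<dots> = 2 * pi * \<i> * ?f w"
      by (rule contour_integral_unique) (use Cauchy_integral_circlepath_simple[OF hol, of w] l in simp)
    finally show ?thesis by simp
  qed
  have "(\<lambda>n. l2_inner (\<lambda>\<zeta>. F (complex_of_real (r n) * \<zeta>)) (szego_kernel w)) \<longlonglongrightarrow> l2_inner g (szego_kernel w)"
  proof (rule l2_weak_limit[where C = C])
    show "(\<lambda>\<zeta>. F (complex_of_real (r n) * \<zeta>)) \<in> L2" for n by (intro L2_dilation F r)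
    show "l2_sq (\<lambda>\<zeta>. F (complex_of_real (r n) * \<zeta>)) \<le> C" for n
      unfolding l2_sq_def using C r by simp
    show "AE \<zeta> in circ. (\<lambda>n. F (complex_of_real (r n) * \<zeta>)) \<longlonglongrightarrow> g \<zeta>"
      using lim by eventually_elim (rule filterlim_compose[OF _ rleft])
  qed (use g kc in auto)
  moreover have "(\<lambda>n. F (complex_of_real (r n) * w)) \<longlonglongrightarrow> F w"
  proof -
    have "isCont F w"
      using holomorphic_on_imp_continuous_on[OF F] l by (auto simp: continuous_on_eq_continuous_at)
    moreover have "(\<lambda>n. complex_of_real (r n) * w) \<longlonglongrightarrow> complex_of_real 1 * w"
      by (intro tendsto_intros rlim)
    ultimately show ?thesis unfolding of_real_1 mult_1_left by (rule isCont_tendsto_compose)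
  qed
  ultimately show ?thesis unfolding cauchy by (rule LIMSEQ_unique)
qed

text \<open>
  Functions of this kind need no boundary theory and multiply the Hardy space into itself. Blaschke products,
  Szego kernels and the basis functions of the model spaces all belong to this class.
\<close>

definition hol_closed_disc :: "(complex \<Rightarrow> complex) \<Rightarrow> bool" where
  "hol_closed_disc M \<longleftrightarrow> (\<exists>R>1. M holomorphic_on ball 0 R)"

lemma hol_closed_disc_const [intro, simp]: "hol_closed_disc (\<lambda>_. c)"
  and hol_closed_disc_ident [intro, simp]: "hol_closed_disc (\<lambda>z. z)"
  unfolding hol_closed_disc_def
  by (rule exI[of _ 2], simp add: holomorphic_on_const holomorphic_on_ident)+

lemma hol_closed_disc_mult [intro]:
  assumes "hol_closed_disc f" "hol_closed_disc g"
  shows "hol_closed_disc (\<lambda>z. f z * g z)"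
proof -
  from assms obtain R S where "R > 1" "f holomorphic_on ball 0 R" "S > 1" "g holomorphic_on ball 0 S"
    by (auto simp: hol_closed_disc_def)
  then show ?thesis unfolding hol_closed_disc_def
    by (intro exI[of _ "min R S"]) (auto intro!: holomorphic_on_mult elim: holomorphic_on_subset)
qed

lemma hol_closed_disc_prod [intro]:
  "(\<And>i. i \<in> I \<Longrightarrow> hol_closed_disc (f i)) \<Longrightarrow> hol_closed_disc (\<lambda>z. \<Prod>i\<in>I. f i z)"
  by (induction I rule: infinite_finite_induct) auto

lemma hol_closed_disc_diff [intro]:
  assumes "hol_closed_disc f" "hol_closed_disc g"
  shows "hol_closed_disc (\<lambda>z. f z - g z)"
proof -
  from assms obtain R S where "R > 1" "f holomorphic_on ball 0 R" "S > 1" "g holomorphic_on ball 0 S"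
    by (auto simp: hol_closed_disc_def)
  then show ?thesis unfolding hol_closed_disc_def
    by (intro exI[of _ "min R S"]) (auto intro!: holomorphic_on_diff elim: holomorphic_on_subset)
qed

lemma hol_closed_disc_szego_kernel [intro]:
  assumes l: "cmod w < 1"
  shows "hol_closed_disc (szego_kernel w)"
  unfolding hol_closed_disc_def
proof (intro exI conjI)
  let ?R = "2 / (1 + cmod w)"
  have pos: "1 + cmod w > 0" by (rule add_pos_nonneg) auto
  show "?R > 1" using l pos by (simp add: pos_less_divide_eq)
  have "1 - cnj w * z \<noteq> 0" if "z \<in> ball 0 ?R" for z
  proof
    assume "1 - cnj w * z = 0"
    then have "cmod (cnj w * z) = 1" by simp
    then have "cmod w * cmod z = 1" by (simp only: norm_mult complex_mod_cnj)
    moreover have "cmod w * cmod z \<le> cmod w * ?R"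
      using that by (intro mult_left_mono) auto
    moreover have "cmod w * ?R < 1" using l pos by (simp add: pos_divide_less_eq)
    ultimately show False by simp
  qed
  then show "szego_kernel w holomorphic_on ball 0 ?R"
    unfolding szego_kernel_def by (intro holomorphic_intros) auto
qed

lemma hol_closed_disc_continuous_cball: "hol_closed_disc M \<Longrightarrow> continuous_on (cball 0 1) M"
  unfolding hol_closed_disc_def
  by (auto intro!: holomorphic_on_imp_continuous_on elim!: holomorphic_on_subset)

lemma hol_closed_disc_continuous: "hol_closed_disc M \<Longrightarrow> continuous_on (sphere 0 1) M"
  by (rule continuous_on_subset[OF hol_closed_disc_continuous_cball]) auto

lemma hardy_ext_mult:
  assumes h: "hardy_ext g F" and M: "hol_closed_disc M"
  shows "hardy_ext (\<lambda>\<zeta>. M \<zeta> * g \<zeta>) (\<lambda>z. M z * F z)"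
proof -
  from M obtain R where R: "R > 1" "M holomorphic_on ball 0 R" by (auto simp: hol_closed_disc_def)
  have g: "g \<in> L2" and F: "F holomorphic_on ball 0 1"
    and lim: "AE \<zeta> in circ. ((\<lambda>r. F (complex_of_real r * \<zeta>)) \<longlongrightarrow> g \<zeta>) (at_left 1)"
    using h by (auto simp: hardy_ext_def)
  from h obtain C where C: "\<And>r. r\<in>{0<..<1} \<Longrightarrow> (LINT \<zeta>|circ. (cmod (F (complex_of_real r * \<zeta>)))\<^sup>2) \<le> C"
    unfolding hardy_ext_def by blast
  have "compact (M ` cball 0 1)" by (intro compact_continuous_image hol_closed_disc_continuous_cball M) auto
  then obtain K where K: "\<And>x. x\<in>cball 0 1 \<Longrightarrow> norm (M x) \<le> K"
    by (meson bounded_iff compact_imp_bounded imageI)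
  have "M holomorphic_on ball 0 1" using R by (auto elim!: holomorphic_on_subset)
  with F have MF: "(\<lambda>z. M z * F z) holomorphic_on ball 0 1" by (rule holomorphic_on_mult[rotated])
  have "(LINT \<zeta>|circ. (cmod (M (complex_of_real r * \<zeta>) * F (complex_of_real r * \<zeta>)))\<^sup>2) \<le> K\<^sup>2 * C"
    if r: "r \<in> {0<..<1}" for r
  proof -
    have "(LINT \<zeta>|circ. (cmod (M (complex_of_real r * \<zeta>) * F (complex_of_real r * \<zeta>)))\<^sup>2)
       \<le> (LINT \<zeta>|circ. K\<^sup>2 * (cmod (F (complex_of_real r * \<zeta>)))\<^sup>2)"
    proof (rule integral_mono_AE)
      show "integrable circ (\<lambda>\<zeta>. (cmod (M (complex_of_real r * \<zeta>) * F (complex_of_real r * \<zeta>)))\<^sup>2)"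
        using r by (intro L2_integrable L2_dilation MF) auto
      show "integrable circ (\<lambda>\<zeta>. K\<^sup>2 * (cmod (F (complex_of_real r * \<zeta>)))\<^sup>2)"
        using r by (intro integrable_mult_right L2_integrable L2_dilation F) auto
      show "AE x in circ. (cmod (M (complex_of_real r * x) * F (complex_of_real r * x)))\<^sup>2
         \<le> K\<^sup>2 * (cmod (F (complex_of_real r * x)))\<^sup>2"
        using r by (intro AE_circI) (auto simp: norm_mult power_mult_distrib intro!: mult_right_mono power_mono K)
    qed
    also have "\<dots> = K\<^sup>2 * (LINT \<zeta>|circ. (cmod (F (complex_of_real r * \<zeta>)))\<^sup>2)" by simp
    also have "\<dots> \<le> K\<^sup>2 * C" using C[OF r] by (intro mult_left_mono) auto
    finally show ?thesis .
  qed
  moreover have "AE \<zeta> in circ. ((\<lambda>r. M (complex_of_real r * \<zeta>) * F (complex_of_real r * \<zeta>)) \<longlongrightarrow> M \<zeta> * g \<zeta>) (at_left 1)"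
    using lim AE_space
  proof eventually_elim
    case (elim \<zeta>)
    have "isCont M \<zeta>"
      using holomorphic_on_imp_continuous_on[OF R(2)] R(1) elim by (auto simp: continuous_on_eq_continuous_at)
    moreover have "((\<lambda>r. complex_of_real r * \<zeta>) \<longlongrightarrow> complex_of_real 1 * \<zeta>) (at_left 1)"
      by (intro tendsto_intros)
    ultimately have "((\<lambda>r. M (complex_of_real r * \<zeta>)) \<longlongrightarrow> M \<zeta>) (at_left 1)"
      unfolding of_real_1 mult_1_left by (rule isCont_tendsto_compose)
    with elim show ?case by (intro tendsto_mult)
  qed
  moreover have "(\<lambda>\<zeta>. M \<zeta> * g \<zeta>) \<in> L2"
    using hol_closed_disc_continuous[OF M] g by auto
  ultimately show ?thesis using MF unfolding hardy_ext_def by blast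
qed

lemma hardy_ext_zero: "hardy_ext (\<lambda>_. 0) (\<lambda>_. 0)"
  unfolding hardy_ext_def by (auto intro!: exI[of _ 0])

lemma hardy_ext_one: "hardy_ext (\<lambda>_. 1) (\<lambda>_. 1)"
  unfolding hardy_ext_def by (auto intro!: exI[of _ 1] L2_continuous simp: circ.prob_space)

lemma hardy_ext_self: "hol_closed_disc M \<Longrightarrow> hardy_ext M M"
  using hardy_ext_mult[OF hardy_ext_one, of M] by simp

lemma hardy_ext_add:
  assumes g: "hardy_ext g F" and h: "hardy_ext h G"
  shows "hardy_ext (\<lambda>\<zeta>. g \<zeta> + h \<zeta>) (\<lambda>z. F z + G z)"
proof -
  have F: "F holomorphic_on ball 0 1" and G: "G holomorphic_on ball 0 1"
    using g h by (auto simp: hardy_ext_def)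
  from g obtain C where C: "\<And>r. r\<in>{0<..<1} \<Longrightarrow> (LINT \<zeta>|circ. (cmod (F (complex_of_real r * \<zeta>)))\<^sup>2) \<le> C"
    unfolding hardy_ext_def by blast
  from h obtain D where D: "\<And>r. r\<in>{0<..<1} \<Longrightarrow> (LINT \<zeta>|circ. (cmod (G (complex_of_real r * \<zeta>)))\<^sup>2) \<le> D"
    unfolding hardy_ext_def by blast
  have "(LINT \<zeta>|circ. (cmod (F (complex_of_real r * \<zeta>) + G (complex_of_real r * \<zeta>)))\<^sup>2) \<le> 2 * C + 2 * D"
    if r: "r \<in> {0<..<1}" for r
    using l2_sq_add_le[OF L2_dilation[OF F] L2_dilation[OF G], of r r] C[OF r] D[OF r] r
    unfolding l2_sq_def by auto
  moreover have "AE \<zeta> in circ. ((\<lambda>r. F (complex_of_real r * \<zeta>) + G (complex_of_real r * \<zeta>)) \<longlongrightarrow> g \<zeta> + h \<zeta>) (at_left 1)"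
  proof -
    have "AE \<zeta> in circ. ((\<lambda>r. F (complex_of_real r * \<zeta>)) \<longlongrightarrow> g \<zeta>) (at_left 1)"
      "AE \<zeta> in circ. ((\<lambda>r. G (complex_of_real r * \<zeta>)) \<longlongrightarrow> h \<zeta>) (at_left 1)"
      using g h by (auto simp: hardy_ext_def)
    then show ?thesis by eventually_elim (rule tendsto_add)
  qed
  moreover have "(\<lambda>\<zeta>. g \<zeta> + h \<zeta>) \<in> L2" using g h by (auto dest: hardy_ext_L2)
  ultimately show ?thesis using holomorphic_on_add[OF F G] unfolding hardy_ext_def by blast
qed

text \<open>
  The quotient has bounded quadratic means since near the zero it is bounded by compactness, and away from
  the zero the divisor is bounded below.
\<close>

lemma hardy_ext_divide:
  assumes h: "hardy_ext g F" and l: "cmod w < 1" and zero: "F w = 0"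
  shows "\<exists>F1. hardy_ext (\<lambda>\<zeta>. g \<zeta> / (\<zeta> - w)) F1"
proof -
  have g: "g \<in> L2" and F: "F holomorphic_on ball 0 1"
    and lim: "AE \<zeta> in circ. ((\<lambda>r. F (complex_of_real r * \<zeta>)) \<longlongrightarrow> g \<zeta>) (at_left 1)"
    using h by (auto simp: hardy_ext_def)
  from h obtain C where C: "\<And>r. r\<in>{0<..<1} \<Longrightarrow> (LINT \<zeta>|circ. (cmod (F (complex_of_real r * \<zeta>)))\<^sup>2) \<le> C"
    unfolding hardy_ext_def by blast
  have "0 \<le> (LINT \<zeta>|circ. (cmod (F (complex_of_real (1/2) * \<zeta>)))\<^sup>2)"
    by (rule integral_nonneg_AE) auto
  from order_trans[OF this C[of "1/2"]] have C0: "C \<ge> 0" by simp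
  define F1 where "F1 z = (if z = w then deriv F w else (F z - F w) / (z - w))" for z
  have F1: "F1 holomorphic_on ball 0 1"
    unfolding F1_def using pole_lemma[OF F, of w] l by (simp add: interior_open)
  \<comment> \<open>the disc of radius \<open>\<rho>\<close> is compact and contains w; outside it the distance to w is at least \<open>\<delta>\<close>\<close>
  define \<rho> where "\<rho> = (1 + cmod w) / 2"
  define \<delta> where "\<delta> = (1 - cmod w) / 2"
  have \<delta>: "\<delta> > 0" and \<rho>: "\<rho> < 1" "\<rho> - cmod w = \<delta>" using l by (auto simp: \<rho>_def \<delta>_def field_simps)
  have "compact (F1 ` cball 0 \<rho>)"
    using \<rho> by (intro compact_continuous_image holomorphic_on_imp_continuous_on holomorphic_on_subset[OF F1]) auto
  then obtain K where K: "\<And>x. x\<in>cball 0 \<rho> \<Longrightarrow> norm (F1 x) \<le> K"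
    by (meson bounded_iff compact_imp_bounded imageI)
  have "(LINT \<zeta>|circ. (cmod (F1 (complex_of_real r * \<zeta>)))\<^sup>2) \<le> C / \<delta>\<^sup>2 + K\<^sup>2" if r: "r \<in> {0<..<1}" for r
  proof (cases "r < \<rho>")
    case True
    have "(LINT \<zeta>|circ. (cmod (F1 (complex_of_real r * \<zeta>)))\<^sup>2) \<le> (LINT \<zeta>|circ. K\<^sup>2)"
      using r True by (intro integral_mono_AE L2_integrable L2_dilation F1 AE_circI)
         (auto intro!: power_mono K simp: norm_mult)
    also have "\<dots> = K\<^sup>2" using circ.prob_space by simp
    finally show ?thesis using C0 by (simp add: add_increasing)
  next
    case False
    have "(LINT \<zeta>|circ. (cmod (F1 (complex_of_real r * \<zeta>)))\<^sup>2) \<le> (LINT \<zeta>|circ. (cmod (F (complex_of_real r * \<zeta>)))\<^sup>2 / \<delta>\<^sup>2)"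
    proof (rule integral_mono_AE)
      show "integrable circ (\<lambda>\<zeta>. (cmod (F1 (complex_of_real r * \<zeta>)))\<^sup>2)"
        using r by (intro L2_integrable L2_dilation F1) auto
      show "integrable circ (\<lambda>\<zeta>. (cmod (F (complex_of_real r * \<zeta>)))\<^sup>2 / \<delta>\<^sup>2)"
        using r by (intro integrable_divide_zero L2_integrable L2_dilation F) auto
      show "AE \<zeta> in circ. (cmod (F1 (complex_of_real r * \<zeta>)))\<^sup>2 \<le> (cmod (F (complex_of_real r * \<zeta>)))\<^sup>2 / \<delta>\<^sup>2"
      proof (rule AE_circI)
        fix \<zeta> assume z: "cmod \<zeta> = 1"
        let ?z = "complex_of_real r * \<zeta>"
        have "\<delta> \<le> cmod ?z - cmod w" using False \<rho> r z by (simp add: norm_mult)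
        also have "\<dots> \<le> cmod (?z - w)" by (rule norm_triangle_ineq2)
        finally have d: "\<delta> \<le> cmod (?z - w)" .
        then have "?z \<noteq> w" using \<delta> by auto
        then have "cmod (F1 ?z) = cmod (F ?z) / cmod (?z - w)" by (simp add: F1_def zero norm_divide)
        also have "\<dots> \<le> cmod (F ?z) / \<delta>" using d \<delta> by (intro divide_left_mono mult_pos_pos) auto
        finally show "(cmod (F1 ?z))\<^sup>2 \<le> (cmod (F ?z))\<^sup>2 / \<delta>\<^sup>2"
          unfolding power_divide[symmetric] by (rule power_mono) simp
      qed
    qed
    also have "\<dots> \<le> C / \<delta>\<^sup>2" using C[OF r] by (simp add: divide_right_mono)
    finally show ?thesis by (simp add: add_increasing2)
  qed
  moreover have "AE \<zeta> in circ. ((\<lambda>r. F1 (complex_of_real r * \<zeta>)) \<longlongrightarrow> g \<zeta> / (\<zeta> - w)) (at_left 1)"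
    using lim AE_space
  proof eventually_elim
    case (elim \<zeta>)
    then have z: "cmod \<zeta> = 1" by simp
    then have ne: "\<zeta> \<noteq> w" using l by auto
    have t: "((\<lambda>r. complex_of_real r * \<zeta>) \<longlongrightarrow> complex_of_real 1 * \<zeta>) (at_left 1)"
      by (intro tendsto_intros)
    then have "eventually (\<lambda>r. complex_of_real r * \<zeta> \<noteq> w) (at_left 1)"
      by (rule tendsto_imp_eventually_ne) (use ne in simp)
    then have "eventually (\<lambda>r. F (complex_of_real r * \<zeta>) / (complex_of_real r * \<zeta> - w) = F1 (complex_of_real r * \<zeta>)) (at_left 1)"
      by eventually_elim (simp add: F1_def zero)
    moreover have "((\<lambda>r. F (complex_of_real r * \<zeta>) / (complex_of_real r * \<zeta> - w)) \<longlongrightarrow> g \<zeta> / (\<zeta> - w)) (at_left 1)"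
      using elim(1) t ne by (intro tendsto_intros) auto
    ultimately show ?case by (rule Lim_transform_eventually[rotated])
  qed
  moreover have "(\<lambda>\<zeta>. g \<zeta> / (\<zeta> - w)) \<in> L2"
  proof -
    have "(\<lambda>\<zeta>. 1 / (\<zeta> - w)) \<in> Linf"
      using l by (intro Linf_continuous continuous_intros) auto
    from L2_mult[OF this g] show ?thesis by simp
  qed
  ultimately show ?thesis using F1 unfolding hardy_ext_def by blast
qed

section \<open>Blaschke products and the Takenaka-Malmquist basis\<close>

definition blaschke_factor :: "complex \<Rightarrow> complex \<Rightarrow> complex" where
  "blaschke_factor w \<zeta> =
     (if w = 0 then 1 else cnj w / complex_of_real (cmod w)) * ((\<zeta> - w) / (1 - cnj w * \<zeta>))"

lemma blaschke_eq_prod: "blaschke \<Lambda> N \<zeta> = (\<Prod>j<N. blaschke_factor (\<Lambda> j) \<zeta>)"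
  by (simp add: blaschke_def blaschke_factor_def)

lemma hol_closed_disc_blaschke_factor [intro]:
  assumes "cmod w < 1"
  shows "hol_closed_disc (blaschke_factor w)"
proof -
  define c where "c = (if w = 0 then 1 else cnj w / complex_of_real (cmod w))"
  have "blaschke_factor w = (\<lambda>\<zeta>. c * ((\<zeta> - w) * szego_kernel w \<zeta>))"
    by (auto simp: blaschke_factor_def szego_kernel_def c_def)
  moreover have "hol_closed_disc (\<lambda>\<zeta>. c * ((\<zeta> - w) * szego_kernel w \<zeta>))"
    by (intro hol_closed_disc_mult hol_closed_disc_diff hol_closed_disc_const hol_closed_disc_ident
        hol_closed_disc_szego_kernel assms)
  ultimately show ?thesis by simp
qed

lemma szego_denominator_circle:
  assumes "cmod \<zeta> = 1"
  shows "cmod (1 - cnj w * \<zeta>) = cmod (\<zeta> - w)"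
proof -
  have "1 - cnj w * \<zeta> = \<zeta> * cnj (\<zeta> - w)"
    using circle_mult_cnj[OF assms] by (simp add: algebra_simps)
  then show ?thesis by (simp only: norm_mult complex_mod_cnj assms)
qed

lemma blaschke_factor_unimodular:
  assumes "cmod w < 1" "cmod \<zeta> = 1"
  shows "cmod (blaschke_factor w \<zeta>) = 1"
proof -
  have "\<zeta> \<noteq> w" using assms by auto
  then show ?thesis
    unfolding blaschke_factor_def norm_mult norm_divide szego_denominator_circle[OF assms(2)]
    by (auto simp: norm_divide)
qed

locale disc_sequence =
  fixes \<Lambda> :: "nat \<Rightarrow> complex"
  assumes disc: "\<And>j. cmod (\<Lambda> j) < 1"
begin

abbreviation "B \<equiv> blaschke \<Lambda>"

lemma hol_blaschke: "hol_closed_disc (B N)"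
  unfolding blaschke_eq_prod[abs_def] by (intro hol_closed_disc_prod hol_closed_disc_blaschke_factor disc)

lemma blaschke_unimodular: "cmod \<zeta> = 1 \<Longrightarrow> cmod (B N \<zeta>) = 1"
  unfolding blaschke_eq_prod prod_norm[symmetric]
  by (intro prod.neutral ballI blaschke_factor_unimodular disc)

lemma blaschke_Linf: "B N \<in> Linf"
  by (rule Linf_continuous[OF hol_closed_disc_continuous[OF hol_blaschke]])

lemma blaschke_split:
  assumes "i < N"
  obtains Q where "hol_closed_disc Q" "\<And>\<zeta>. B N \<zeta> = B i \<zeta> * (blaschke_factor (\<Lambda> i) \<zeta> * Q \<zeta>)"
proof (rule that)
  let ?Q = "\<lambda>\<zeta>. \<Prod>j\<in>{Suc i..<N}. blaschke_factor (\<Lambda> j) \<zeta>"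
  show "hol_closed_disc ?Q" by (intro hol_closed_disc_prod hol_closed_disc_blaschke_factor disc)
  have "{..<N} = {..<i} \<union> insert i {Suc i..<N}" using assms by auto
  moreover have "(\<Prod>j\<in>{..<i} \<union> insert i {Suc i..<N}. blaschke_factor (\<Lambda> j) \<zeta>)
     = B i \<zeta> * (blaschke_factor (\<Lambda> i) \<zeta> * ?Q \<zeta>)" for \<zeta>
    unfolding blaschke_eq_prod by (subst prod.union_disjoint) auto
  ultimately show "B N \<zeta> = B i \<zeta> * (blaschke_factor (\<Lambda> i) \<zeta> * ?Q \<zeta>)" for \<zeta>
    unfolding blaschke_eq_prod[of \<Lambda> N] by simp
qed

definition tm_norm :: "nat \<Rightarrow> real" where
  "tm_norm i = sqrt (1 - (cmod (\<Lambda> i))\<^sup>2)"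

text \<open>
  The Takenaka-Malmquist functions: when the points \<open>\<Lambda> 0, \<Lambda> 1, \<dots>\<close> are distinct, these are up to unimodular constants the
  orthonormalization of the Szego kernels at these points, and they remain a basis when points repeat.
\<close>

definition tm :: "nat \<Rightarrow> complex \<Rightarrow> complex" where
  "tm i \<zeta> = of_real (tm_norm i) * (szego_kernel (\<Lambda> i) \<zeta> * B i \<zeta>)"

lemma tm_norm_sq: "(tm_norm i)\<^sup>2 = 1 - (cmod (\<Lambda> i))\<^sup>2"
  using disc[of i] by (simp add: tm_norm_def power_le_one)

lemma hol_tm: "hol_closed_disc (tm i)"
  unfolding tm_def[abs_def]
  by (intro hol_closed_disc_mult hol_closed_disc_const hol_blaschke hol_closed_disc_szego_kernel disc)

lemma tm_L2: "tm i \<in> L2"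
  by (rule L2_continuous[OF hol_closed_disc_continuous[OF hol_tm]])

text \<open>
  \<open>B i\<close> is unimodular on the circle and cancels, leaving a pairing with a Szego kernel. All inner products with the
  basis functions are thereby point evaluations.
\<close>

lemma tm_reproducing:
  assumes "hardy_ext g F"
  shows "l2_inner (\<lambda>\<zeta>. B i \<zeta> * g \<zeta>) (tm i) = of_real (tm_norm i) * F (\<Lambda> i)"
proof -
  have "l2_inner (\<lambda>\<zeta>. B i \<zeta> * g \<zeta>) (tm i) = l2_inner g (\<lambda>\<zeta>. cnj (B i \<zeta>) * tm i \<zeta>)"
    by (rule l2_inner_mult_left)
  also have "\<dots> = l2_inner g (\<lambda>\<zeta>. of_real (tm_norm i) * szego_kernel (\<Lambda> i) \<zeta>)"
  proof (rule l2_inner_cong[OF refl])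
    fix \<zeta> :: complex assume "cmod \<zeta> = 1"
    have "cnj (B i \<zeta>) * tm i \<zeta> = of_real (tm_norm i) * szego_kernel (\<Lambda> i) \<zeta> * (B i \<zeta> * cnj (B i \<zeta>))"
      by (simp add: tm_def mult_ac)
    then show "cnj (B i \<zeta>) * tm i \<zeta> = of_real (tm_norm i) * szego_kernel (\<Lambda> i) \<zeta>"
      using circle_mult_cnj[OF blaschke_unimodular[OF \<open>cmod \<zeta> = 1\<close>, of i]] by simp
  qed
  also have "\<dots> = of_real (tm_norm i) * F (\<Lambda> i)"
    by (simp add: l2_inner_cmult_right hardy_reproducing[OF assms disc])
  finally show ?thesis .
qed

lemma tm_inner_self: "l2_inner (tm i) (tm i) = 1"
proof -
  let ?g = "\<lambda>\<zeta>. of_real (tm_norm i) * szego_kernel (\<Lambda> i) \<zeta>"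
  have "l2_inner (tm i) (tm i) = l2_inner (\<lambda>\<zeta>. B i \<zeta> * ?g \<zeta>) (tm i)"
    by (rule l2_inner_cong) (auto simp: tm_def)
  also have "\<dots> = of_real (tm_norm i) * ?g (\<Lambda> i)"
    by (intro tm_reproducing hardy_ext_self hol_closed_disc_mult hol_closed_disc_const hol_closed_disc_szego_kernel disc)
  also have "\<dots> = of_real ((tm_norm i)\<^sup>2) * szego_kernel (\<Lambda> i) (\<Lambda> i)"
    by (simp add: power2_eq_square)
  also have "cnj (\<Lambda> i) * \<Lambda> i = of_real ((cmod (\<Lambda> i))\<^sup>2)"
    by (simp only: complex_norm_square mult.commute)
  then have "szego_kernel (\<Lambda> i) (\<Lambda> i) = 1 / of_real ((tm_norm i)\<^sup>2)"
    unfolding szego_kernel_def tm_norm_sq by simp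
  also have "of_real ((tm_norm i)\<^sup>2) * (1 / complex_of_real ((tm_norm i)\<^sup>2)) = 1"
    unfolding tm_norm_sq using disc[of i] power_less_one_iff[of "cmod (\<Lambda> i)" 2]
    by (simp del: of_real_diff of_real_power)
  finally show ?thesis .
qed

text \<open>
  \<open>B N\<close> is \<open>B i\<close> times a function that vanishes at \<open>\<Lambda> i\<close>, the point at which \<open>tm_reproducing\<close> evaluates.
\<close>

lemma blaschke_orthogonal_tm:
  assumes "i < N" "hardy_ext h F"
  shows "l2_inner (\<lambda>\<zeta>. B N \<zeta> * h \<zeta>) (tm i) = 0"
proof -
  obtain Q where Q: "hol_closed_disc Q" "\<And>\<zeta>. B N \<zeta> = B i \<zeta> * (blaschke_factor (\<Lambda> i) \<zeta> * Q \<zeta>)"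
    using blaschke_split[OF assms(1)] by blast
  let ?M = "\<lambda>\<zeta>. blaschke_factor (\<Lambda> i) \<zeta> * Q \<zeta>"
  have "hol_closed_disc ?M"
    by (intro hol_closed_disc_mult Q hol_closed_disc_blaschke_factor disc)
  from tm_reproducing[OF hardy_ext_mult[OF assms(2) this], of i]
  show ?thesis by (simp add: Q(2) mult.assoc blaschke_factor_def)
qed

lemma orthonormal_tm: "orthonormal N tm"
proof -
  have lt: "l2_inner (tm j) (tm i) = 0" if "i < j" for i j
  proof -
    have "hardy_ext (\<lambda>\<zeta>. of_real (tm_norm j) * szego_kernel (\<Lambda> j) \<zeta>) (\<lambda>\<zeta>. of_real (tm_norm j) * szego_kernel (\<Lambda> j) \<zeta>)"
      by (intro hardy_ext_self hol_closed_disc_mult hol_closed_disc_const hol_closed_disc_szego_kernel disc)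
    from blaschke_orthogonal_tm[OF that this] show ?thesis
      by (simp add: tm_def[abs_def] mult_ac)
  qed
  then have "l2_inner (tm i) (tm j) = 0" if "i < j" for i j
    using that by (subst l2_inner_commute) simp
  with lt tm_inner_self have "l2_inner (tm i) (tm j) = (if i = j then 1 else 0)" for i j
    by (cases i j rule: linorder_cases) auto
  then show ?thesis using tm_L2 by (simp add: orthonormal_def)
qed

abbreviation "K \<equiv> \<lambda>N. model_space (B N)"

lemma model_space_L2: "g \<in> K N \<Longrightarrow> g \<in> L2"
  by (simp add: model_space_def H2_def)

lemma blaschke_mult_L2: "h \<in> L2 \<Longrightarrow> (\<lambda>\<zeta>. B N \<zeta> * h \<zeta>) \<in> L2"
  by (rule L2_mult[OF blaschke_Linf])

lemma model_space_add:
  assumes "g \<in> K N" "h \<in> K N"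
  shows "(\<lambda>\<zeta>. g \<zeta> + h \<zeta>) \<in> K N"
  unfolding model_space_def
proof (intro CollectI conjI ballI)
  show "(\<lambda>\<zeta>. g \<zeta> + h \<zeta>) \<in> H2"
    using assms hardy_ext_add unfolding model_space_def H2_iff_hardy_ext by blast
  fix k assume k: "k \<in> H2"
  then have "(\<lambda>\<zeta>. B N \<zeta> * k \<zeta>) \<in> L2" by (intro blaschke_mult_L2) (simp add: H2_def)
  with k assms show "l2_inner (\<lambda>\<zeta>. g \<zeta> + h \<zeta>) (\<lambda>\<zeta>. B N \<zeta> * k \<zeta>) = 0"
    by (subst l2_inner_add_left) (auto simp: model_space_L2, auto simp: model_space_def)
qed

lemma model_space_cmult:
  assumes "g \<in> K N"
  shows "(\<lambda>\<zeta>. c * g \<zeta>) \<in> K N"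
  unfolding model_space_def
proof (intro CollectI conjI ballI)
  show "(\<lambda>\<zeta>. c * g \<zeta>) \<in> H2"
    using assms hardy_ext_mult[OF _ hol_closed_disc_const[of c]] unfolding model_space_def H2_iff_hardy_ext by blast
qed (use assms in \<open>auto simp: l2_inner_cmult_left model_space_def\<close>)

lemma model_space_zero: "(\<lambda>\<zeta>. 0) \<in> K N"
  unfolding model_space_def using hardy_ext_zero by (auto simp: H2_iff_hardy_ext)

lemma model_space_lincomb:
  "(\<And>i. i \<in> I \<Longrightarrow> g i \<in> K N) \<Longrightarrow> (\<lambda>\<zeta>. \<Sum>i\<in>I. c i * g i \<zeta>) \<in> K N"
  by (induction I rule: infinite_finite_induct)
     (auto simp: model_space_zero intro!: model_space_add model_space_cmult)

lemma tm_in_model_space: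
  assumes "i < N"
  shows "tm i \<in> K N"
  unfolding model_space_def
proof (intro CollectI conjI ballI)
  show "tm i \<in> H2" using hardy_ext_self[OF hol_tm] by (auto simp: H2_iff_hardy_ext)
  fix h assume "h \<in> H2"
  then obtain F where "hardy_ext h F" by (auto simp: H2_iff_hardy_ext)
  from blaschke_orthogonal_tm[OF assms this]
  show "l2_inner (tm i) (\<lambda>\<zeta>. B N \<zeta> * h \<zeta>) = 0" by (subst l2_inner_commute) simp
qed

text \<open>
  Orthogonality to \<open>tm m\<close> says that the cofactor of \<open>B m\<close> vanishes at \<open>\<Lambda> m\<close>, so one more Blaschke factor can be
  divided out.
\<close>

lemma hardy_factor_blaschke:
  assumes u: "hardy_ext u F0" and orth: "\<And>i. i < m \<Longrightarrow> l2_inner u (tm i) = 0"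
  shows "\<exists>v F. hardy_ext v F \<and> (\<forall>\<zeta>. cmod \<zeta> = 1 \<longrightarrow> u \<zeta> = B m \<zeta> * v \<zeta>)"
  using orth
proof (induction m)
  case 0
  show ?case using u by (intro exI[of _ u] exI[of _ F0]) (auto simp: blaschke_eq_prod)
next
  case (Suc m)
  then obtain v F where v: "hardy_ext v F" and uv: "\<And>\<zeta>. cmod \<zeta> = 1 \<Longrightarrow> u \<zeta> = B m \<zeta> * v \<zeta>" by auto
  have "l2_inner (\<lambda>\<zeta>. B m \<zeta> * v \<zeta>) (tm m) = l2_inner u (tm m)"
    by (rule l2_inner_cong) (auto simp: uv)
  with Suc.prems[of m] tm_reproducing[OF v, of m] have "of_real (tm_norm m) * F (\<Lambda> m) = 0" by simp
  moreover have "tm_norm m \<noteq> 0"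
    using tm_norm_sq[of m] disc[of m] power_less_one_iff[of "cmod (\<Lambda> m)" 2] by auto
  ultimately have "F (\<Lambda> m) = 0" by simp
  from hardy_ext_divide[OF v disc this] obtain F1 where F1: "hardy_ext (\<lambda>\<zeta>. v \<zeta> / (\<zeta> - \<Lambda> m)) F1" by blast
  define c where "c = (if \<Lambda> m = 0 then 1 else cnj (\<Lambda> m) / complex_of_real (cmod (\<Lambda> m)))"
  have c: "c \<noteq> 0" by (auto simp: c_def)
  \<comment> \<open>the part of the Blaschke factor other than its zero, inverted\<close>
  let ?M = "\<lambda>\<zeta>. (1 / c) * (1 - cnj (\<Lambda> m) * \<zeta>)"
  have "hol_closed_disc ?M"
    by (intro hol_closed_disc_mult hol_closed_disc_diff hol_closed_disc_const hol_closed_disc_ident)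
  from hardy_ext_mult[OF F1 this]
  have "hardy_ext (\<lambda>\<zeta>. ?M \<zeta> * (v \<zeta> / (\<zeta> - \<Lambda> m))) (\<lambda>\<zeta>. ?M \<zeta> * F1 \<zeta>)" .
  moreover have "u \<zeta> = B (Suc m) \<zeta> * (?M \<zeta> * (v \<zeta> / (\<zeta> - \<Lambda> m)))" if z: "cmod \<zeta> = 1" for \<zeta>
  proof -
    have "\<zeta> - \<Lambda> m \<noteq> 0" using z disc[of m] by auto
    moreover have "1 - cnj (\<Lambda> m) * \<zeta> \<noteq> 0" using szego_denominator_nonzero[OF disc] z by simp
    ultimately have "blaschke_factor (\<Lambda> m) \<zeta> * (?M \<zeta> * (v \<zeta> / (\<zeta> - \<Lambda> m))) = v \<zeta>"
      unfolding blaschke_factor_def c_def[symmetric] using c by (simp add: divide_simps)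
    moreover have "B (Suc m) \<zeta> = B m \<zeta> * blaschke_factor (\<Lambda> m) \<zeta>" by (simp add: blaschke_eq_prod)
    ultimately show ?thesis unfolding uv[OF z] by (simp only: mult.assoc)
  qed
  ultimately show ?case by blast
qed

text \<open>
  The remainder of the expansion lies in the model space and is orthogonal to the basis functions. By the
  previous lemma it is also a multiple of \<open>B N\<close>, hence orthogonal to itself.
\<close>

lemma model_space_expansion:
  assumes g: "g \<in> K N"
  shows "AE \<zeta> in circ. g \<zeta> = (\<Sum>i<N. l2_inner g (tm i) * tm i \<zeta>)"
proof -
  define u where "u \<zeta> = g \<zeta> + (-1) * proj N tm g \<zeta>" for \<zeta>
  have uK: "u \<in> K N"
    unfolding u_def proj_def by (intro model_space_add model_space_cmult model_space_lincomb g tm_in_model_space) auto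
  have uL2: "u \<in> L2" by (rule model_space_L2[OF uK])
  from uK obtain F0 where F0: "hardy_ext u F0" by (auto simp: model_space_def H2_iff_hardy_ext)
  have "l2_inner u (tm i) = 0" if "i < N" for i
    using that model_space_L2[OF g] unfolding u_def
    by (subst l2_inner_add_left)
       (auto simp: l2_inner_cmult_left[of "-1", simplified] proj_inner[OF orthonormal_tm] tm_L2 proj_L2[OF orthonormal_tm]
          intro: L2_cmult[of _ "-1", simplified])
  from hardy_factor_blaschke[OF F0 this] obtain v F where v: "hardy_ext v F"
    and uv: "\<And>\<zeta>. cmod \<zeta> = 1 \<Longrightarrow> u \<zeta> = B N \<zeta> * v \<zeta>" by blast
  have "complex_of_real (l2_sq u) = l2_inner u (\<lambda>\<zeta>. B N \<zeta> * v \<zeta>)"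
    unfolding l2_sq_eq_inner by (rule l2_inner_cong) (auto simp: uv)
  also have "\<dots> = 0" using uK v by (auto simp: model_space_def H2_iff_hardy_ext)
  finally have "l2_sq u = 0" by simp
  from l2_sq_eq_0[OF uL2 this] show ?thesis by eventually_elim (simp add: u_def proj_def)
qed

lemma orthonormal_basis_tm: "orthonormal_basis (K N) N tm"
  unfolding orthonormal_basis_def
  using tm_in_model_space model_space_expansion orthonormal_tm[of N] by (auto simp: orthonormal_def)

text \<open>
  As \<open>\<Lambda> 0 = 0\<close>, the function \<open>tm j\<close> has a zero at the origin for \<open>j > 0\<close>. Multiplication by
  \<open>cnj \<zeta>\<close> removes it, which leaves a function in the Hardy space, and preserves orthogonality to \<open>B N H\<^sup>2\<close> since \<open>\<zeta> H\<^sup>2\<close> is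
  contained in \<open>H\<^sup>2\<close>. Hence \<open>cnj \<zeta> * tm j\<close> stays in the model space and has distance zero from it.
\<close>

lemma backward_shift_tm:
  assumes 0: "\<Lambda> 0 = 0" and j: "0 < j" "j < N"
  shows "l2_sq (\<lambda>\<zeta>. cnj \<zeta> * tm j \<zeta> - proj N tm (\<lambda>\<zeta>. cnj \<zeta> * tm j \<zeta>) \<zeta>) = 0"
proof -
  obtain Q where Q: "hol_closed_disc Q" "\<And>\<zeta>. B j \<zeta> = B 0 \<zeta> * (blaschke_factor (\<Lambda> 0) \<zeta> * Q \<zeta>)"
    using blaschke_split[OF j(1)] by blast
  define f where "f \<zeta> = of_real (tm_norm j) * (szego_kernel (\<Lambda> j) \<zeta> * Q \<zeta>)" for \<zeta>
  have f: "hol_closed_disc f" unfolding f_def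
    by (intro hol_closed_disc_mult hol_closed_disc_const Q hol_closed_disc_szego_kernel disc)
  have "B 0 \<zeta> = 1" for \<zeta> by (simp add: blaschke_eq_prod)
  then have "B j \<zeta> = \<zeta> * Q \<zeta>" for \<zeta>
    using Q(2)[of \<zeta>] by (simp add: 0 blaschke_factor_def)
  then have tmf: "tm j \<zeta> = \<zeta> * f \<zeta>" for \<zeta>
    by (simp add: tm_def f_def)
  have fc: "f \<zeta> = cnj \<zeta> * tm j \<zeta>" if "cmod \<zeta> = 1" for \<zeta>
    using circle_mult_cnj[OF that] by (simp add: tmf mult.commute)
  have "f \<in> K N"
    unfolding model_space_def
  proof (intro CollectI conjI ballI)
    show "f \<in> H2" using hardy_ext_self[OF f] by (auto simp: H2_iff_hardy_ext)
    fix h assume "h \<in> H2"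
    then obtain F where "hardy_ext h F" by (auto simp: H2_iff_hardy_ext)
    from blaschke_orthogonal_tm[OF j(2) hardy_ext_mult[OF this hol_closed_disc_ident]]
    have "l2_inner (tm j) (\<lambda>\<zeta>. B N \<zeta> * (\<zeta> * h \<zeta>)) = 0" by (subst l2_inner_commute) simp
    also have "l2_inner (tm j) (\<lambda>\<zeta>. B N \<zeta> * (\<zeta> * h \<zeta>)) = l2_inner (\<lambda>\<zeta>. cnj \<zeta> * tm j \<zeta>) (\<lambda>\<zeta>. B N \<zeta> * h \<zeta>)"
      unfolding l2_inner_mult_left by (simp add: mult_ac)
    also have "\<dots> = l2_inner f (\<lambda>\<zeta>. B N \<zeta> * h \<zeta>)"
      by (rule l2_inner_cong) (auto simp: fc)
    finally show "l2_inner f (\<lambda>\<zeta>. B N \<zeta> * h \<zeta>) = 0" .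
  qed
  from model_space_expansion[OF this]
  have ae: "AE \<zeta> in circ. f \<zeta> - proj N tm f \<zeta> = 0" by eventually_elim (simp add: proj_def)
  have "l2_inner f (tm i) = l2_inner (\<lambda>\<zeta>. cnj \<zeta> * tm j \<zeta>) (tm i)" for i
    by (rule l2_inner_cong) (auto simp: fc)
  then have p: "proj N tm (\<lambda>\<zeta>. cnj \<zeta> * tm j \<zeta>) = proj N tm f" by (simp add: proj_def)
  have "AE \<zeta> in circ. (cmod (cnj \<zeta> * tm j \<zeta> - proj N tm (\<lambda>\<zeta>. cnj \<zeta> * tm j \<zeta>) \<zeta>))\<^sup>2 = 0"
    using ae AE_space
  proof eventually_elim
    case (elim \<zeta>)
    then have "cmod \<zeta> = 1" by simp
    with elim(1) show ?case unfolding p by (simp flip: fc)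
  qed
  then show ?thesis unfolding l2_sq_def by (rule integral_eq_zero_AE)
qed

lemma tm_sq_circle:
  assumes "cmod \<zeta> = 1"
  shows "(cmod (tm j \<zeta>))\<^sup>2 = (1 - (cmod (\<Lambda> j))\<^sup>2) / (cmod (\<zeta> - \<Lambda> j))\<^sup>2"
  using assms blaschke_unimodular[OF assms, of j]
  by (simp add: tm_def szego_kernel_def norm_mult norm_divide power_mult_distrib power_divide
      szego_denominator_circle tm_norm_sq)

text \<open>
  The logarithmic derivative of one Blaschke factor at a point of the circle is its Poisson kernel, divided by \<open>\<zeta>\<close>.
  The Poisson kernels are positive, so that there is no cancellation in \<open>|B\<^sub>N'|\<close>, and they are the \<open>|tm j|\<^sup>2\<close>.
\<close>

lemma blaschke_has_derivative:
  assumes z: "cmod \<zeta> = 1"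
  shows "(B N has_field_derivative B N \<zeta> * of_real (\<Sum>j<N. (cmod (tm j \<zeta>))\<^sup>2) / \<zeta>) (at \<zeta>)"
proof (induction N)
  case 0
  show ?case by (simp add: blaschke_eq_prod[abs_def])
next
  case (Suc N)
  let ?w = "\<Lambda> N"
  let ?b = "blaschke_factor ?w"
  define c where "c = (if ?w = 0 then 1 else cnj ?w / complex_of_real (cmod ?w))"
  have ne: "\<zeta> - ?w \<noteq> 0" "1 - cnj ?w * \<zeta> \<noteq> 0" "\<zeta> \<noteq> 0"
    using z disc[of N] szego_denominator_nonzero[OF disc] by auto
  have "(?b has_field_derivative c * ((1 - cnj ?w * \<zeta>) + (\<zeta> - ?w) * cnj ?w) / (1 - cnj ?w * \<zeta>)\<^sup>2) (at \<zeta>)"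
  proof -
    have "((\<lambda>\<zeta>. \<zeta> - ?w) has_field_derivative 1) (at \<zeta>)"
      by (auto intro!: derivative_eq_intros)
    moreover have "((\<lambda>\<zeta>. 1 - cnj ?w * \<zeta>) has_field_derivative - cnj ?w) (at \<zeta>)"
      by (auto intro!: derivative_eq_intros)
    ultimately have "((\<lambda>\<zeta>. (\<zeta> - ?w) / (1 - cnj ?w * \<zeta>)) has_field_derivative
        (1 * (1 - cnj ?w * \<zeta>) - (\<zeta> - ?w) * - cnj ?w) / ((1 - cnj ?w * \<zeta>) * (1 - cnj ?w * \<zeta>))) (at \<zeta>)"
      by (rule DERIV_divide) (rule ne)
    from DERIV_cmult[OF this, of c] show ?thesis
      unfolding blaschke_factor_def[abs_def] c_def[symmetric] power2_eq_square by simp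
  qed
  also have "c * ((1 - cnj ?w * \<zeta>) + (\<zeta> - ?w) * cnj ?w) / (1 - cnj ?w * \<zeta>)\<^sup>2
      = ?b \<zeta> * of_real ((cmod (tm N \<zeta>))\<^sup>2) / \<zeta>"
  proof -
    have n: "?w * cnj ?w = of_real ((cmod ?w)\<^sup>2)" by (simp only: complex_norm_square)
    have d: "\<zeta> * ((\<zeta> - ?w) * cnj (\<zeta> - ?w)) = (\<zeta> - ?w) * (1 - cnj ?w * \<zeta>)"
      using circle_mult_cnj[OF z] by (simp add: algebra_simps)
    have "complex_of_real ((cmod (tm N \<zeta>))\<^sup>2) = (1 - ?w * cnj ?w) / ((\<zeta> - ?w) * cnj (\<zeta> - ?w))"
      unfolding tm_sq_circle[OF z] of_real_divide of_real_diff complex_norm_square by simp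
    then have "complex_of_real ((cmod (tm N \<zeta>))\<^sup>2) / \<zeta> = (1 - ?w * cnj ?w) / ((\<zeta> - ?w) * (1 - cnj ?w * \<zeta>))"
      unfolding d[symmetric] by simp
    then have "?b \<zeta> * of_real ((cmod (tm N \<zeta>))\<^sup>2) / \<zeta>
       = c * ((\<zeta> - ?w) / (1 - cnj ?w * \<zeta>)) * ((1 - ?w * cnj ?w) / ((\<zeta> - ?w) * (1 - cnj ?w * \<zeta>)))"
      unfolding blaschke_factor_def c_def[symmetric] by (simp only: times_divide_eq_right[symmetric])
    also have "\<dots> = c * (1 - ?w * cnj ?w) / (1 - cnj ?w * \<zeta>)\<^sup>2"
      using ne by (simp add: power2_eq_square)
    also have "1 - ?w * cnj ?w = (1 - cnj ?w * \<zeta>) + (\<zeta> - ?w) * cnj ?w" by (simp add: algebra_simps)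
    finally show ?thesis by simp
  qed
  finally have b: "(?b has_field_derivative ?b \<zeta> * of_real ((cmod (tm N \<zeta>))\<^sup>2) / \<zeta>) (at \<zeta>)" .
  have "B (Suc N) = (\<lambda>\<zeta>. B N \<zeta> * ?b \<zeta>)" by (auto simp: blaschke_eq_prod)
  moreover have "B N \<zeta> * of_real (\<Sum>j<N. (cmod (tm j \<zeta>))\<^sup>2) / \<zeta> * ?b \<zeta> + ?b \<zeta> * of_real ((cmod (tm N \<zeta>))\<^sup>2) / \<zeta> * B N \<zeta>
     = B N \<zeta> * ?b \<zeta> * of_real (\<Sum>j<Suc N. (cmod (tm j \<zeta>))\<^sup>2) / \<zeta>"
    by (simp add: distrib_left add_divide_distrib mult_ac)
  ultimately show ?case using DERIV_mult[OF Suc.IH b] by simp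
qed

lemma norm_deriv_blaschke:
  assumes z: "cmod \<zeta> = 1"
  shows "cmod (deriv (B N) \<zeta>) = (\<Sum>j<N. (cmod (tm j \<zeta>))\<^sup>2)"
proof -
  have "(\<Sum>j<N. (cmod (tm j \<zeta>))\<^sup>2) \<ge> 0" by (rule sum_nonneg) auto
  then show ?thesis
    unfolding DERIV_imp_deriv[OF blaschke_has_derivative[OF z]] norm_mult norm_divide norm_of_real
    using z by (simp add: blaschke_unimodular)
qed

lemma measurable_tm: "tm j \<in> borel_measurable circ"
  by (rule L2_measurable[OF tm_L2])

lemma nu_eq_density:
  "nu \<Lambda> N = density circ (\<lambda>\<zeta>. ennreal (1 / real N * (\<Sum>j<N. (cmod (tm j \<zeta>))\<^sup>2)))"
proof -
  have m: "(\<lambda>\<zeta>. ennreal (1 / real N * (\<Sum>j<N. (cmod (tm j \<zeta>))\<^sup>2))) \<in> borel_measurable circ"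
    using measurable_tm by measurable
  have "(\<lambda>\<zeta>. ennreal (1 / real N * cmod (deriv (B N) \<zeta>))) \<in> borel_measurable circ"
    by (rule measurable_circ_AE_cong[OF m]) (intro AE_circI, simp add: norm_deriv_blaschke)
  then show ?thesis unfolding nu_def
    using m by (intro density_cong AE_circI) (auto simp: norm_deriv_blaschke)
qed

lemma integrable_tm_weight:
  fixes g :: "complex \<Rightarrow> 'b :: {banach, second_countable_topology}"
  assumes g: "g \<in> borel_measurable circ" and C: "AE \<zeta> in circ. norm (g \<zeta>) \<le> C"
  shows "integrable circ (\<lambda>\<zeta>. (cmod (tm j \<zeta>))\<^sup>2 *\<^sub>R g \<zeta>)"
proof (rule Bochner_Integration.integrable_bound)
  show "integrable circ (\<lambda>\<zeta>. C * (cmod (tm j \<zeta>))\<^sup>2)" using L2_integrable[OF tm_L2] by simp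
  show "(\<lambda>\<zeta>. (cmod (tm j \<zeta>))\<^sup>2 *\<^sub>R g \<zeta>) \<in> borel_measurable circ" using measurable_tm g by measurable
  show "AE \<zeta> in circ. norm ((cmod (tm j \<zeta>))\<^sup>2 *\<^sub>R g \<zeta>) \<le> norm (C * (cmod (tm j \<zeta>))\<^sup>2)"
    using C by eventually_elim (auto simp: abs_mult mult.commute intro!: mult_right_mono)
qed

lemma integral_nu:
  fixes g :: "complex \<Rightarrow> 'b :: {banach, second_countable_topology}"
  assumes g: "g \<in> borel_measurable circ" and C: "AE \<zeta> in circ. norm (g \<zeta>) \<le> C"
  shows "(LINT \<zeta>|nu \<Lambda> N. g \<zeta>) = (1 / real N) *\<^sub>R (\<Sum>j<N. LINT \<zeta>|circ. (cmod (tm j \<zeta>))\<^sup>2 *\<^sub>R g \<zeta>)"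
proof -
  note i = integrable_tm_weight[OF g C]
  have m: "(\<lambda>\<zeta>. 1 / real N * (\<Sum>j<N. (cmod (tm j \<zeta>))\<^sup>2)) \<in> borel_measurable circ"
    using measurable_tm by measurable
  have "(LINT \<zeta>|nu \<Lambda> N. g \<zeta>) = (LINT \<zeta>|circ. (1 / real N * (\<Sum>j<N. (cmod (tm j \<zeta>))\<^sup>2)) *\<^sub>R g \<zeta>)"
    unfolding nu_eq_density by (rule integral_density[OF g m]) (auto intro!: AE_I2 sum_nonneg divide_nonneg_nonneg)
  also have "\<dots> = (LINT \<zeta>|circ. (1 / real N) *\<^sub>R (\<Sum>j<N. (cmod (tm j \<zeta>))\<^sup>2 *\<^sub>R g \<zeta>))"
    by (intro Bochner_Integration.integral_cong refl) (simp only: scaleR_scaleR[symmetric] scaleR_sum_left)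
  also have "\<dots> = (1 / real N) *\<^sub>R (LINT \<zeta>|circ. (\<Sum>j<N. (cmod (tm j \<zeta>))\<^sup>2 *\<^sub>R g \<zeta>))"
    by (rule integral_scaleR_right)
  also have "(LINT \<zeta>|circ. (\<Sum>j<N. (cmod (tm j \<zeta>))\<^sup>2 *\<^sub>R g \<zeta>)) = (\<Sum>j<N. LINT \<zeta>|circ. (cmod (tm j \<zeta>))\<^sup>2 *\<^sub>R g \<zeta>)"
    by (rule Bochner_Integration.integral_sum) (rule i)
  finally show ?thesis .
qed

end

section \<open>Traces and functional calculi of compressions\<close>

text \<open>
  A left inverse of a square matrix is a right inverse.
\<close>

lemma unitary_rows:
  fixes u :: "nat \<Rightarrow> nat \<Rightarrow> complex"
  assumes u: "\<And>i j. i < n \<Longrightarrow> j < n \<Longrightarrow> (\<Sum>k<n. cnj (u k i) * u k j) = (if i = j then 1 else 0)"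
    and k: "k < n" and l: "l < n"
  shows "(\<Sum>j<n. u k j * cnj (u l j)) = (if k = l then 1 else 0)"
proof -
  define U where "U = Matrix.mat n n (\<lambda>(i,j). u i j)"
  define W where "W = Matrix.mat n n (\<lambda>(i,j). cnj (u j i))"
  have U: "U \<in> carrier_mat n n" and W: "W \<in> carrier_mat n n" by (simp_all add: U_def W_def)
  have "W * U = 1\<^sub>m n"
    by (rule eq_matI) (use u in \<open>simp_all add: U_def W_def scalar_prod_def atLeast0LessThan\<close>)
  from mat_mult_left_right_inverse[OF W U this] have "U * W = 1\<^sub>m n" .
  then have "index_mat (U * W) (k, l) = index_mat (1\<^sub>m n) (k, l)" by simp
  with k l show ?thesis by (simp add: U_def W_def scalar_prod_def atLeast0LessThan)
qed

lemma orthonormal_basis_orthonormal: "orthonormal_basis V n e \<Longrightarrow> V \<subseteq> L2 \<Longrightarrow> orthonormal n e"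
  by (auto simp: orthonormal_basis_def orthonormal_def)

lemma basis_expansion:
  assumes "orthonormal_basis V n e" "V \<subseteq> L2" "g \<in> V" "k \<in> L2"
  shows "l2_inner g k = (\<Sum>i<n. l2_inner g (e i) * l2_inner (e i) k)"
proof -
  note e = orthonormal_basis_orthonormal[OF assms(1,2)]
  have "l2_inner g k = l2_inner (\<lambda>\<zeta>. \<Sum>i<n. l2_inner g (e i) * e i \<zeta>) k"
    by (rule l2_inner_cong_AE) (use assms in \<open>auto simp: orthonormal_basis_def\<close>)
  also have "\<dots> = (\<Sum>i<n. l2_inner g (e i) * l2_inner (e i) k)"
    by (rule l2_inner_lincomb_left) (use assms e in \<open>auto simp: orthonormal_L2\<close>)
  finally show ?thesis .
qed

lemma basis_eqI:
  assumes e: "orthonormal_basis V n e" and "g \<in> V" "h \<in> V"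
    and "\<And>i. i < n \<Longrightarrow> l2_inner g (e i) = l2_inner h (e i)"
  shows "AE \<zeta> in circ. g \<zeta> = h \<zeta>"
proof -
  have "AE \<zeta> in circ. g \<zeta> = (\<Sum>i<n. l2_inner g (e i) * e i \<zeta>)"
    "AE \<zeta> in circ. h \<zeta> = (\<Sum>i<n. l2_inner h (e i) * e i \<zeta>)"
    using assms by (auto simp: orthonormal_basis_def)
  then show ?thesis by eventually_elim (simp add: assms(4))
qed

text \<open>
  Operators act on representatives, and those given by a choice (the projection, both calculi) are determined only up to
  null sets, so they cannot be described by equations between functions. Their coefficients in a basis are well
  defined.
\<close>

definition has_matrix ::
  "(complex \<Rightarrow> complex) set \<Rightarrow> nat \<Rightarrow> (nat \<Rightarrow> complex \<Rightarrow> complex) \<Rightarrow> l2_op \<Rightarrow> (nat \<Rightarrow> nat \<Rightarrow> complex) \<Rightarrow> bool" where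
  "has_matrix V n e S a \<longleftrightarrow> (\<forall>g\<in>V. S g \<in> V \<and> (\<forall>i<n. l2_inner (S g) (e i) = (\<Sum>j<n. a i j * l2_inner g (e j))))"

text \<open>
  Parseval's identity, once in each of the two bases.
\<close>

lemma trace_basis_independent:
  assumes V: "V \<subseteq> L2" and e: "orthonormal_basis V n e" and f: "orthonormal_basis V m f"
    and S: "has_matrix V n e S a"
  shows "(\<Sum>k<m. l2_inner (S (f k)) (f k)) = (\<Sum>i<n. a i i)"
proof -
  note eo = orthonormal_basis_orthonormal[OF e V]
  have fV: "f k \<in> V" if "k < m" for k using f that by (auto simp: orthonormal_basis_def)
  have eV: "e k \<in> V" if "k < n" for k using e that by (auto simp: orthonormal_basis_def)
  have "(\<Sum>k<m. l2_inner (S (f k)) (f k))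
      = (\<Sum>k<m. \<Sum>i<n. (\<Sum>j<n. a i j * l2_inner (f k) (e j)) * l2_inner (e i) (f k))"
  proof (rule sum.cong[OF refl])
    fix k assume "k \<in> {..<m}"
    then have k: "f k \<in> V" using fV by simp
    have "l2_inner (S (f k)) (f k) = (\<Sum>i<n. l2_inner (S (f k)) (e i) * l2_inner (e i) (f k))"
      by (rule basis_expansion[OF e V]) (use S k V in \<open>auto simp: has_matrix_def\<close>)
    also have "\<dots> = (\<Sum>i<n. (\<Sum>j<n. a i j * l2_inner (f k) (e j)) * l2_inner (e i) (f k))"
      by (rule sum.cong) (use S k in \<open>auto simp: has_matrix_def\<close>)
    finally show "l2_inner (S (f k)) (f k) = (\<Sum>i<n. (\<Sum>j<n. a i j * l2_inner (f k) (e j)) * l2_inner (e i) (f k))" .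
  qed
  also have "\<dots> = (\<Sum>k<m. \<Sum>i<n. \<Sum>j<n. a i j * (l2_inner (e i) (f k) * l2_inner (f k) (e j)))"
    unfolding sum_distrib_right by (intro sum.cong refl) (simp only: mult_ac)
  also have "\<dots> = (\<Sum>i<n. \<Sum>k<m. \<Sum>j<n. a i j * (l2_inner (e i) (f k) * l2_inner (f k) (e j)))"
    by (rule sum.swap)
  also have "\<dots> = (\<Sum>i<n. \<Sum>j<n. \<Sum>k<m. a i j * (l2_inner (e i) (f k) * l2_inner (f k) (e j)))"
    by (intro sum.cong[OF refl] sum.swap)
  also have "\<dots> = (\<Sum>i<n. \<Sum>j<n. a i j * l2_inner (e i) (e j))"
  proof (intro sum.cong[OF refl])
    fix i j assume "i \<in> {..<n}" "j \<in> {..<n}"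
    then have "l2_inner (e i) (e j) = (\<Sum>k<m. l2_inner (e i) (f k) * l2_inner (f k) (e j))"
      by (intro basis_expansion[OF f V]) (use eV V in auto)
    then show "(\<Sum>k<m. a i j * (l2_inner (e i) (f k) * l2_inner (f k) (e j))) = a i j * l2_inner (e i) (e j)"
      by (simp add: sum_distrib_left)
  qed
  also have "\<dots> = (\<Sum>i<n. a i i)"
  proof (rule sum.cong[OF refl])
    fix i assume i: "i \<in> {..<n}"
    have "(\<Sum>j<n. a i j * l2_inner (e i) (e j)) = (\<Sum>j<n. if j = i then a i j else 0)"
      by (rule sum.cong) (use eo i in \<open>auto simp: orthonormal_def\<close>)
    then show "(\<Sum>j<n. a i j * l2_inner (e i) (e j)) = a i i" using i by simp
  qed
  finally show ?thesis .
qed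

text \<open>
  Since all bases give the same value, the definite description in \<^const>\<open>op_trace\<close> denotes.
\<close>

lemma op_trace_eq:
  assumes V: "V \<subseteq> L2" and e: "orthonormal_basis V n e" and S: "has_matrix V n e S a"
  shows "op_trace V S = (\<Sum>i<n. a i i)"
  unfolding op_trace_def
proof (rule the_equality)
  show "\<exists>n' e'. orthonormal_basis V n' e' \<and> (\<Sum>i<n. a i i) = (\<Sum>i<n'. l2_inner (S (e' i)) (e' i))"
    using trace_basis_independent[OF V e e S] e by (intro exI[of _ n] exI[of _ e]) simp
qed (use trace_basis_independent[OF V e _ S] in auto)

text \<open>
  For a model space \<open>V\<close> the operator \<open>T\<close> of this locale is the truncated Toeplitz operator; the results up to the traces
  of its functional calculi are linear algebra on a finite-dimensional subspace of \<open>L\<^sup>2\<close>.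
\<close>

locale compression =
  fixes V :: "(complex \<Rightarrow> complex) set" and \<phi> :: "complex \<Rightarrow> complex" and n :: nat
  assumes V_L2: "V \<subseteq> L2"
    and V_add: "\<And>g h. g \<in> V \<Longrightarrow> h \<in> V \<Longrightarrow> (\<lambda>\<zeta>. g \<zeta> + h \<zeta>) \<in> V"
    and V_cmult: "\<And>c g. g \<in> V \<Longrightarrow> (\<lambda>\<zeta>. c * g \<zeta>) \<in> V"
    and V_zero: "(\<lambda>\<zeta>. 0) \<in> V"
    and V_basis: "\<exists>e. orthonormal_basis V n e"
    and symbol: "\<phi> \<in> Linf"
begin

definition T :: l2_op where "T g = orth_proj V (\<lambda>\<zeta>. \<phi> \<zeta> * g \<zeta>)"

lemma V_lincomb: "(\<And>i. i \<in> I \<Longrightarrow> g i \<in> V) \<Longrightarrow> (\<lambda>\<zeta>. \<Sum>i\<in>I. c i * g i \<zeta>) \<in> V"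
  by (induction I rule: infinite_finite_induct) (auto simp: V_zero intro!: V_add V_cmult)

lemma basis_in_V: "orthonormal_basis V n e \<Longrightarrow> i < n \<Longrightarrow> e i \<in> V"
  by (simp add: orthonormal_basis_def)

lemma basis_lincomb_in_V: "orthonormal_basis V n e \<Longrightarrow> (\<lambda>\<zeta>. \<Sum>i<n. c i * e i \<zeta>) \<in> V"
  by (rule V_lincomb) (simp add: basis_in_V)

lemma basis_lincomb_inner:
  "orthonormal_basis V n e \<Longrightarrow> j < n \<Longrightarrow> l2_inner (\<lambda>\<zeta>. \<Sum>i<n. c i * e i \<zeta>) (e j) = c j"
  by (rule orthonormal_lincomb_inner[OF orthonormal_basis_orthonormal[OF _ V_L2]])

text \<open>
  Expansion in a basis provides a witness for the choice in \<^const>\<open>orth_proj\<close>.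
\<close>

lemma orth_proj:
  assumes h: "h \<in> L2"
  shows "orth_proj V h \<in> V" and "k \<in> V \<Longrightarrow> l2_inner (orth_proj V h) k = l2_inner h k"
proof -
  obtain e where e: "orthonormal_basis V n e" using V_basis by blast
  note eo = orthonormal_basis_orthonormal[OF e V_L2]
  define g where "g = proj n e h"
  have gV: "g \<in> V" unfolding g_def proj_def by (rule basis_lincomb_in_V[OF e])
  have d: "(\<lambda>\<zeta>. h \<zeta> - g \<zeta>) \<in> L2" using h gV V_L2 by auto
  have "l2_inner (\<lambda>\<zeta>. h \<zeta> - g \<zeta>) k = 0" if k: "k \<in> V" for k
  proof -
    have "l2_inner (\<lambda>\<zeta>. h \<zeta> - g \<zeta>) k = l2_inner (\<lambda>\<zeta>. h \<zeta> - g \<zeta>) (\<lambda>\<zeta>. \<Sum>i<n. l2_inner k (e i) * e i \<zeta>)"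
      by (rule l2_inner_cong_AE) (use d k V_L2 e in \<open>auto simp: orthonormal_basis_def\<close>)
    also have "\<dots> = 0"
      by (rule orthogonal_lincomb[OF eo d])
         (use eo h gV V_L2 in \<open>auto simp: l2_inner_diff_left orthonormal_L2 g_def proj_inner proj_L2\<close>)
    finally show ?thesis .
  qed
  with gV have "\<exists>g. g \<in> V \<and> (\<forall>k\<in>V. l2_inner (\<lambda>\<zeta>. h \<zeta> - g \<zeta>) k = 0)" by blast
  from someI_ex[OF this]
  have p: "orth_proj V h \<in> V" "\<And>k. k \<in> V \<Longrightarrow> l2_inner (\<lambda>\<zeta>. h \<zeta> - orth_proj V h \<zeta>) k = 0"
    unfolding orth_proj_def by blast+
  show "orth_proj V h \<in> V" by (rule p)
  assume k: "k \<in> V"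
  have "l2_inner h k - l2_inner (orth_proj V h) k = 0"
    using p(2)[OF k] by (subst l2_inner_diff_left[symmetric]) (use h p(1) k V_L2 in auto)
  then show "l2_inner (orth_proj V h) k = l2_inner h k" by simp
qed

lemma symbol_mult_L2: "g \<in> V \<Longrightarrow> (\<lambda>\<zeta>. \<phi> \<zeta> * g \<zeta>) \<in> L2"
  using symbol V_L2 by auto

lemma T_in_V: "g \<in> V \<Longrightarrow> T g \<in> V"
  unfolding T_def by (intro orth_proj symbol_mult_L2)

lemma T_inner: "g \<in> V \<Longrightarrow> k \<in> V \<Longrightarrow> l2_inner (T g) k = l2_inner (\<lambda>\<zeta>. \<phi> \<zeta> * g \<zeta>) k"
  unfolding T_def by (intro orth_proj symbol_mult_L2)

abbreviation mat_of :: "(nat \<Rightarrow> complex \<Rightarrow> complex) \<Rightarrow> nat \<Rightarrow> nat \<Rightarrow> complex" where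
  "mat_of e i j \<equiv> l2_inner (\<lambda>\<zeta>. \<phi> \<zeta> * e j \<zeta>) (e i)"

lemma T_has_matrix:
  assumes e: "orthonormal_basis V n e"
  shows "has_matrix V n e T (mat_of e)"
  unfolding has_matrix_def
proof (intro ballI conjI allI impI)
  fix g i assume g: "g \<in> V" and i: "i < n"
  note eo = orthonormal_basis_orthonormal[OF e V_L2]
  have "l2_inner (T g) (e i) = l2_inner g (\<lambda>\<zeta>. cnj (\<phi> \<zeta>) * e i \<zeta>)"
    by (simp add: T_inner[OF g basis_in_V[OF e i]] l2_inner_mult_left)
  also have "\<dots> = (\<Sum>j<n. l2_inner g (e j) * l2_inner (e j) (\<lambda>\<zeta>. cnj (\<phi> \<zeta>) * e i \<zeta>))"
    by (rule basis_expansion[OF e V_L2 g]) (use symbol orthonormal_L2[OF eo i] in auto)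
  finally show "l2_inner (T g) (e i) = (\<Sum>j<n. mat_of e i j * l2_inner g (e j))"
    by (simp add: l2_inner_mult_left mult.commute)
qed (rule T_in_V)

text \<open>
  Rotate any orthonormal basis by the unitary matrix of Schur's theorem.
\<close>

lemma schur_basis:
  obtains f where "orthonormal_basis V n f" "\<And>i j. i < n \<Longrightarrow> j < i \<Longrightarrow> mat_of f i j = 0"
proof -
  obtain e where e: "orthonormal_basis V n e" using V_basis by blast
  note eo = orthonormal_basis_orthonormal[OF e V_L2]
  obtain u where u: "\<And>i j. i < n \<Longrightarrow> j < n \<Longrightarrow> (\<Sum>k<n. cnj (u k i) * u k j) = (if i = j then 1 else 0)"
    and tri: "\<And>i j. i < n \<Longrightarrow> j < i \<Longrightarrow> (\<Sum>k<n. \<Sum>l<n. cnj (u k i) * mat_of e k l * u l j) = 0"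
    using unitary_triangularization[of n "mat_of e"] by blast
  define f where "f j \<zeta> = (\<Sum>k<n. u k j * e k \<zeta>)" for j \<zeta>
  have fV: "f j \<in> V" for j unfolding f_def by (rule basis_lincomb_in_V[OF e])
  have fe: "l2_inner (f j) (e k) = u k j" if "k < n" for j k
    unfolding f_def by (rule basis_lincomb_inner[OF e that])
  have gf: "l2_inner g (f i) = (\<Sum>k<n. cnj (u k i) * l2_inner g (e k))" if "g \<in> L2" for g i
    unfolding f_def by (rule l2_inner_lincomb_right) (use that eo in \<open>auto simp: orthonormal_L2\<close>)
  have ff: "l2_inner (f j) (f i) = (if i = j then 1 else 0)" if "i < n" "j < n" for i j
    using fV V_L2 u[OF that] by (subst gf) (auto simp: fe)
  have fb: "AE \<zeta> in circ. g \<zeta> = (\<Sum>i<n. l2_inner g (f i) * f i \<zeta>)" if g: "g \<in> V" for g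
  proof (rule basis_eqI[OF e g])
    show "(\<lambda>\<zeta>. \<Sum>i<n. l2_inner g (f i) * f i \<zeta>) \<in> V" by (intro V_lincomb fV)
    fix l assume l: "l < n"
    have "l2_inner (\<lambda>\<zeta>. \<Sum>i<n. l2_inner g (f i) * f i \<zeta>) (e l) = (\<Sum>i<n. l2_inner g (f i) * u l i)"
      by (subst l2_inner_lincomb_left) (use fV V_L2 orthonormal_L2[OF eo l] l in \<open>auto simp: fe\<close>)
    also have "\<dots> = (\<Sum>i<n. \<Sum>k<n. l2_inner g (e k) * (u l i * cnj (u k i)))"
    proof (rule sum.cong[OF refl])
      fix i
      have "l2_inner g (f i) = (\<Sum>k<n. cnj (u k i) * l2_inner g (e k))" using g V_L2 by (intro gf) auto
      then show "l2_inner g (f i) * u l i = (\<Sum>k<n. l2_inner g (e k) * (u l i * cnj (u k i)))"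
        by (simp only: sum_distrib_right) (intro sum.cong refl, simp only: mult_ac)
    qed
    also have "\<dots> = (\<Sum>k<n. l2_inner g (e k) * (\<Sum>i<n. u l i * cnj (u k i)))"
      by (subst sum.swap) (simp add: sum_distrib_left)
    also have "\<dots> = (\<Sum>k<n. if k = l then l2_inner g (e k) else 0)"
    proof (rule sum.cong[OF refl])
      fix k assume "k \<in> {..<n}"
      then have "(\<Sum>i<n. u l i * cnj (u k i)) = (if l = k then 1 else 0)"
        using unitary_rows[OF u l, of k] by simp
      then show "l2_inner g (e k) * (\<Sum>i<n. u l i * cnj (u k i)) = (if k = l then l2_inner g (e k) else 0)"
        by simp
    qed
    also have "\<dots> = l2_inner g (e l)" using l by simp
    finally show "l2_inner g (e l) = l2_inner (\<lambda>\<zeta>. \<Sum>i<n. l2_inner g (f i) * f i \<zeta>) (e l)" by simp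
  qed
  have "orthonormal_basis V n f"
    unfolding orthonormal_basis_def using fV ff fb by auto
  moreover have "mat_of f i j = 0" if i: "i < n" and j: "j < i" for i j
  proof -
    have "mat_of f i j = (\<Sum>k<n. cnj (u k i) * l2_inner (\<lambda>\<zeta>. \<phi> \<zeta> * f j \<zeta>) (e k))"
      by (rule gf[OF symbol_mult_L2[OF fV]])
    also have "\<dots> = (\<Sum>k<n. \<Sum>l<n. cnj (u k i) * mat_of e k l * u l j)"
    proof (rule sum.cong[OF refl])
      fix k assume k: "k \<in> {..<n}"
      have "l2_inner (\<lambda>\<zeta>. \<phi> \<zeta> * f j \<zeta>) (e k) = l2_inner (f j) (\<lambda>\<zeta>. cnj (\<phi> \<zeta>) * e k \<zeta>)"
        by (rule l2_inner_mult_left)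
      also have "\<dots> = (\<Sum>l<n. u l j * l2_inner (e l) (\<lambda>\<zeta>. cnj (\<phi> \<zeta>) * e k \<zeta>))"
        unfolding f_def
        by (rule l2_inner_lincomb_left) (use eo k symbol in \<open>auto simp: orthonormal_L2\<close>)
      finally show "cnj (u k i) * l2_inner (\<lambda>\<zeta>. \<phi> \<zeta> * f j \<zeta>) (e k) = (\<Sum>l<n. cnj (u k i) * mat_of e k l * u l j)"
        by (simp add: sum_distrib_left l2_inner_mult_left mult_ac)
    qed
    also have "\<dots> = 0" by (rule tri[OF i j])
    finally show ?thesis .
  qed
  ultimately show ?thesis using that by blast
qed

end

text \<open>
  The diagonal entries \<open>\<mu> i\<close> of the matrix \<open>a\<close> of \<open>T\<close> in this basis are the eigenvalues with their multiplicities.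
\<close>

locale triangular_compression = compression +
  fixes f :: "nat \<Rightarrow> complex \<Rightarrow> complex"
  assumes basis: "orthonormal_basis V n f"
    and tri: "\<And>i j. i < n \<Longrightarrow> j < i \<Longrightarrow> mat_of f i j = 0"
begin

abbreviation "a \<equiv> mat_of f"
abbreviation "\<mu> i \<equiv> a i i"
abbreviation coef :: "(complex \<Rightarrow> complex) \<Rightarrow> nat \<Rightarrow> complex" where "coef g i \<equiv> l2_inner g (f i)"
abbreviation comb :: "(nat \<Rightarrow> complex) \<Rightarrow> complex \<Rightarrow> complex" where "comb c \<equiv> (\<lambda>\<zeta>. \<Sum>i<n. c i * f i \<zeta>)"

lemmas on = orthonormal_basis_orthonormal[OF basis V_L2]
lemmas comb_V = basis_lincomb_in_V[OF basis]
lemmas comb_coef = basis_lincomb_inner[OF basis]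

lemma T_coef: "g \<in> V \<Longrightarrow> i < n \<Longrightarrow> coef (T g) i = (\<Sum>j<n. a i j * coef g j)"
  using T_has_matrix[OF basis] by (simp add: has_matrix_def)

fun mpow :: "nat \<Rightarrow> nat \<Rightarrow> nat \<Rightarrow> complex" where
  "mpow 0 i j = (if i = j then 1 else 0)"
| "mpow (Suc k) i j = (\<Sum>l<n. a i l * mpow k l j)"

lemma T_power_matrix: "has_matrix V n f (T ^^ k) (mpow k)"
proof (induction k)
  case 0
  show ?case unfolding has_matrix_def by (simp add: if_distrib[of "\<lambda>x. x * _"] cong: if_cong)
next
  case (Suc k)
  show ?case unfolding has_matrix_def
  proof (intro ballI conjI allI impI)
    fix g assume g: "g \<in> V"
    then have k: "(T ^^ k) g \<in> V" using Suc by (simp add: has_matrix_def)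
    then show "(T ^^ Suc k) g \<in> V" by (simp add: T_in_V)
    fix i assume i: "i < n"
    have "coef ((T ^^ Suc k) g) i = (\<Sum>l<n. a i l * coef ((T ^^ k) g) l)"
      using T_coef[OF k i] by simp
    also have "\<dots> = (\<Sum>l<n. a i l * (\<Sum>j<n. mpow k l j * coef g j))"
      by (rule sum.cong) (use Suc g in \<open>auto simp: has_matrix_def\<close>)
    also have "\<dots> = (\<Sum>j<n. mpow (Suc k) i j * coef g j)"
      by (simp add: sum_distrib_left sum_distrib_right mult.assoc) (rule sum.swap)
    finally show "coef ((T ^^ Suc k) g) i = (\<Sum>j<n. mpow (Suc k) i j * coef g j)" .
  qed
qed

lemma T_power_V: "g \<in> V \<Longrightarrow> (T ^^ k) g \<in> V"
  using T_power_matrix[of k] by (simp add: has_matrix_def)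

lemma mpow_triangular: "i < n \<Longrightarrow> j < n \<Longrightarrow> j \<le> i \<Longrightarrow> mpow k i j = (if i = j then \<mu> i ^ k else 0)"
proof (induction k arbitrary: i j)
  case (Suc k)
  have "a i l * mpow k l j = (if l = i then (if i = j then \<mu> i ^ Suc k else 0) else 0)" if l: "l < n" for l
  proof (cases l i rule: linorder_cases)
    case less
    then show ?thesis using tri[OF Suc.prems(1) less] by simp
  next
    case equal
    then show ?thesis using Suc.IH[of i j] Suc.prems by simp
  next
    case greater
    then show ?thesis using Suc.IH[of l j] Suc.prems l by simp
  qed
  then have "mpow (Suc k) i j = (\<Sum>l<n. if l = i then (if i = j then \<mu> i ^ Suc k else 0) else 0)" by simp
  also have "\<dots> = (if i = j then \<mu> i ^ Suc k else 0)" using Suc.prems by simp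
  finally show ?case .
qed simp

lemma trace_T_power:
  assumes "orthonormal_basis V m e"
  shows "(\<Sum>k<m. l2_inner ((T ^^ p) (e k)) (e k)) = (\<Sum>i<n. \<mu> i ^ p)"
  unfolding trace_basis_independent[OF V_L2 basis assms T_power_matrix]
  by (rule sum.cong) (simp_all add: mpow_triangular)

text \<open>
  Passing to coefficients turns an equation that holds almost everywhere into a finite linear system.
\<close>

lemma is_preimage_iff:
  assumes h: "h \<in> V"
  shows "is_preimage V T z h g \<longleftrightarrow>
    g \<in> V \<and> (\<forall>i<n. z * coef g i - (\<Sum>j<n. a i j * coef g j) = coef h i)"
proof (cases "g \<in> V")
  case g: True
  define d where "d \<zeta> = z * g \<zeta> + (-1) * T g \<zeta>" for \<zeta>
  have dV: "d \<in> V" unfolding d_def by (intro V_add V_cmult g T_in_V)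
  have dc: "coef d i = z * coef g i - (\<Sum>j<n. a i j * coef g j)" if i: "i < n" for i
  proof -
    have "g \<in> L2" "T g \<in> L2" using g T_in_V[OF g] V_L2 by auto
    from l2_inner_add_left[OF L2_cmult[OF this(1), of z] L2_cmult[OF this(2), of "-1"] orthonormal_L2[OF on i]]
    have "coef d i = z * coef g i + (-1) * coef (T g) i"
      unfolding d_def[abs_def] l2_inner_cmult_left .
    then show ?thesis using T_coef[OF g i] by simp
  qed
  have "is_preimage V T z h g \<longleftrightarrow> (AE \<zeta> in circ. d \<zeta> = h \<zeta>)"
    using g by (simp add: is_preimage_def d_def)
  also have "\<dots> \<longleftrightarrow> (\<forall>i<n. coef d i = coef h i)"
  proof
    assume "AE \<zeta> in circ. d \<zeta> = h \<zeta>"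
    then have "coef d i = coef h i" if "i < n" for i
      using dV V_L2 orthonormal_L2[OF on that] by (intro l2_inner_cong_AE) auto
    then show "\<forall>i<n. coef d i = coef h i" by blast
  next
    assume "\<forall>i<n. coef d i = coef h i"
    then show "AE \<zeta> in circ. d \<zeta> = h \<zeta>" by (intro basis_eqI[OF basis dV h]) auto
  qed
  finally show ?thesis using g dc by auto
qed (simp add: is_preimage_def)

definition G :: "complex \<Rightarrow> nat \<Rightarrow> nat \<Rightarrow> complex" where
  "G = (SOME G. resolvent_matrix n a G)"

lemma resolvent_matrix_G: "resolvent_matrix n a G"
  unfolding G_def by (rule someI_ex[OF triangular_resolvent]) (rule tri)

lemmas G = resolvent_matrixD[OF resolvent_matrix_G]

lemma preimage_coef_unique:
  assumes z: "\<And>m. m < n \<Longrightarrow> z \<noteq> \<mu> m" and h: "h \<in> V" and g: "is_preimage V T z h g" and k: "k < n"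
  shows "coef g k = (\<Sum>j<n. G z k j * coef h j)"
proof -
  from g h have eq: "\<And>i. i < n \<Longrightarrow> z * coef g i - (\<Sum>j<n. a i j * coef g j) = coef h i"
    by (simp add: is_preimage_iff)
  have "(\<Sum>j<n. G z k j * coef h j) = (\<Sum>j<n. G z k j * (z * coef g j - (\<Sum>l<n. a j l * coef g l)))"
    by (rule sum.cong) (simp_all add: eq)
  also have "\<dots> = (\<Sum>j<n. z * G z k j * coef g j) - (\<Sum>j<n. \<Sum>l<n. G z k j * a j l * coef g l)"
    by (simp add: right_diff_distrib sum_subtractf sum_distrib_left mult_ac)
  also have "(\<Sum>j<n. \<Sum>l<n. G z k j * a j l * coef g l) = (\<Sum>l<n. (\<Sum>j<n. G z k j * a j l) * coef g l)"
    by (subst sum.swap) (simp add: sum_distrib_right)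
  also have "(\<Sum>j<n. z * G z k j * coef g j) - (\<Sum>l<n. (\<Sum>j<n. G z k j * a j l) * coef g l)
     = (\<Sum>l<n. (z * G z k l - (\<Sum>j<n. G z k j * a j l)) * coef g l)"
    by (simp add: left_diff_distrib sum_subtractf)
  also have "\<dots> = (\<Sum>l<n. if l = k then coef g l else 0)"
    by (rule sum.cong) (use G(2)[OF z k] in auto)
  also have "\<dots> = coef g k" using k by simp
  finally show ?thesis by simp
qed

lemma preimage_exists:
  assumes z: "\<And>m. m < n \<Longrightarrow> z \<noteq> \<mu> m" and h: "h \<in> V"
  shows "is_preimage V T z h (comb (\<lambda>i. \<Sum>j<n. G z i j * coef h j))"
  unfolding is_preimage_iff[OF h]
proof (intro conjI allI impI)
  show "comb (\<lambda>i. \<Sum>j<n. G z i j * coef h j) \<in> V" by (rule comb_V)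
  fix i assume i: "i < n"
  let ?c = "\<lambda>i. \<Sum>j<n. G z i j * coef h j"
  have "z * ?c i - (\<Sum>k<n. a i k * ?c k) = (\<Sum>j<n. (z * G z i j - (\<Sum>k<n. a i k * G z k j)) * coef h j)"
  proof -
    have "(\<Sum>k<n. a i k * ?c k) = (\<Sum>j<n. \<Sum>k<n. a i k * G z k j * coef h j)"
      unfolding sum_distrib_left by (subst sum.swap) (simp add: mult.assoc)
    then show ?thesis
      by (simp add: sum_distrib_left sum_distrib_right left_diff_distrib sum_subtractf mult.assoc)
  qed
  also have "\<dots> = (\<Sum>j<n. if j = i then coef h j else 0)"
    by (rule sum.cong) (use G(1)[OF z i] in auto)
  also have "\<dots> = coef h i" using i by simp
  finally show "z * coef (comb ?c) i - (\<Sum>j<n. a i j * coef (comb ?c) j) = coef h i"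
    using i by (simp add: comb_coef)
qed

text \<open>
  Away from the diagonal entries \<open>G\<close> solves the linear system uniquely. At a diagonal entry an eigenvector is a
  second preimage of zero, and injectivity fails.
\<close>

lemma spectrum_eq: "op_spectrum V T = {\<mu> m | m. m < n}"
proof -
  have "(\<forall>h\<in>V. \<exists>g. is_preimage V T z h g \<and> (\<forall>g'. is_preimage V T z h g' \<longrightarrow> (AE \<zeta> in circ. g' \<zeta> = g \<zeta>)))
     \<longleftrightarrow> (\<forall>m<n. z \<noteq> \<mu> m)" (is "?L = ?R") for z
  proof
    assume L: ?L
    show ?R
    proof (intro allI impI notI)
      fix m assume m: "m < n" and zm: "z = \<mu> m"
      obtain v where v: "\<And>i. i < n \<Longrightarrow> \<mu> m * v i - (\<Sum>k<n. a i k * v k) = 0" and v0: "\<exists>i<n. v i \<noteq> 0"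
        by (rule triangular_eigenvector[of n a m]) (rule tri, assumption+, rule m, blast)
      have 0: "coef (\<lambda>\<zeta>. 0) i = 0" for i by simp
      have "is_preimage V T z (\<lambda>\<zeta>. 0) (comb v)"
        using v by (simp add: is_preimage_iff[OF V_zero] comb_V comb_coef zm)
      moreover have "is_preimage V T z (\<lambda>\<zeta>. 0) (\<lambda>\<zeta>. 0)"
        by (simp add: is_preimage_iff[OF V_zero] V_zero)
      moreover from L V_zero obtain g where
        "\<forall>g'. is_preimage V T z (\<lambda>\<zeta>. 0) g' \<longrightarrow> (AE \<zeta> in circ. g' \<zeta> = g \<zeta>)" by blast
      ultimately have "AE \<zeta> in circ. comb v \<zeta> = g \<zeta>" "AE \<zeta> in circ. 0 = g \<zeta>" by blast+
      then have ae: "AE \<zeta> in circ. comb v \<zeta> = 0" by eventually_elim simp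
      have "v i = 0" if i: "i < n" for i
      proof -
        have "v i = coef (comb v) i" using i by (simp add: comb_coef)
        also have "\<dots> = coef (\<lambda>\<zeta>. 0) i"
          using comb_V[of v] V_L2 orthonormal_L2[OF on i] ae by (intro l2_inner_cong_AE) auto
        finally show ?thesis by simp
      qed
      with v0 show False by blast
    qed
  next
    assume ?R
    then have z: "\<And>m. m < n \<Longrightarrow> z \<noteq> \<mu> m" by blast
    show ?L
    proof (intro ballI exI conjI allI impI)
      fix h assume h: "h \<in> V"
      show "is_preimage V T z h (comb (\<lambda>i. \<Sum>j<n. G z i j * coef h j))"
        by (rule preimage_exists[OF z h])
      fix g' assume g': "is_preimage V T z h g'"
      then have "g' \<in> V" by (simp add: is_preimage_def)
      then show "AE \<zeta> in circ. g' \<zeta> = comb (\<lambda>i. \<Sum>j<n. G z i j * coef h j) \<zeta>"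
        by (rule basis_eqI[OF basis _ comb_V])
           (simp add: comb_coef preimage_coef_unique[OF z h g'])
    qed
  qed
  then show ?thesis unfolding op_spectrum_def by blast
qed

lemma finite_spectrum: "finite (op_spectrum V T)"
  unfolding spectrum_eq by simp

lemma resolvent_coef:
  assumes z: "z \<notin> op_spectrum V T" and h: "h \<in> V"
  shows "op_resolvent V T z h \<in> V" "k < n \<Longrightarrow> coef (op_resolvent V T z h) k = (\<Sum>j<n. G z k j * coef h j)"
proof -
  have z': "\<And>m. m < n \<Longrightarrow> z \<noteq> \<mu> m" using z by (auto simp: spectrum_eq)
  have p: "is_preimage V T z h (op_resolvent V T z h)"
    unfolding op_resolvent_def by (rule someI[of "is_preimage V T z h", OF preimage_exists[OF z' h]])
  then show "op_resolvent V T z h \<in> V" by (simp add: is_preimage_def)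
  show "k < n \<Longrightarrow> coef (op_resolvent V T z h) k = (\<Sum>j<n. G z k j * coef h j)"
    by (rule preimage_coef_unique[OF z' h p])
qed

lemma residue_sum:
  assumes "open S" "w \<in> S" "\<And>i. i \<in> I \<Longrightarrow> F i holomorphic_on S - {w}"
  shows "residue (\<lambda>z. \<Sum>i\<in>I. c i * F i z) w = (\<Sum>i\<in>I. c i * residue (F i) w)"
  using assms(3)
proof (induction I rule: infinite_finite_induct)
  case (insert x I)
  have "residue (\<lambda>z. c x * F x z + (\<Sum>i\<in>I. c i * F i z)) w = residue (\<lambda>z. c x * F x z) w + residue (\<lambda>z. \<Sum>i\<in>I. c i * F i z) w"
    by (rule residue_add[OF assms(1,2)]) (use insert.prems in \<open>auto intro!: holomorphic_intros\<close>)
  also have "residue (\<lambda>z. c x * F x z) w = c x * residue (F x) w"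
    by (rule residue_lmul[OF assms(1,2)]) (use insert.prems in auto)
  finally show ?case using insert by simp
qed (simp_all add: residue_const)

text \<open>
  In a punctured neighbourhood of an eigenvalue the pairing with the resolvent is a fixed linear combination of
  the entries of \<open>G\<close>, so its residues are the same combination of residues. The resulting sesquilinear form is
  represented by an element of \<open>V\<close>, which is the witness for the choice in \<^const>\<open>hol_calculus\<close>.
\<close>

lemma hol_calculus_matrix:
  assumes F: "F holomorphic_on U" and U: "open U" "op_spectrum V T \<subseteq> U"
  shows "has_matrix V n f (hol_calculus V T F) (\<lambda>i j. \<Sum>w\<in>op_spectrum V T. residue (\<lambda>z. F z * G z i j) w)"
proof -
  let ?M = "\<lambda>i j. \<Sum>w\<in>op_spectrum V T. residue (\<lambda>z. F z * G z i j) w"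
  have main: "(\<Sum>w\<in>op_spectrum V T. residue (\<lambda>z. F z * l2_inner (op_resolvent V T z h) k) w)
     = (\<Sum>i<n. (\<Sum>j<n. ?M i j * coef h j) * cnj (coef k i))" if h: "h \<in> V" and k: "k \<in> V" for h k
  proof -
    have "residue (\<lambda>z. F z * l2_inner (op_resolvent V T z h) k) w
        = (\<Sum>p\<in>{..<n}\<times>{..<n}. (coef h (snd p) * cnj (coef k (fst p))) * residue (\<lambda>z. F z * G z (fst p) (snd p)) w)"
      if w: "w \<in> op_spectrum V T" for w
    proof -
      have "residue (\<lambda>z. F z * l2_inner (op_resolvent V T z h) k) w
        = residue (\<lambda>z. \<Sum>p\<in>{..<n}\<times>{..<n}. (coef h (snd p) * cnj (coef k (fst p))) * (F z * G z (fst p) (snd p))) w"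
      proof (rule residue_cong[OF _ refl])
        \<comment> \<open>the resolvent is known off the spectrum only, and the spectrum is finite, hence discrete\<close>
        have "open (- (op_spectrum V T - {w}))"
          using finite_spectrum by (intro open_Compl finite_imp_closed) auto
        from eventually_at_in_open'[OF this, of w]
        have "eventually (\<lambda>z. z \<notin> op_spectrum V T - {w}) (at w)" by (simp only: Compl_iff) simp
        moreover have "eventually (\<lambda>z. z \<noteq> w) (at w)" by (simp add: eventually_neq_at_within)
        ultimately have "eventually (\<lambda>z. z \<notin> op_spectrum V T) (at w)" by eventually_elim auto
        then show "eventually (\<lambda>z. F z * l2_inner (op_resolvent V T z h) k
           = (\<Sum>p\<in>{..<n}\<times>{..<n}. (coef h (snd p) * cnj (coef k (fst p))) * (F z * G z (fst p) (snd p)))) (at w)"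
        proof eventually_elim
          case (elim z)
          note r = resolvent_coef[OF elim h]
          have "l2_inner (op_resolvent V T z h) k = (\<Sum>i<n. coef (op_resolvent V T z h) i * l2_inner (f i) k)"
            by (rule basis_expansion[OF basis V_L2 r(1)]) (use k V_L2 in auto)
          also have "\<dots> = (\<Sum>i<n. \<Sum>j<n. G z i j * coef h j * cnj (coef k i))"
            by (rule sum.cong) (simp_all add: r(2) sum_distrib_right l2_inner_commute[of "f _" k])
          finally show ?case
            by (simp add: sum.cartesian_product[symmetric] sum_distrib_left mult_ac case_prod_unfold
                sum.cartesian_product)
        qed
      qed
      also have "\<dots> = (\<Sum>p\<in>{..<n}\<times>{..<n}. (coef h (snd p) * cnj (coef k (fst p))) * residue (\<lambda>z. F z * G z (fst p) (snd p)) w)"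
      proof (rule residue_sum)
        let ?S = "U - (op_spectrum V T - {w})"
        show "open ?S" using U finite_spectrum by (intro open_Diff finite_imp_closed) auto
        show "w \<in> ?S" using U w by auto
        show "(\<lambda>z. F z * G z (fst p) (snd p)) holomorphic_on ?S - {w}" for p
          by (intro holomorphic_on_mult holomorphic_on_subset[OF F] holomorphic_on_subset[OF G(3)])
             (auto simp: spectrum_eq)
      qed
      finally show ?thesis .
    qed
    then have "(\<Sum>w\<in>op_spectrum V T. residue (\<lambda>z. F z * l2_inner (op_resolvent V T z h) k) w)
      = (\<Sum>w\<in>op_spectrum V T. \<Sum>p\<in>{..<n}\<times>{..<n}. (coef h (snd p) * cnj (coef k (fst p))) * residue (\<lambda>z. F z * G z (fst p) (snd p)) w)"
      by (rule sum.cong[OF refl])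
    also have "\<dots> = (\<Sum>p\<in>{..<n}\<times>{..<n}. (coef h (snd p) * cnj (coef k (fst p))) * ?M (fst p) (snd p))"
      by (subst sum.swap) (simp add: sum_distrib_left)
    also have "\<dots> = (\<Sum>i<n. \<Sum>j<n. coef h j * cnj (coef k i) * ?M i j)"
      by (simp add: sum.cartesian_product case_prod_unfold)
    also have "\<dots> = (\<Sum>i<n. (\<Sum>j<n. ?M i j * coef h j) * cnj (coef k i))"
      by (simp add: sum_distrib_right sum_distrib_left mult_ac)
    finally show ?thesis .
  qed
  show ?thesis unfolding has_matrix_def
  proof
    fix h assume h: "h \<in> V"
    let ?c = "\<lambda>i. \<Sum>j<n. ?M i j * coef h j"
    have "\<exists>g. g \<in> V \<and> (\<forall>k\<in>V. l2_inner g k = (\<Sum>w\<in>op_spectrum V T. residue (\<lambda>z. F z * l2_inner (op_resolvent V T z h) k) w))"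
    proof (intro exI[of _ "comb ?c"] conjI ballI)
      show "comb ?c \<in> V" by (rule comb_V)
      fix k assume k: "k \<in> V"
      have "l2_inner (comb ?c) k = (\<Sum>i<n. ?c i * l2_inner (f i) k)"
        by (rule l2_inner_lincomb_left) (use k V_L2 on in \<open>auto simp: orthonormal_L2\<close>)
      then show "l2_inner (comb ?c) k = (\<Sum>w\<in>op_spectrum V T. residue (\<lambda>z. F z * l2_inner (op_resolvent V T z h) k) w)"
        unfolding main[OF h k] l2_inner_commute[of "f _" k] .
    qed
    from someI_ex[OF this]
    have g: "hol_calculus V T F h \<in> V"
      "\<And>k. k \<in> V \<Longrightarrow> l2_inner (hol_calculus V T F h) k = (\<Sum>w\<in>op_spectrum V T. residue (\<lambda>z. F z * l2_inner (op_resolvent V T z h) k) w)"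
      unfolding hol_calculus_def by blast+
    show "hol_calculus V T F h \<in> V \<and> (\<forall>i<n. coef (hol_calculus V T F h) i = (\<Sum>j<n. ?M i j * coef h j))"
    proof (intro conjI allI impI)
      fix i assume i: "i < n"
      have fi: "f i \<in> V" by (rule basis_in_V[OF basis i])
      have "coef (hol_calculus V T F h) i = (\<Sum>l<n. ?c l * cnj (coef (f i) l))"
        unfolding g(2)[OF fi] by (rule main[OF h fi])
      also have "\<dots> = (\<Sum>l<n. if l = i then ?c l else 0)"
        by (rule sum.cong[OF refl]) (use on i in \<open>simp add: orthonormal_inner\<close>)
      also have "\<dots> = ?c i" using i by simp
      finally show "coef (hol_calculus V T F h) i = ?c i" .
    qed (rule g)
  qed
qed

text \<open>
  Whatever the entries of \<open>G\<close> off the diagonal are, those on it are \<open>1 / (z - \<mu> i)\<close>, with a single simple pole.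
\<close>

lemma trace_hol_calculus:
  assumes F: "F holomorphic_on U" and U: "open U" "op_spectrum V T \<subseteq> U"
  shows "op_trace V (hol_calculus V T F) = (\<Sum>i<n. F (\<mu> i))"
  unfolding op_trace_eq[OF V_L2 basis hol_calculus_matrix[OF F U]]
proof (rule sum.cong[OF refl])
  fix i assume "i \<in> {..<n}"
  then have i: "i < n" by simp
  have "residue (\<lambda>z. F z * G z i i) w = (if w = \<mu> i then F (\<mu> i) else 0)" if w: "w \<in> op_spectrum V T" for w
  proof -
    have e: "(\<lambda>z. F z * G z i i) = (\<lambda>z. F z / (z - \<mu> i))" using G(4)[OF i] by simp
    show ?thesis
    proof (cases "w = \<mu> i")
      case True
      then show ?thesis unfolding e using residue_simple[OF U(1) _ F, of "\<mu> i"] w U by auto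
    next
      case False
      have "residue (\<lambda>z. F z / (z - \<mu> i)) w = 0"
        by (rule residue_holo[of "U - {\<mu> i}"])
           (use False w U in \<open>auto intro!: holomorphic_intros holomorphic_on_subset[OF F] open_Diff\<close>)
      with False show ?thesis unfolding e by simp
    qed
  qed
  then have "(\<Sum>w\<in>op_spectrum V T. residue (\<lambda>z. F z * G z i i) w) = (\<Sum>w\<in>op_spectrum V T. if w = \<mu> i then F (\<mu> i) else 0)"
    by (rule sum.cong[OF refl])
  also have "\<dots> = F (\<mu> i)" using i finite_spectrum by (auto simp: spectrum_eq)
  finally show "(\<Sum>w\<in>op_spectrum V T. residue (\<lambda>z. F z * G z i i) w) = F (\<mu> i)" .
qed

end

lemma poly_interpolation:
  fixes y :: "complex \<Rightarrow> complex"
  assumes "finite S"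
  shows "\<exists>p. \<forall>w\<in>S. poly p w = y w"
  using assms
proof (induction S rule: finite_induct)
  case (insert x S)
  then obtain p where p: "\<forall>w\<in>S. poly p w = y w" by blast
  define q where "q = (\<Prod>s\<in>S. [:- s, 1:])"
  have q: "poly q x = (\<Prod>s\<in>S. x - s)" "poly q w = 0" if "w \<in> S" for w
    using that insert.hyps by (auto simp: q_def poly_prod)
  have qx: "poly q x \<noteq> 0" using insert.hyps by (auto simp: q_def poly_prod)
  have "\<forall>w\<in>insert x S. poly (p + Polynomial.smult ((y x - poly p x) / poly q x) q) w = y w"
    using p q qx by auto
  then show ?case by blast
qed auto

lemma l2_norm_circ: "l2_norm circ g = sqrt (l2_sq g)"
  by (simp add: l2_norm_def l2_sq_def)

context triangular_compression
begin

lemma l2_sq_coef: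
  assumes g: "g \<in> V"
  shows "l2_sq g = (\<Sum>i<n. (cmod (coef g i))\<^sup>2)"
proof -
  have "AE \<zeta> in circ. g \<zeta> = comb (coef g) \<zeta>" using basis g by (simp add: orthonormal_basis_def)
  then have "l2_sq g = l2_sq (comb (coef g))" using g V_L2 by (intro l2_sq_cong_AE) auto
  then show ?thesis by (simp add: orthonormal_lincomb_sq[OF on])
qed

text \<open>
  For a real symbol the matrix is Hermitian, and a Hermitian triangular matrix is diagonal.
\<close>

lemma selfadjoint_diagonal:
  assumes real: "AE \<zeta> in circ. \<phi> \<zeta> \<in> \<real>" and i: "i < n" and j: "j < n" and ij: "i \<noteq> j"
  shows "a i j = 0"
proof -
  have sym: "a j i = cnj (a i j)" if "i < n" "j < n" for i j
  proof -
    have fi: "f i \<in> L2" "f j \<in> L2" using on that by (auto simp: orthonormal_L2)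
    have "a j i = l2_inner (\<lambda>\<zeta>. cnj (\<phi> \<zeta>) * f i \<zeta>) (f j)"
    proof (rule l2_inner_cong_AE)
      show "AE \<zeta> in circ. \<phi> \<zeta> * f i \<zeta> = cnj (\<phi> \<zeta>) * f i \<zeta>"
        using real by eventually_elim (simp add: Reals_cnj_iff)
    qed (use fi symbol in auto)
    also have "\<dots> = l2_inner (f i) (\<lambda>\<zeta>. \<phi> \<zeta> * f j \<zeta>)" by (simp add: l2_inner_mult_left)
    also have "\<dots> = cnj (a i j)" by (rule l2_inner_commute)
    finally show ?thesis .
  qed
  show ?thesis
  proof (cases "j < i")
    case True then show ?thesis using tri i by simp
  next
    case False
    then have "i < j" using ij by simp
    then have "a j i = 0" using tri j by simp
    then show ?thesis using sym[OF i j] by simp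
  qed
qed

lemma selfadjoint_power_coef:
  assumes real: "AE \<zeta> in circ. \<phi> \<zeta> \<in> \<real>" and g: "g \<in> V" and i: "i < n"
  shows "coef ((T ^^ k) g) i = \<mu> i ^ k * coef g i"
proof (induction k)
  case (Suc k)
  have "coef ((T ^^ Suc k) g) i = (\<Sum>j<n. a i j * coef ((T ^^ k) g) j)"
    using T_coef[OF T_power_V[OF g] i] by simp
  also have "\<dots> = (\<Sum>j<n. if j = i then \<mu> i * coef ((T ^^ k) g) i else 0)"
    by (rule sum.cong[OF refl]) (use selfadjoint_diagonal[OF real i] in auto)
  also have "\<dots> = \<mu> i * coef ((T ^^ k) g) i" using i by simp
  finally show ?case using Suc by simp
qed simp

lemma poly_op_V: "g \<in> V \<Longrightarrow> poly_op p T g \<in> V"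
  unfolding poly_op_def by (intro V_lincomb T_power_V)

lemma selfadjoint_poly_coef:
  assumes real: "AE \<zeta> in circ. \<phi> \<zeta> \<in> \<real>" and g: "g \<in> V" and i: "i < n"
  shows "coef (poly_op p T g) i = poly p (\<mu> i) * coef g i"
proof -
  have "coef (poly_op p T g) i = (\<Sum>k\<le>degree p. coeff p k * coef ((T ^^ k) g) i)"
    unfolding poly_op_def
    by (rule l2_inner_lincomb_left) (use T_power_V[OF g] V_L2 orthonormal_L2[OF on i] in auto)
  then show ?thesis
    by (simp add: selfadjoint_power_coef[OF real g i] poly_altdef sum_distrib_right mult.assoc)
qed

text \<open>
  \<open>T\<close> is diagonal, so \<open>p(T)\<close> multiplies the \<open>i\<close>-th coefficient by \<open>p(\<mu> i)\<close>, and the diagonal operator with entries \<open>F(\<mu> i)\<close> has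
  the required limit property. Conversely, \<open>F\<close> agrees with an interpolation polynomial on the finite spectrum, and the
  constant sequence of this polynomial determines any limit.
\<close>

lemma cont_calculus_matrix:
  assumes real: "AE \<zeta> in circ. \<phi> \<zeta> \<in> \<real>"
  shows "has_matrix V n f (cont_calculus V T F) (\<lambda>i j. if i = j then F (Re (\<mu> i)) else 0)"
  unfolding has_matrix_def
proof
  fix h assume h: "h \<in> V"
  define g0 where "g0 = comb (\<lambda>i. F (Re (\<mu> i)) * coef h i)"
  have g0: "g0 \<in> V" "\<And>i. i < n \<Longrightarrow> coef g0 i = F (Re (\<mu> i)) * coef h i"
    unfolding g0_def by (rule comb_V) (rule comb_coef)
  have dist: "l2_sq (\<lambda>\<zeta>. poly_op p T h \<zeta> - g \<zeta>) = (\<Sum>i<n. (cmod (poly p (\<mu> i) * coef h i - coef g i))\<^sup>2)"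
    if g: "g \<in> V" for p g
  proof -
    have gp: "poly_op p T h \<in> L2" "g \<in> L2" using poly_op_V[OF h] g V_L2 by auto
    have "(\<lambda>\<zeta>. poly_op p T h \<zeta> + (-1) * g \<zeta>) \<in> V" by (intro V_add V_cmult poly_op_V h g)
    then have dV: "(\<lambda>\<zeta>. poly_op p T h \<zeta> - g \<zeta>) \<in> V" by simp
    show ?thesis unfolding l2_sq_coef[OF dV]
    proof (rule sum.cong[OF refl])
      fix i assume "i \<in> {..<n}"
      then have i: "i < n" by simp
      show "(cmod (coef (\<lambda>\<zeta>. poly_op p T h \<zeta> - g \<zeta>) i))\<^sup>2 = (cmod (poly p (\<mu> i) * coef h i - coef g i))\<^sup>2"
        unfolding l2_inner_diff_left[OF gp orthonormal_L2[OF on i]] selfadjoint_poly_coef[OF real h i] ..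
    qed
  qed
  have \<mu>: "\<mu> i \<in> op_spectrum V T" if "i < n" for i using that by (auto simp: spectrum_eq)
  let ?P = "\<lambda>g. g \<in> V \<and> (\<forall>p :: nat \<Rightarrow> complex poly.
      uniform_limit (op_spectrum V T) (\<lambda>n. poly (p n)) (\<lambda>z. F (Re z)) sequentially \<longrightarrow>
      (\<lambda>n. l2_norm circ (\<lambda>\<zeta>. poly_op (p n) T h \<zeta> - g \<zeta>)) \<longlonglongrightarrow> 0)"
  have "?P g0"
  proof (intro conjI allI impI)
    fix p :: "nat \<Rightarrow> complex poly"
    assume p: "uniform_limit (op_spectrum V T) (\<lambda>n. poly (p n)) (\<lambda>z. F (Re z)) sequentially"
    have "(\<lambda>N. l2_sq (\<lambda>\<zeta>. poly_op (p N) T h \<zeta> - g0 \<zeta>)) \<longlonglongrightarrow> (\<Sum>i<n. (cmod (F (Re (\<mu> i)) * coef h i - coef g0 i))\<^sup>2)"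
      unfolding dist[OF g0(1)]
      by (intro tendsto_sum tendsto_power tendsto_norm tendsto_diff tendsto_mult tendsto_const
          tendsto_uniform_limitI[OF p] \<mu>) auto
    also have "(\<Sum>i<n. (cmod (F (Re (\<mu> i)) * coef h i - coef g0 i))\<^sup>2) = 0"
      by (rule sum.neutral) (simp add: g0)
    finally show "(\<lambda>n. l2_norm circ (\<lambda>\<zeta>. poly_op (p n) T h \<zeta> - g0 \<zeta>)) \<longlonglongrightarrow> 0"
      unfolding l2_norm_circ using tendsto_real_sqrt[of _ 0] by simp
  qed (rule g0)
  then have P: "?P (cont_calculus V T F h)"
    unfolding cont_calculus_def by (rule someI[of ?P])
  then have cV: "cont_calculus V T F h \<in> V" by blast
  obtain p where p: "\<forall>w\<in>op_spectrum V T. poly p w = F (Re w)"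
    using poly_interpolation[OF finite_spectrum, of "\<lambda>z. F (Re z)"] by blast
  have "uniform_limit (op_spectrum V T) (\<lambda>n. poly p) (\<lambda>z. F (Re z)) sequentially"
    by (rule uniform_limitI) (simp add: p)
  from conjunct2[OF P, rule_format, of "\<lambda>_. p", OF this]
  have "(\<lambda>n::nat. l2_norm circ (\<lambda>\<zeta>. poly_op p T h \<zeta> - cont_calculus V T F h \<zeta>)) \<longlonglongrightarrow> 0" .
  then have "l2_norm circ (\<lambda>\<zeta>. poly_op p T h \<zeta> - cont_calculus V T F h \<zeta>) = 0"
    by (simp add: LIMSEQ_const_iff)
  then have "(\<Sum>i<n. (cmod (poly p (\<mu> i) * coef h i - coef (cont_calculus V T F h) i))\<^sup>2) = 0"
    unfolding l2_norm_circ dist[OF cV] by simp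
  then have "\<forall>i\<in>{..<n}. (cmod (poly p (\<mu> i) * coef h i - coef (cont_calculus V T F h) i))\<^sup>2 = 0"
    by (subst (asm) sum_nonneg_eq_0_iff) auto
  then have c: "coef (cont_calculus V T F h) i = F (Re (\<mu> i)) * coef h i" if "i < n" for i
  proof -
    have "poly p (\<mu> i) * coef h i = coef (cont_calculus V T F h) i"
      using \<open>\<forall>i\<in>{..<n}. _ = 0\<close> that by auto
    moreover have "poly p (\<mu> i) = F (Re (\<mu> i))" using p \<mu>[OF that] by blast
    ultimately show ?thesis by (simp only:)
  qed
  show "cont_calculus V T F h \<in> V \<and> (\<forall>i<n. coef (cont_calculus V T F h) i =
      (\<Sum>j<n. (if i = j then F (Re (\<mu> i)) else 0) * coef h j))"
    using cV by (auto simp: c if_distrib[of "\<lambda>x. x * _"] cong: if_cong)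
qed

lemma trace_cont_calculus:
  assumes real: "AE \<zeta> in circ. \<phi> \<zeta> \<in> \<real>"
  shows "op_trace V (cont_calculus V T F) = (\<Sum>i<n. F (Re (\<mu> i)))"
  unfolding op_trace_eq[OF V_L2 basis cont_calculus_matrix[OF real]] by simp

end

section \<open>Essential range and numerical range\<close>

text \<open>
  \<open>|g|\<^sup>2\<close> is a probability density, and the mean of values on one side of a line is on that side. This locates the
  numerical range of \<open>T\<close>, and with it the diagonal entries in a Schur basis.
\<close>

lemma weighted_mean_in_closed_convex:
  assumes K: "closed K" "convex K" and \<phi>: "\<phi> \<in> Linf" "AE \<zeta> in circ. \<phi> \<zeta> \<in> K"
    and g: "g \<in> L2" "l2_inner g g = 1"
  shows "l2_inner (\<lambda>\<zeta>. \<phi> \<zeta> * g \<zeta>) g \<in> K"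
proof (rule ccontr)
  assume "l2_inner (\<lambda>\<zeta>. \<phi> \<zeta> * g \<zeta>) g \<notin> K"
  from separating_hyperplane_closed_point[OF K(2,1) this] obtain a b where
    a: "inner a (l2_inner (\<lambda>\<zeta>. \<phi> \<zeta> * g \<zeta>) g) < b" and b: "\<forall>x\<in>K. inner a x > b" by blast
  have eq: "\<phi> \<zeta> * g \<zeta> * cnj (g \<zeta>) = (cmod (g \<zeta>))\<^sup>2 *\<^sub>R \<phi> \<zeta>" for \<zeta>
    by (simp add: scaleR_conv_of_real complex_norm_square mult_ac del: of_real_power)
  have i: "integrable circ (\<lambda>\<zeta>. (cmod (g \<zeta>))\<^sup>2 *\<^sub>R \<phi> \<zeta>)"
    using L2_inner_integrable[OF L2_mult[OF \<phi>(1) g(1)] g(1)] unfolding eq .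
  have g1: "(LINT \<zeta>|circ. (cmod (g \<zeta>))\<^sup>2) = 1"
    using g(2) l2_sq_eq_inner[of g] by (simp add: l2_sq_def)
  have "b = (LINT \<zeta>|circ. b * (cmod (g \<zeta>))\<^sup>2)" by (simp add: g1)
  also have "\<dots> \<le> (LINT \<zeta>|circ. inner a ((cmod (g \<zeta>))\<^sup>2 *\<^sub>R \<phi> \<zeta>))"
  proof (rule integral_mono_AE)
    show "integrable circ (\<lambda>\<zeta>. b * (cmod (g \<zeta>))\<^sup>2)" using L2_integrable[OF g(1)] by simp
    show "integrable circ (\<lambda>\<zeta>. inner a ((cmod (g \<zeta>))\<^sup>2 *\<^sub>R \<phi> \<zeta>))" using i by (rule integrable_inner_right)
    show "AE \<zeta> in circ. b * (cmod (g \<zeta>))\<^sup>2 \<le> inner a ((cmod (g \<zeta>))\<^sup>2 *\<^sub>R \<phi> \<zeta>)"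
      using \<phi>(2) by eventually_elim (use b in \<open>auto simp: mult.commute intro!: mult_right_mono dest!: bspec\<close>)
  qed
  also have "\<dots> = inner a (l2_inner (\<lambda>\<zeta>. \<phi> \<zeta> * g \<zeta>) g)"
    unfolding l2_inner_def eq by (rule integral_inner_right) (rule i)
  finally show False using a by simp
qed

text \<open>
  The complement of the essential range is covered by discs with null preimages; by Lindelof's theorem countably many
  of them suffice.
\<close>

lemma AE_in_ess_range:
  assumes "\<phi> \<in> borel_measurable circ"
  shows "AE \<zeta> in circ. \<phi> \<zeta> \<in> ess_range \<phi>"
proof -
  define \<F> where "\<F> = {ball w e | w e. e > 0 \<and> emeasure circ {\<zeta> \<in> space circ. dist (\<phi> \<zeta>) w < e} = 0}"
  obtain \<G> where G: "\<G> \<subseteq> \<F>" "countable \<G>" "\<Union>\<G> = \<Union>\<F>"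
    by (rule Lindelof[of \<F>]) (auto simp: \<F>_def)
  have "AE \<zeta> in circ. \<phi> \<zeta> \<notin> S" if S: "S \<in> \<G>" for S
  proof -
    from S G obtain w e where we: "S = ball w e" "emeasure circ {\<zeta> \<in> space circ. dist (\<phi> \<zeta>) w < e} = 0"
      by (auto simp: \<F>_def)
    have "{\<zeta> \<in> space circ. dist (\<phi> \<zeta>) w < e} \<in> sets circ" using assms by measurable
    then have "AE \<zeta> in circ. \<not> dist (\<phi> \<zeta>) w < e"
      using we(2) by (subst AE_iff_measurable[of "{\<zeta> \<in> space circ. dist (\<phi> \<zeta>) w < e}"]) auto
    then show ?thesis by eventually_elim (simp add: we dist_commute)
  qed
  then have "AE \<zeta> in circ. \<forall>S\<in>\<G>. \<phi> \<zeta> \<notin> S" using G(2) by (subst AE_ball_countable) auto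
  then show ?thesis
  proof eventually_elim
    case (elim \<zeta>)
    show ?case unfolding ess_range_def
    proof (intro CollectI allI impI)
      fix e :: real assume e: "e > 0"
      show "emeasure circ {\<zeta>' \<in> space circ. dist (\<phi> \<zeta>') (\<phi> \<zeta>) < e} > 0"
      proof (rule ccontr)
        assume "\<not> ?thesis"
        then have "ball (\<phi> \<zeta>) e \<in> \<F>" using e unfolding \<F>_def by auto
        moreover have "\<phi> \<zeta> \<in> ball (\<phi> \<zeta>) e" using e by simp
        ultimately have "\<phi> \<zeta> \<in> \<Union>\<G>" unfolding G(3) by (rule UnionI)
        with elim show False by blast
      qed
    qed
  qed
qed

lemma compact_conv_ess_range:
  assumes "\<phi> \<in> Linf"
  shows "compact (conv_ess_range \<phi>)" "convex (conv_ess_range \<phi>)" "conv_ess_range \<phi> \<noteq> {}"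
    "AE \<zeta> in circ. \<phi> \<zeta> \<in> conv_ess_range \<phi>"
proof -
  obtain C where C: "AE \<zeta> in circ. cmod (\<phi> \<zeta>) \<le> C" using assms by (auto simp: Linf_def)
  have m: "\<phi> \<in> borel_measurable circ" using assms by (rule Linf_measurable)
  have "ess_range \<phi> \<subseteq> cball 0 C"
  proof (rule subsetI, rule ccontr)
    fix w assume w: "w \<in> ess_range \<phi>" and "w \<notin> cball 0 C"
    then have e: "cmod w - C > 0" by simp
    have s: "{\<zeta> \<in> space circ. dist (\<phi> \<zeta>) w < cmod w - C} \<in> sets circ" using m by measurable
    have "AE \<zeta> in circ. \<not> dist (\<phi> \<zeta>) w < cmod w - C"
      using C
    proof eventually_elim
      case (elim \<zeta>)
      then show ?case using norm_triangle_ineq2[of w "\<phi> \<zeta>"] by (simp add: dist_norm norm_minus_commute)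
    qed
    then have "emeasure circ {\<zeta> \<in> space circ. dist (\<phi> \<zeta>) w < cmod w - C} = 0"
      using s by (subst (asm) AE_iff_measurable[of "{\<zeta> \<in> space circ. dist (\<phi> \<zeta>) w < cmod w - C}"]) auto
    moreover have "emeasure circ {\<zeta> \<in> space circ. dist (\<phi> \<zeta>) w < cmod w - C} > 0"
      using w e unfolding ess_range_def by blast
    ultimately show False by simp
  qed
  then have "bounded (ess_range \<phi>)" using bounded_cball bounded_subset by blast
  then show "compact (conv_ess_range \<phi>)"
    unfolding conv_ess_range_def by (simp add: compact_eq_bounded_closed bounded_convex_hull bounded_closure)
  show "convex (conv_ess_range \<phi>)"
    unfolding conv_ess_range_def by (intro convex_closure convex_convex_hull)
  have "ess_range \<phi> \<subseteq> conv_ess_range \<phi>"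
    unfolding conv_ess_range_def by (rule order_trans[OF hull_subset closure_subset])
  with AE_in_ess_range[OF m] show ae: "AE \<zeta> in circ. \<phi> \<zeta> \<in> conv_ess_range \<phi>"
    by (auto elim!: eventually_mono)
  show "conv_ess_range \<phi> \<noteq> {}"
  proof
    assume "conv_ess_range \<phi> = {}"
    with ae have "AE \<zeta> in circ. False" by simp
    then show False by simp
  qed
qed

text \<open>
  The extended essential supremum has to be shown finite, because \<^const>\<open>ess_sup\<close> sends infinite values to 0.
\<close>

lemma AE_le_ess_sup:
  assumes m: "u \<in> borel_measurable circ" and C: "AE \<zeta> in circ. \<bar>u \<zeta>\<bar> \<le> C"
  shows "AE \<zeta> in circ. u \<zeta> \<le> ess_sup u"
proof -
  let ?s = "esssup circ (\<lambda>\<zeta>. ereal (u \<zeta>))"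
  have ae: "AE \<zeta> in circ. ereal (u \<zeta>) \<le> ?s" by (rule esssup_AE)
  have "?s \<le> ereal C"
    by (rule esssup_I) (use m C in \<open>auto elim!: eventually_mono\<close>)
  moreover have "ereal (- C) \<le> ?s"
  proof (rule ccontr)
    assume "\<not> ereal (- C) \<le> ?s"
    then have "?s < ereal (- C)" by simp
    have "AE \<zeta> in circ. False"
      using ae C
    proof eventually_elim
      case (elim \<zeta>)
      from elim(1) \<open>esssup circ (\<lambda>\<zeta>. ereal (u \<zeta>)) < ereal (- C)\<close> have "ereal (u \<zeta>) < ereal (- C)" by (rule order_le_less_trans)
      with elim(2) show ?case by simp
    qed
    then show False by simp
  qed
  ultimately obtain r where r: "?s = ereal r" by (cases ?s) auto
  show ?thesis using ae unfolding r ess_sup_def by simp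
qed

lemma AE_in_ess_interval:
  assumes m: "u \<in> borel_measurable circ" and C: "AE \<zeta> in circ. \<bar>u \<zeta>\<bar> \<le> C"
  shows "AE \<zeta> in circ. u \<zeta> \<in> {ess_inf u..ess_sup u}"
proof -
  have "AE \<zeta> in circ. - u \<zeta> \<le> ess_sup (\<lambda>\<zeta>. - u \<zeta>)"
  proof (rule AE_le_ess_sup[where C = C])
    show "(\<lambda>\<zeta>. - u \<zeta>) \<in> borel_measurable circ" using m by measurable
    show "AE \<zeta> in circ. \<bar>- u \<zeta>\<bar> \<le> C" using C by simp
  qed
  with AE_le_ess_sup[OF m C] show ?thesis by eventually_elim (simp add: ess_inf_def)
qed

section \<open>Symbols of negligible defect\<close>

locale orthonormal_sequence =
  fixes e :: "nat \<Rightarrow> complex \<Rightarrow> complex"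
  assumes on: "\<And>N. orthonormal N e"
begin

lemma e_L2: "e j \<in> L2"
  using orthonormal_L2[OF on[of "Suc j"]] by simp

lemma e_sq: "l2_sq (e j) = 1"
  using orthonormal_inner[OF on[of "Suc j"], of j j] l2_sq_eq_inner[of "e j"] by simp

definition coproj :: "nat \<Rightarrow> (complex \<Rightarrow> complex) \<Rightarrow> complex \<Rightarrow> complex" where
  "coproj N h \<zeta> = h \<zeta> - proj N e h \<zeta>"

text \<open>
  With \<open>P\<close> the projection onto the span of \<open>e 0, \<dots>, e (N - 1)\<close>, this is the squared Hilbert-Schmidt norm of \<open>(1 - P) \<psi> P\<close>:
  the extent to which multiplication by \<open>\<psi>\<close> fails to preserve the span.
\<close>

definition defect :: "nat \<Rightarrow> (complex \<Rightarrow> complex) \<Rightarrow> real" where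
  "defect N \<psi> = (\<Sum>j<N. l2_sq (coproj N (\<lambda>\<zeta>. \<psi> \<zeta> * e j \<zeta>)))"

definition negligible_defect :: "(complex \<Rightarrow> complex) \<Rightarrow> bool" where
  "negligible_defect \<psi> \<longleftrightarrow> \<psi> \<in> Linf \<and> (\<lambda>N. defect N \<psi> / real N) \<longlonglongrightarrow> 0"

lemma coproj_L2: "h \<in> L2 \<Longrightarrow> coproj N h \<in> L2"
  unfolding coproj_def[abs_def] by (intro L2_diff proj_L2 on)

lemma coproj_le: "h \<in> L2 \<Longrightarrow> l2_sq (coproj N h) \<le> l2_sq h"
  unfolding coproj_def[abs_def] by (rule coproj_sq_le[OF on])

lemma proj_add: "g \<in> L2 \<Longrightarrow> h \<in> L2 \<Longrightarrow> proj N e (\<lambda>\<zeta>. g \<zeta> + h \<zeta>) \<zeta> = proj N e g \<zeta> + proj N e h \<zeta>"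
  unfolding proj_def by (simp add: l2_inner_add_left e_L2 distrib_right sum.distrib)

lemma proj_lincomb:
  assumes "\<And>i. i < n \<Longrightarrow> g i \<in> L2"
  shows "proj N e (\<lambda>\<zeta>. \<Sum>i<n. c i * g i \<zeta>) \<zeta> = (\<Sum>i<n. c i * proj N e (g i) \<zeta>)"
proof -
  have "l2_inner (\<lambda>\<zeta>. \<Sum>i<n. c i * g i \<zeta>) (e k) = (\<Sum>i<n. c i * l2_inner (g i) (e k))" for k
    by (rule l2_inner_lincomb_left) (use assms e_L2 in auto)
  then have "proj N e (\<lambda>\<zeta>. \<Sum>i<n. c i * g i \<zeta>) \<zeta> = (\<Sum>k<N. \<Sum>i<n. c i * (l2_inner (g i) (e k) * e k \<zeta>))"
    by (simp add: proj_def sum_distrib_right mult.assoc)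
  also have "\<dots> = (\<Sum>i<n. \<Sum>k<N. c i * (l2_inner (g i) (e k) * e k \<zeta>))" by (rule sum.swap)
  finally show ?thesis by (simp add: proj_def sum_distrib_left)
qed

lemma coproj_add: "g \<in> L2 \<Longrightarrow> h \<in> L2 \<Longrightarrow> coproj N (\<lambda>\<zeta>. g \<zeta> + h \<zeta>) = (\<lambda>\<zeta>. coproj N g \<zeta> + coproj N h \<zeta>)"
  by (rule ext) (simp add: coproj_def proj_add)

lemma coproj_lincomb:
  "(\<And>i. i < n \<Longrightarrow> g i \<in> L2) \<Longrightarrow> coproj N (\<lambda>\<zeta>. \<Sum>i<n. c i * g i \<zeta>) = (\<lambda>\<zeta>. \<Sum>i<n. c i * coproj N (g i) \<zeta>)"
  by (rule ext) (simp add: coproj_def proj_lincomb right_diff_distrib sum_subtractf)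

lemma defect_nonneg: "defect N \<psi> \<ge> 0"
  unfolding defect_def by (rule sum_nonneg) simp

lemma defect_le: "\<psi> \<in> Linf \<Longrightarrow> defect N \<psi> \<le> (\<Sum>j<N. l2_sq (\<lambda>\<zeta>. \<psi> \<zeta> * e j \<zeta>))"
  unfolding defect_def by (intro sum_mono coproj_le L2_mult e_L2)

lemma defect_add:
  assumes "\<psi> \<in> Linf" "\<eta> \<in> Linf"
  shows "defect N (\<lambda>\<zeta>. \<psi> \<zeta> + \<eta> \<zeta>) \<le> 2 * defect N \<psi> + 2 * defect N \<eta>"
proof -
  have "defect N (\<lambda>\<zeta>. \<psi> \<zeta> + \<eta> \<zeta>)
     \<le> (\<Sum>j<N. 2 * l2_sq (coproj N (\<lambda>\<zeta>. \<psi> \<zeta> * e j \<zeta>)) + 2 * l2_sq (coproj N (\<lambda>\<zeta>. \<eta> \<zeta> * e j \<zeta>)))"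
    unfolding defect_def
  proof (rule sum_mono)
    fix j
    have L: "(\<lambda>\<zeta>. \<psi> \<zeta> * e j \<zeta>) \<in> L2" "(\<lambda>\<zeta>. \<eta> \<zeta> * e j \<zeta>) \<in> L2" using assms e_L2 by auto
    show "l2_sq (coproj N (\<lambda>\<zeta>. (\<psi> \<zeta> + \<eta> \<zeta>) * e j \<zeta>))
        \<le> 2 * l2_sq (coproj N (\<lambda>\<zeta>. \<psi> \<zeta> * e j \<zeta>)) + 2 * l2_sq (coproj N (\<lambda>\<zeta>. \<eta> \<zeta> * e j \<zeta>))"
      unfolding distrib_right coproj_add[OF L] by (intro l2_sq_add_le coproj_L2 L)
  qed
  then show ?thesis by (simp add: defect_def sum.distrib sum_distrib_left)
qed

text \<open>
  The compression of multiplication by \<open>\<psi>\<close> has operator norm at most \<open>D\<close>. The inner sum runs over the row index, so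
  this is the transposed matrix; it is handled by Bessel's inequality for multiplication by \<open>cnj \<psi>\<close>.
\<close>

lemma multiplication_matrix_bound:
  assumes \<psi>: "\<psi> \<in> borel_measurable circ" "AE \<zeta> in circ. cmod (\<psi> \<zeta>) \<le> D"
  shows "(\<Sum>j<N. (cmod (\<Sum>i<N. l2_inner (\<lambda>\<zeta>. \<psi> \<zeta> * e j \<zeta>) (e i) * v i))\<^sup>2) \<le> D\<^sup>2 * (\<Sum>i<N. (cmod (v i))\<^sup>2)"
proof -
  have \<psi>': "\<psi> \<in> Linf" using \<psi> by (auto simp: Linf_def)
  define u where "u = (\<lambda>\<zeta>. \<Sum>i<N. cnj (v i) * e i \<zeta>)"
  have u: "u \<in> L2" "l2_sq u = (\<Sum>i<N. (cmod (v i))\<^sup>2)"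
    unfolding u_def using orthonormal_lincomb_L2[OF on] orthonormal_lincomb_sq[OF on] by simp_all
  define h where "h \<zeta> = cnj (\<psi> \<zeta>) * u \<zeta>" for \<zeta>
  have h: "h \<in> L2" "l2_sq h \<le> D\<^sup>2 * l2_sq u"
    unfolding h_def[abs_def] by (rule L2_mult_bounded; use \<psi> u in auto)+
  have "(\<Sum>i<N. l2_inner (\<lambda>\<zeta>. \<psi> \<zeta> * e j \<zeta>) (e i) * v i) = cnj (l2_inner h (e j))" for j
  proof -
    have "l2_inner (\<lambda>\<zeta>. \<psi> \<zeta> * e j \<zeta>) u = (\<Sum>i<N. cnj (cnj (v i)) * l2_inner (\<lambda>\<zeta>. \<psi> \<zeta> * e j \<zeta>) (e i))"
      unfolding u_def by (rule l2_inner_lincomb_right) (use \<psi>' e_L2 in auto)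
    moreover have "l2_inner (\<lambda>\<zeta>. \<psi> \<zeta> * e j \<zeta>) u = l2_inner (e j) h"
      unfolding h_def by (rule l2_inner_mult_left)
    ultimately show ?thesis by (simp add: l2_inner_commute[of "e j" h] mult.commute)
  qed
  then have "(\<Sum>j<N. (cmod (\<Sum>i<N. l2_inner (\<lambda>\<zeta>. \<psi> \<zeta> * e j \<zeta>) (e i) * v i))\<^sup>2) = (\<Sum>j<N. (cmod (l2_inner h (e j)))\<^sup>2)"
    by simp
  also have "\<dots> \<le> l2_sq h" by (rule bessel[OF on h(1)])
  finally show ?thesis using h(2) u(2) by simp
qed

text \<open>
  Write \<open>(1 - P) \<phi> \<psi> P = (1 - P) \<phi> P \<cdot> P \<psi> P + (1 - P) \<phi> \<cdot> (1 - P) \<psi> P\<close>. Each term is a Hilbert-Schmidt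
  operator times an operator whose norm is bounded by the essential supremum of a symbol.
\<close>

lemma defect_mult:
  assumes \<phi>: "\<phi> \<in> borel_measurable circ" "AE \<zeta> in circ. cmod (\<phi> \<zeta>) \<le> C"
    and \<psi>: "\<psi> \<in> borel_measurable circ" "AE \<zeta> in circ. cmod (\<psi> \<zeta>) \<le> D"
  shows "defect N (\<lambda>\<zeta>. \<phi> \<zeta> * \<psi> \<zeta>) \<le> 2 * D\<^sup>2 * defect N \<phi> + 2 * C\<^sup>2 * defect N \<psi>"
proof -
  have L: "\<phi> \<in> Linf" "\<psi> \<in> Linf" using \<phi> \<psi> by (auto simp: Linf_def)
  define m where "m i j = l2_inner (\<lambda>\<zeta>. \<psi> \<zeta> * e j \<zeta>) (e i)" for i j
  define d where "d i = coproj N (\<lambda>\<zeta>. \<phi> \<zeta> * e i \<zeta>)" for i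
  define d' where "d' j = coproj N (\<lambda>\<zeta>. \<psi> \<zeta> * e j \<zeta>)" for j
  \<comment> \<open>the contribution of the first term to \<open>e j\<close>: the vectors \<open>d i\<close> mixed by the matrix of \<open>P \<psi> P\<close>\<close>
  define s where "s j \<zeta> = (\<Sum>i<N. m i j * d i \<zeta>)" for j \<zeta>
  have d: "d i \<in> L2" "d' i \<in> L2" for i
    unfolding d_def d'_def by (intro coproj_L2 L2_mult L e_L2)+
  have s: "s j \<in> L2" for j unfolding s_def by (intro L2_sum L2_cmult d)
  have "l2_sq (coproj N (\<lambda>\<zeta>. \<phi> \<zeta> * \<psi> \<zeta> * e j \<zeta>)) \<le> 2 * l2_sq (s j) + 2 * (C\<^sup>2 * l2_sq (d' j))" for j
  proof -
    have eq: "(\<lambda>\<zeta>. \<phi> \<zeta> * \<psi> \<zeta> * e j \<zeta>) = (\<lambda>\<zeta>. (\<Sum>i<N. m i j * (\<phi> \<zeta> * e i \<zeta>)) + \<phi> \<zeta> * d' j \<zeta>)"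
    proof (rule ext)
      fix \<zeta>
      have "\<psi> \<zeta> * e j \<zeta> = (\<Sum>i<N. m i j * e i \<zeta>) + d' j \<zeta>"
        by (simp add: d'_def coproj_def proj_def m_def)
      then have "\<phi> \<zeta> * (\<psi> \<zeta> * e j \<zeta>) = \<phi> \<zeta> * ((\<Sum>i<N. m i j * e i \<zeta>) + d' j \<zeta>)" by simp
      then show "\<phi> \<zeta> * \<psi> \<zeta> * e j \<zeta> = (\<Sum>i<N. m i j * (\<phi> \<zeta> * e i \<zeta>)) + \<phi> \<zeta> * d' j \<zeta>"
        by (simp add: distrib_left sum_distrib_left mult_ac)
    qed
    have L1: "(\<lambda>\<zeta>. \<Sum>i<N. m i j * (\<phi> \<zeta> * e i \<zeta>)) \<in> L2" by (intro L2_sum L2_cmult L2_mult L e_L2)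
    have L2': "(\<lambda>\<zeta>. \<phi> \<zeta> * d' j \<zeta>) \<in> L2" by (intro L2_mult L d)
    have "coproj N (\<lambda>\<zeta>. \<phi> \<zeta> * \<psi> \<zeta> * e j \<zeta>) = (\<lambda>\<zeta>. s j \<zeta> + coproj N (\<lambda>\<zeta>. \<phi> \<zeta> * d' j \<zeta>) \<zeta>)"
      unfolding eq coproj_add[OF L1 L2']
      by (subst coproj_lincomb) (auto simp: s_def d_def intro!: L2_mult L e_L2)
    then have "l2_sq (coproj N (\<lambda>\<zeta>. \<phi> \<zeta> * \<psi> \<zeta> * e j \<zeta>)) \<le> 2 * l2_sq (s j) + 2 * l2_sq (coproj N (\<lambda>\<zeta>. \<phi> \<zeta> * d' j \<zeta>))"
      by (simp only:) (intro l2_sq_add_le s coproj_L2 L2')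
    also have "l2_sq (coproj N (\<lambda>\<zeta>. \<phi> \<zeta> * d' j \<zeta>)) \<le> l2_sq (\<lambda>\<zeta>. \<phi> \<zeta> * d' j \<zeta>)" by (rule coproj_le[OF L2'])
    also have "\<dots> \<le> C\<^sup>2 * l2_sq (d' j)" by (rule L2_mult_bounded(2)[OF \<phi> d(2)])
    finally show ?thesis by simp
  qed
  then have "defect N (\<lambda>\<zeta>. \<phi> \<zeta> * \<psi> \<zeta>) \<le> (\<Sum>j<N. 2 * l2_sq (s j) + 2 * (C\<^sup>2 * l2_sq (d' j)))"
    unfolding defect_def by (intro sum_mono)
  also have "\<dots> = 2 * (\<Sum>j<N. l2_sq (s j)) + 2 * C\<^sup>2 * defect N \<psi>"
    by (simp add: sum.distrib sum_distrib_left defect_def d'_def mult.assoc)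
  finally have 1: "defect N (\<lambda>\<zeta>. \<phi> \<zeta> * \<psi> \<zeta>) \<le> 2 * (\<Sum>j<N. l2_sq (s j)) + 2 * C\<^sup>2 * defect N \<psi>" .
  \<comment> \<open>the matrix bound holds pointwise, for the vector of the values \<open>d i \<zeta>\<close>, and is then integrated\<close>
  have "(\<Sum>j<N. l2_sq (s j)) = (LINT \<zeta>|circ. (\<Sum>j<N. (cmod (s j \<zeta>))\<^sup>2))"
    unfolding l2_sq_def by (rule Bochner_Integration.integral_sum[symmetric]) (rule L2_integrable[OF s])
  also have "\<dots> \<le> (LINT \<zeta>|circ. D\<^sup>2 * (\<Sum>i<N. (cmod (d i \<zeta>))\<^sup>2))"
  proof (rule integral_mono_AE)
    show "integrable circ (\<lambda>\<zeta>. \<Sum>j<N. (cmod (s j \<zeta>))\<^sup>2)"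
      by (intro Bochner_Integration.integrable_sum L2_integrable s)
    show "integrable circ (\<lambda>\<zeta>. D\<^sup>2 * (\<Sum>i<N. (cmod (d i \<zeta>))\<^sup>2))"
      by (intro integrable_mult_right Bochner_Integration.integrable_sum L2_integrable d)
    show "AE \<zeta> in circ. (\<Sum>j<N. (cmod (s j \<zeta>))\<^sup>2) \<le> D\<^sup>2 * (\<Sum>i<N. (cmod (d i \<zeta>))\<^sup>2)"
      unfolding s_def m_def by (rule AE_I2) (rule multiplication_matrix_bound[OF \<psi>])
  qed
  also have "\<dots> = D\<^sup>2 * (\<Sum>i<N. LINT \<zeta>|circ. (cmod (d i \<zeta>))\<^sup>2)"
    by (simp add: Bochner_Integration.integral_sum L2_integrable d)
  also have "\<dots> = D\<^sup>2 * defect N \<phi>" by (simp add: defect_def d_def l2_sq_def)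
  finally have "2 * (\<Sum>j<N. l2_sq (s j)) \<le> 2 * (D\<^sup>2 * defect N \<phi>)" by simp
  with 1 show ?thesis by simp
qed

lemma negligible_defectI:
  assumes "\<psi> \<in> Linf" "\<And>N. defect N \<psi> \<le> b N" "(\<lambda>N. b N / real N) \<longlonglongrightarrow> 0"
  shows "negligible_defect \<psi>"
  unfolding negligible_defect_def
proof (intro conjI)
  show "(\<lambda>N. defect N \<psi> / real N) \<longlonglongrightarrow> 0"
    by (rule Lim_null_comparison[OF _ assms(3)])
       (auto intro!: always_eventually divide_right_mono assms(2) simp: defect_nonneg)
qed fact

lemma negligible_add:
  assumes "negligible_defect \<psi>" "negligible_defect \<eta>"
  shows "negligible_defect (\<lambda>\<zeta>. \<psi> \<zeta> + \<eta> \<zeta>)"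
proof (rule negligible_defectI[OF _ defect_add])
  have "(\<lambda>N. 2 * (defect N \<psi> / real N) + 2 * (defect N \<eta> / real N)) \<longlonglongrightarrow> 2 * 0 + 2 * 0"
    using assms by (intro tendsto_intros) (auto simp: negligible_defect_def)
  then show "(\<lambda>N. (2 * defect N \<psi> + 2 * defect N \<eta>) / real N) \<longlonglongrightarrow> 0"
    by (simp add: add_divide_distrib)
qed (use assms in \<open>auto simp: negligible_defect_def\<close>)

lemma negligible_mult:
  assumes "negligible_defect \<phi>" "negligible_defect \<psi>"
  shows "negligible_defect (\<lambda>\<zeta>. \<phi> \<zeta> * \<psi> \<zeta>)"
proof -
  have L: "\<phi> \<in> Linf" "\<psi> \<in> Linf" using assms by (auto simp: negligible_defect_def)
  obtain C D where C: "AE \<zeta> in circ. cmod (\<phi> \<zeta>) \<le> C" and D: "AE \<zeta> in circ. cmod (\<psi> \<zeta>) \<le> D"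
    using L by (auto simp: Linf_def)
  show ?thesis
  proof (rule negligible_defectI[OF _ defect_mult[OF _ C _ D]])
    have "(\<lambda>N. 2 * D\<^sup>2 * (defect N \<phi> / real N) + 2 * C\<^sup>2 * (defect N \<psi> / real N)) \<longlonglongrightarrow> 2 * D\<^sup>2 * 0 + 2 * C\<^sup>2 * 0"
      using assms by (intro tendsto_intros) (auto simp: negligible_defect_def)
    then show "(\<lambda>N. (2 * D\<^sup>2 * defect N \<phi> + 2 * C\<^sup>2 * defect N \<psi>) / real N) \<longlonglongrightarrow> 0"
      by (simp add: add_divide_distrib)
  qed (use L in \<open>auto dest: Linf_measurable\<close>)
qed

text \<open>
  Multiplication by a constant preserves the span.
\<close>

lemma negligible_const: "negligible_defect (\<lambda>\<zeta>. c)"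
proof (rule negligible_defectI[where b = "\<lambda>_. 0"])
  show "defect N (\<lambda>\<zeta>. c) \<le> 0" for N
  proof -
    have "coproj N (\<lambda>\<zeta>. c * e j \<zeta>) = (\<lambda>\<zeta>. 0)" if j: "j < N" for j
    proof (rule ext)
      fix \<zeta>
      have "proj N e (\<lambda>\<zeta>. c * e j \<zeta>) \<zeta> = (\<Sum>i<N. if i = j then c * e j \<zeta> else 0)"
        unfolding proj_def
        by (rule sum.cong) (use orthonormal_inner[OF on j] in \<open>auto simp: l2_inner_cmult_left\<close>)
      also have "\<dots> = c * e j \<zeta>" using j by simp
      finally show "coproj N (\<lambda>\<zeta>. c * e j \<zeta>) \<zeta> = 0" by (simp add: coproj_def)
    qed
    then show ?thesis by (simp add: defect_def l2_sq_def)
  qed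
qed auto

lemma negligible_power: "negligible_defect \<phi> \<Longrightarrow> negligible_defect (\<lambda>\<zeta>. \<phi> \<zeta> ^ k)"
  by (induction k) (auto intro: negligible_const negligible_mult)

text \<open>
  For a unimodular symbol the vectors \<open>\<psi> e\<^sub>j\<close> have norm 1, so the defect is \<open>N\<close> minus the squared Hilbert-Schmidt
  norm of \<open>P \<psi> P\<close>. The compression of the conjugate symbol is the adjoint and has the same Hilbert-Schmidt norm.
\<close>

lemma defect_cnj_unimodular:
  assumes \<psi>: "\<psi> \<in> Linf" and uni: "\<And>\<zeta>. cmod \<zeta> = 1 \<Longrightarrow> cmod (\<psi> \<zeta>) = 1"
  shows "defect N (\<lambda>\<zeta>. cnj (\<psi> \<zeta>)) = defect N \<psi>"
proof -
  have d: "defect N \<eta> = (\<Sum>j<N. 1 - (\<Sum>i<N. (cmod (l2_inner (\<lambda>\<zeta>. \<eta> \<zeta> * e j \<zeta>) (e i)))\<^sup>2))"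
    if \<eta>: "\<eta> \<in> Linf" and u: "\<And>\<zeta>. cmod \<zeta> = 1 \<Longrightarrow> cmod (\<eta> \<zeta>) = 1" for \<eta>
    unfolding defect_def
  proof (rule sum.cong[OF refl])
    fix j
    have L: "(\<lambda>\<zeta>. \<eta> \<zeta> * e j \<zeta>) \<in> L2" by (intro L2_mult \<eta> e_L2)
    have "l2_sq (\<lambda>\<zeta>. \<eta> \<zeta> * e j \<zeta>) = l2_sq (e j)"
      unfolding l2_sq_def by (rule integral_circ_cong) (simp add: norm_mult u)
    with proj_pythagoras[OF on L, of N] e_sq[of j]
    show "l2_sq (coproj N (\<lambda>\<zeta>. \<eta> \<zeta> * e j \<zeta>)) = 1 - (\<Sum>i<N. (cmod (l2_inner (\<lambda>\<zeta>. \<eta> \<zeta> * e j \<zeta>) (e i)))\<^sup>2)"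
      by (simp add: coproj_def[abs_def])
  qed
  have "cmod (l2_inner (\<lambda>\<zeta>. cnj (\<psi> \<zeta>) * e j \<zeta>) (e i)) = cmod (l2_inner (\<lambda>\<zeta>. \<psi> \<zeta> * e i \<zeta>) (e j))" for i j
  proof -
    have "l2_inner (\<lambda>\<zeta>. cnj (\<psi> \<zeta>) * e j \<zeta>) (e i) = l2_inner (e j) (\<lambda>\<zeta>. \<psi> \<zeta> * e i \<zeta>)"
      by (simp add: l2_inner_mult_left)
    then show ?thesis by (simp add: l2_inner_commute[of "e j"])
  qed
  then have "defect N (\<lambda>\<zeta>. cnj (\<psi> \<zeta>)) = (\<Sum>j<N. 1 - (\<Sum>i<N. (cmod (l2_inner (\<lambda>\<zeta>. \<psi> \<zeta> * e i \<zeta>) (e j)))\<^sup>2))"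
    using uni by (subst d[OF Linf_cnj[OF \<psi>]]) simp_all
  also have "\<dots> = (\<Sum>j<N. 1 - (\<Sum>i<N. (cmod (l2_inner (\<lambda>\<zeta>. \<psi> \<zeta> * e j \<zeta>) (e i)))\<^sup>2))"
    unfolding sum_subtractf by (subst (2) sum.swap) simp
  finally show ?thesis using d[OF \<psi> uni] by simp
qed

text \<open>
  The approximation hypothesis has the form in which smallness in the \<open>\<Lambda>\<close>-norm is available: for the Takenaka-Malmquist
  basis, the sum divided by \<open>N\<close> is the squared norm of \<open>\<psi> - g\<close> in \<open>L\<^sup>2(\<nu>\<^sub>N)\<close>. It bounds the defect of \<open>\<psi> - g\<close> because
  \<open>1 - P\<close> is a contraction.
\<close>

lemma negligible_approx:
  assumes \<psi>: "\<psi> \<in> Linf"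
    and approx: "\<And>\<epsilon>. \<epsilon> > 0 \<Longrightarrow> \<exists>g. negligible_defect g \<and> (\<forall>N\<ge>1. (\<Sum>j<N. l2_sq (\<lambda>\<zeta>. (\<psi> \<zeta> - g \<zeta>) * e j \<zeta>)) \<le> \<epsilon> * real N)"
  shows "negligible_defect \<psi>"
  unfolding negligible_defect_def
proof (intro conjI \<psi>, unfold LIMSEQ_iff, intro allI impI)
  fix r :: real assume r: "r > 0"
  obtain g where g: "negligible_defect g"
    and a: "\<And>N. N \<ge> 1 \<Longrightarrow> (\<Sum>j<N. l2_sq (\<lambda>\<zeta>. (\<psi> \<zeta> - g \<zeta>) * e j \<zeta>)) \<le> r / 8 * real N"
    using approx[of "r / 8"] r by auto
  have gL: "g \<in> Linf" and "(\<lambda>N. defect N g / real N) \<longlonglongrightarrow> 0" using g by (auto simp: negligible_defect_def)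
  then have "eventually (\<lambda>N. defect N g / real N < r / 8) sequentially"
    using r by (intro order_tendstoD(2)) auto
  then obtain N0 where N0: "\<And>N. N \<ge> N0 \<Longrightarrow> defect N g / real N < r / 8"
    by (auto simp: eventually_sequentially)
  show "\<exists>no. \<forall>N\<ge>no. norm (defect N \<psi> / real N - 0) < r"
  proof (intro exI[of _ "max 1 N0"] allI impI)
    fix N assume N: "N \<ge> max 1 N0"
    have L: "(\<lambda>\<zeta>. \<psi> \<zeta> - g \<zeta>) \<in> Linf" using \<psi> gL by auto
    have "defect N \<psi> = defect N (\<lambda>\<zeta>. (\<psi> \<zeta> - g \<zeta>) + g \<zeta>)" by simp
    also have "\<dots> \<le> 2 * defect N (\<lambda>\<zeta>. \<psi> \<zeta> - g \<zeta>) + 2 * defect N g" by (rule defect_add[OF L gL])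
    also have "defect N (\<lambda>\<zeta>. \<psi> \<zeta> - g \<zeta>) \<le> r / 8 * real N"
      using order_trans[OF defect_le[OF L] a] N by simp
    also have "defect N g \<le> r / 8 * real N"
      using N0[of N] N by (simp add: pos_divide_less_eq)
    finally have "defect N \<psi> \<le> r / 2 * real N" by simp
    then have "defect N \<psi> / real N \<le> r / 2" using N by (simp add: pos_divide_le_eq)
    then have "defect N \<psi> / real N < r" using r by linarith
    moreover have "defect N \<psi> / real N \<ge> 0" by (simp add: defect_nonneg)
    ultimately show "norm (defect N \<psi> / real N - 0) < r" by simp
  qed
qed

text \<open>
  Polynomials in \<open>\<zeta>\<close> and \<open>cnj \<zeta>\<close> are uniformly dense in the continuous functions on the circle.
\<close>

lemma negligible_continuous:
  assumes z: "negligible_defect (\<lambda>\<zeta>. \<zeta>)" "negligible_defect cnj" and h: "continuous_on (sphere 0 1) h"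
  shows "negligible_defect h"
proof -
  have lin: "negligible_defect (\<lambda>\<zeta>. complex_of_real (p \<zeta>))" if "real_polynomial_function p" for p :: "complex \<Rightarrow> real"
    using that
  proof (induction p rule: real_polynomial_function.induct)
    case (linear f)
    interpret f: bounded_linear f by fact
    have "complex_of_real (f \<zeta>) = (\<zeta> + cnj \<zeta>) * (1/2) * complex_of_real (f 1) + (\<zeta> + (-1) * cnj \<zeta>) * (- \<i>/2) * complex_of_real (f \<i>)" for \<zeta>
    proof -
      have "\<zeta> = Re \<zeta> *\<^sub>R 1 + Im \<zeta> *\<^sub>R \<i>" by (simp add: complex_eq_iff)
      then have "f \<zeta> = f (Re \<zeta> *\<^sub>R 1 + Im \<zeta> *\<^sub>R \<i>)" by (rule arg_cong)
      also have "\<dots> = Re \<zeta> * f 1 + Im \<zeta> * f \<i>" by (simp add: f.add f.scaleR)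
      finally have 1: "complex_of_real (f \<zeta>) = complex_of_real (Re \<zeta>) * complex_of_real (f 1) + complex_of_real (Im \<zeta>) * complex_of_real (f \<i>)"
        by simp
      have "complex_of_real (Re \<zeta>) = (\<zeta> + cnj \<zeta>) * (1/2)" "complex_of_real (Im \<zeta>) = (\<zeta> + (-1) * cnj \<zeta>) * (- \<i>/2)"
        by (simp_all add: complex_eq_iff)
      with 1 show ?thesis by (simp only:)
    qed
    then have "(\<lambda>\<zeta>. complex_of_real (f \<zeta>)) = (\<lambda>\<zeta>. (\<zeta> + cnj \<zeta>) * (1/2) * complex_of_real (f 1) + (\<zeta> + (-1) * cnj \<zeta>) * (- \<i>/2) * complex_of_real (f \<i>))"
      by (rule ext)
    then show ?case using z by (simp only:) (intro negligible_add negligible_mult negligible_const)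
  next
    case (const c) show ?case by (rule negligible_const)
  next
    case (add f g) then show ?case by (simp add: negligible_add)
  next
    case (mult f g) then show ?case by (simp add: negligible_mult)
  qed
  show ?thesis
  proof (rule negligible_approx)
    show "h \<in> Linf" by (rule Linf_continuous[OF h])
    fix \<epsilon> :: real assume \<epsilon>: "\<epsilon> > 0"
    obtain g where g: "polynomial_function g" "\<And>x. x \<in> sphere 0 1 \<Longrightarrow> norm (h x - g x) < sqrt \<epsilon>"
      using Stone_Weierstrass_polynomial_function[OF compact_sphere h, of "sqrt \<epsilon>"] \<epsilon> by auto
    have "real_polynomial_function (\<lambda>x. Re (g x))" "real_polynomial_function (\<lambda>x. Im (g x))"
      using g(1) bounded_linear_Re bounded_linear_Im unfolding polynomial_function_def comp_def by blast+
    then have "negligible_defect (\<lambda>\<zeta>. complex_of_real (Re (g \<zeta>)) + \<i> * complex_of_real (Im (g \<zeta>)))"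
      by (intro negligible_add negligible_mult negligible_const lin)
    then have "negligible_defect g" by (simp flip: complex_eq)
    moreover have "(\<Sum>j<N. l2_sq (\<lambda>\<zeta>. (h \<zeta> - g \<zeta>) * e j \<zeta>)) \<le> \<epsilon> * real N" for N
    proof -
      have gL: "g \<in> Linf" using \<open>negligible_defect g\<close> by (simp add: negligible_defect_def)
      have "l2_sq (\<lambda>\<zeta>. (h \<zeta> - g \<zeta>) * e j \<zeta>) \<le> (sqrt \<epsilon>)\<^sup>2 * l2_sq (e j)" for j
      proof (rule L2_mult_bounded(2))
        show "(\<lambda>\<zeta>. h \<zeta> - g \<zeta>) \<in> borel_measurable circ"
          using Linf_diff[OF Linf_continuous[OF h] gL] by (rule Linf_measurable)
        show "AE \<zeta> in circ. cmod (h \<zeta> - g \<zeta>) \<le> sqrt \<epsilon>"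
          by (rule AE_circI) (use g(2) in \<open>auto intro: less_imp_le\<close>)
      qed (rule e_L2)
      then have "l2_sq (\<lambda>\<zeta>. (h \<zeta> - g \<zeta>) * e j \<zeta>) \<le> \<epsilon>" for j using \<epsilon> by (simp add: e_sq)
      then have "(\<Sum>j<N. l2_sq (\<lambda>\<zeta>. (h \<zeta> - g \<zeta>) * e j \<zeta>)) \<le> (\<Sum>j<N. \<epsilon>)" by (rule sum_mono)
      then show ?thesis by (simp add: mult.commute)
    qed
    ultimately show "\<exists>g. negligible_defect g \<and> (\<forall>N\<ge>1. (\<Sum>j<N. l2_sq (\<lambda>\<zeta>. (h \<zeta> - g \<zeta>) * e j \<zeta>)) \<le> \<epsilon> * real N)" by blast
  qed
qed

definition compress :: "nat \<Rightarrow> (complex \<Rightarrow> complex) \<Rightarrow> (complex \<Rightarrow> complex) \<Rightarrow> complex \<Rightarrow> complex" where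
  "compress N \<phi> g = proj N e (\<lambda>\<zeta>. \<phi> \<zeta> * g \<zeta>)"

lemma compress_power_L2: "((compress N \<phi>) ^^ k) (e j) \<in> L2"
  by (induction k) (auto simp: compress_def e_L2 proj_L2[OF on])

definition power_error :: "(complex \<Rightarrow> complex) \<Rightarrow> nat \<Rightarrow> nat \<Rightarrow> nat \<Rightarrow> complex \<Rightarrow> complex" where
  "power_error \<phi> N k j \<zeta> = ((compress N \<phi>) ^^ k) (e j) \<zeta> - \<phi> \<zeta> ^ k * e j \<zeta>"

lemma power_error_L2: "\<phi> \<in> Linf \<Longrightarrow> power_error \<phi> N k j \<in> L2"
  unfolding power_error_def[abs_def] by (intro L2_diff compress_power_L2 L2_mult Linf_power e_L2)

text \<open>
  With \<open>P\<close> the projection and \<open>T = P \<phi> P\<close>, the error for the next power is \<open>P \<phi>\<close> applied to the error for \<open>k\<close>, minus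
  \<open>(1 - P) (\<phi>\<^sup>k\<^sup>+\<^sup>1 e\<^sub>j)\<close>. The latter is controlled by the defect of \<open>\<phi>\<^sup>k\<^sup>+\<^sup>1\<close>, which is negligible as well.
\<close>

lemma compress_power_limit:
  assumes \<phi>: "negligible_defect \<phi>"
  shows "(\<lambda>N. (\<Sum>j<N. l2_sq (power_error \<phi> N k j)) / real N) \<longlonglongrightarrow> 0"
proof (induction k)
  case 0
  show ?case by (simp add: l2_sq_def power_error_def)
next
  case (Suc k)
  have L: "\<phi> \<in> Linf" using \<phi> by (simp add: negligible_defect_def)
  obtain C where C: "AE \<zeta> in circ. cmod (\<phi> \<zeta>) \<le> C" using L by (auto simp: Linf_def)
  let ?s = "power_error \<phi>"
  note sL = power_error_L2[OF L]
  have step: "l2_sq (?s N (Suc k) j) \<le> 2 * C\<^sup>2 * l2_sq (?s N k j) + 2 * l2_sq (coproj N (\<lambda>\<zeta>. \<phi> \<zeta> ^ Suc k * e j \<zeta>))" for N j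
  proof -
    let ?p = "\<lambda>\<zeta>. \<phi> \<zeta> ^ Suc k * e j \<zeta>"
    have pL: "?p \<in> L2" by (intro L2_mult Linf_power L e_L2)
    have fL: "(\<lambda>\<zeta>. \<phi> \<zeta> * ?s N k j \<zeta>) \<in> L2" by (intro L2_mult L sL)
    have "(\<lambda>\<zeta>. \<phi> \<zeta> * ((compress N \<phi>) ^^ k) (e j) \<zeta>) = (\<lambda>\<zeta>. \<phi> \<zeta> * ?s N k j \<zeta> + ?p \<zeta>)"
      by (simp add: power_error_def[of \<phi> N k] algebra_simps)
    then have "?s N (Suc k) j = (\<lambda>\<zeta>. proj N e (\<lambda>\<zeta>. \<phi> \<zeta> * ?s N k j \<zeta>) \<zeta> + (-1) * coproj N ?p \<zeta>)"
      using proj_add[OF fL pL, of N] by (intro ext) (simp add: power_error_def[of \<phi> N "Suc k"] compress_def coproj_def)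
    then have "l2_sq (?s N (Suc k) j) \<le> 2 * l2_sq (proj N e (\<lambda>\<zeta>. \<phi> \<zeta> * ?s N k j \<zeta>)) + 2 * l2_sq (\<lambda>\<zeta>. (-1) * coproj N ?p \<zeta>)"
      by (simp only:) (intro l2_sq_add_le proj_L2[OF on] L2_cmult coproj_L2 pL)
    also have "l2_sq (\<lambda>\<zeta>. (-1) * coproj N ?p \<zeta>) = l2_sq (coproj N ?p)" unfolding l2_sq_cmult by simp
    also have "l2_sq (proj N e (\<lambda>\<zeta>. \<phi> \<zeta> * ?s N k j \<zeta>)) \<le> l2_sq (\<lambda>\<zeta>. \<phi> \<zeta> * ?s N k j \<zeta>)"
      by (rule proj_sq_le[OF on fL])
    also have "\<dots> \<le> C\<^sup>2 * l2_sq (?s N k j)"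
      by (rule L2_mult_bounded(2)[OF Linf_measurable[OF L] C sL])
    finally show ?thesis by simp
  qed
  have sum_step: "(\<Sum>j<N. l2_sq (?s N (Suc k) j)) \<le> 2 * C\<^sup>2 * (\<Sum>j<N. l2_sq (?s N k j)) + 2 * defect N (\<lambda>\<zeta>. \<phi> \<zeta> ^ Suc k)" for N
  proof -
    have "(\<Sum>j<N. l2_sq (?s N (Suc k) j)) \<le> (\<Sum>j<N. 2 * C\<^sup>2 * l2_sq (?s N k j) + 2 * l2_sq (coproj N (\<lambda>\<zeta>. \<phi> \<zeta> ^ Suc k * e j \<zeta>)))"
      by (rule sum_mono) (rule step)
    then show ?thesis by (simp only: sum.distrib sum_distrib_left defect_def)
  qed
  have "(\<lambda>N. (\<Sum>j<N. l2_sq (?s N (Suc k) j)) / real N) \<longlonglongrightarrow> 0"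
  proof (rule Lim_null_comparison)
    show "eventually (\<lambda>N. norm ((\<Sum>j<N. l2_sq (?s N (Suc k) j)) / real N)
       \<le> 2 * C\<^sup>2 * ((\<Sum>j<N. l2_sq (?s N k j)) / real N) + 2 * (defect N (\<lambda>\<zeta>. \<phi> \<zeta> ^ Suc k) / real N)) sequentially"
    proof (intro always_eventually allI)
      fix N
      have "norm ((\<Sum>j<N. l2_sq (?s N (Suc k) j)) / real N) = (\<Sum>j<N. l2_sq (?s N (Suc k) j)) / real N"
        by (simp add: sum_nonneg)
      also have "\<dots> \<le> (2 * C\<^sup>2 * (\<Sum>j<N. l2_sq (?s N k j)) + 2 * defect N (\<lambda>\<zeta>. \<phi> \<zeta> ^ Suc k)) / real N"
        by (rule divide_right_mono[OF sum_step]) simp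
      finally show "norm ((\<Sum>j<N. l2_sq (?s N (Suc k) j)) / real N)
       \<le> 2 * C\<^sup>2 * ((\<Sum>j<N. l2_sq (?s N k j)) / real N) + 2 * (defect N (\<lambda>\<zeta>. \<phi> \<zeta> ^ Suc k) / real N)"
        by (simp add: add_divide_distrib)
    qed
    have "(\<lambda>N. 2 * C\<^sup>2 * ((\<Sum>j<N. l2_sq (?s N k j)) / real N) + 2 * (defect N (\<lambda>\<zeta>. \<phi> \<zeta> ^ Suc k) / real N)) \<longlonglongrightarrow> 2 * C\<^sup>2 * 0 + 2 * 0"
      using Suc negligible_power[OF \<phi>, of "Suc k"]
      by (intro tendsto_intros) (auto simp: negligible_defect_def)
    then show "(\<lambda>N. 2 * C\<^sup>2 * ((\<Sum>j<N. l2_sq (?s N k j)) / real N) + 2 * (defect N (\<lambda>\<zeta>. \<phi> \<zeta> ^ Suc k) / real N)) \<longlonglongrightarrow> 0"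
      by simp
  qed
  then show ?case .
qed

text \<open>
  Cauchy-Schwarz, first in each inner product with \<open>e j\<close> and then in the sum over \<open>j\<close>.
\<close>

lemma compress_power_trace_limit:
  assumes \<phi>: "negligible_defect \<phi>"
  shows "(\<lambda>N. ((\<Sum>j<N. l2_inner (((compress N \<phi>) ^^ k) (e j)) (e j)) - (\<Sum>j<N. l2_inner (\<lambda>\<zeta>. \<phi> \<zeta> ^ k * e j \<zeta>) (e j))) / of_nat N) \<longlonglongrightarrow> 0"
proof (rule Lim_null_comparison)
  have L: "\<phi> \<in> Linf" using \<phi> by (simp add: negligible_defect_def)
  let ?s = "\<lambda>N. power_error \<phi> N k"
  note sL = power_error_L2[OF L]
  show "eventually (\<lambda>N. norm (((\<Sum>j<N. l2_inner (((compress N \<phi>) ^^ k) (e j)) (e j)) - (\<Sum>j<N. l2_inner (\<lambda>\<zeta>. \<phi> \<zeta> ^ k * e j \<zeta>) (e j))) / of_nat N)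
     \<le> sqrt ((\<Sum>j<N. l2_sq (power_error \<phi> N k j)) / real N)) sequentially"
  proof (intro always_eventually allI)
    fix N
    have "(\<Sum>j<N. l2_inner (((compress N \<phi>) ^^ k) (e j)) (e j)) - (\<Sum>j<N. l2_inner (\<lambda>\<zeta>. \<phi> \<zeta> ^ k * e j \<zeta>) (e j))
       = (\<Sum>j<N. l2_inner (?s N j) (e j))"
      unfolding sum_subtractf[symmetric] power_error_def[abs_def]
      by (intro sum.cong refl l2_inner_diff_left[symmetric] compress_power_L2 L2_mult Linf_power L e_L2)
    moreover have "cmod (\<Sum>j<N. l2_inner (?s N j) (e j)) \<le> sqrt (real N * (\<Sum>j<N. l2_sq (?s N j)))"
    proof (rule real_le_rsqrt)
      have "(cmod (\<Sum>j<N. l2_inner (?s N j) (e j)))\<^sup>2 \<le> (\<Sum>j<N. cmod (l2_inner (?s N j) (e j)))\<^sup>2"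
        by (intro power_mono norm_sum) auto
      also have "\<dots> \<le> (\<Sum>j<N. (cmod (l2_inner (?s N j) (e j)))\<^sup>2) * card {..<N}"
        by (rule sum_squared_le_sum_of_squares)
      also have "\<dots> \<le> (\<Sum>j<N. l2_sq (?s N j)) * card {..<N}"
        using l2_cauchy_schwarz[OF sL e_L2] by (intro mult_right_mono sum_mono) (auto simp: e_sq)
      finally show "(cmod (\<Sum>j<N. l2_inner (?s N j) (e j)))\<^sup>2 \<le> real N * (\<Sum>j<N. l2_sq (?s N j))"
        by (simp add: mult.commute)
    qed
    moreover have "sqrt (real N * x) / real N = sqrt (x / real N)" for x
      by (cases "N = 0") (simp_all add: real_sqrt_mult real_sqrt_divide field_simps)
    ultimately show "norm (((\<Sum>j<N. l2_inner (((compress N \<phi>) ^^ k) (e j)) (e j)) - (\<Sum>j<N. l2_inner (\<lambda>\<zeta>. \<phi> \<zeta> ^ k * e j \<zeta>) (e j))) / of_nat N)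
     \<le> sqrt ((\<Sum>j<N. l2_sq (power_error \<phi> N k j)) / real N)"
      unfolding norm_divide norm_of_nat
      by (metis divide_right_mono of_nat_0_le_iff)
  qed
  show "(\<lambda>N. sqrt ((\<Sum>j<N. l2_sq (power_error \<phi> N k j)) / real N)) \<longlonglongrightarrow> 0"
    using tendsto_real_sqrt[OF compress_power_limit[OF \<phi>, of k]] by simp
qed

end

section \<open>Polynomial approximation on compact convex sets\<close>

definition poly_approximable :: "complex set \<Rightarrow> (complex \<Rightarrow> complex) \<Rightarrow> bool" where
  "poly_approximable K f \<longleftrightarrow> (\<forall>\<epsilon>>0. \<exists>p. \<forall>z\<in>K. cmod (f z - poly p z) < \<epsilon>)"

lemma poly_approximable_limit:
  assumes "\<And>\<epsilon>. \<epsilon> > 0 \<Longrightarrow> \<exists>g. poly_approximable K g \<and> (\<forall>z\<in>K. cmod (f z - g z) < \<epsilon>)"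
  shows "poly_approximable K f"
  unfolding poly_approximable_def
proof (intro allI impI)
  fix \<epsilon> :: real assume e: "\<epsilon> > 0"
  obtain g where g: "poly_approximable K g" "\<And>z. z \<in> K \<Longrightarrow> cmod (f z - g z) < \<epsilon> / 2"
    using assms[of "\<epsilon> / 2"] e by auto
  obtain p where p: "\<And>z. z \<in> K \<Longrightarrow> cmod (g z - poly p z) < \<epsilon> / 2"
    using g(1) e unfolding poly_approximable_def by (meson half_gt_zero)
  have "cmod (f z - poly p z) < \<epsilon>" if "z \<in> K" for z
    by (rule norm_diff_triangle_less[OF g(2)[OF that] p[OF that], simplified])
  then show "\<exists>p. \<forall>z\<in>K. cmod (f z - poly p z) < \<epsilon>" by blast
qed

lemma poly_approximable_add:
  assumes "poly_approximable K f" "poly_approximable K g"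
  shows "poly_approximable K (\<lambda>z. f z + g z)"
  unfolding poly_approximable_def
proof (intro allI impI)
  fix \<epsilon> :: real assume e: "\<epsilon> > 0"
  obtain p where p: "\<And>z. z \<in> K \<Longrightarrow> cmod (f z - poly p z) < \<epsilon> / 2"
    using assms(1) e unfolding poly_approximable_def by (meson half_gt_zero)
  obtain q where q: "\<And>z. z \<in> K \<Longrightarrow> cmod (g z - poly q z) < \<epsilon> / 2"
    using assms(2) e unfolding poly_approximable_def by (meson half_gt_zero)
  have "cmod (f z + g z - poly (p + q) z) < \<epsilon>" if "z \<in> K" for z
    using norm_triangle_lt[OF _ , of "f z - poly p z" "g z - poly q z" \<epsilon>] p[OF that] q[OF that]
    by (simp add: algebra_simps)
  then show "\<exists>p. \<forall>z\<in>K. cmod (f z + g z - poly p z) < \<epsilon>" by blast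
qed

lemma poly_approximable_cmult:
  assumes "poly_approximable K f"
  shows "poly_approximable K (\<lambda>z. c * f z)"
  unfolding poly_approximable_def
proof (intro allI impI)
  fix \<epsilon> :: real assume e: "\<epsilon> > 0"
  have pos: "cmod c + 1 > 0" by (simp add: add_nonneg_pos)
  then have "\<epsilon> / (cmod c + 1) > 0" using e by simp
  then obtain p where p: "\<And>z. z \<in> K \<Longrightarrow> cmod (f z - poly p z) < \<epsilon> / (cmod c + 1)"
    using assms unfolding poly_approximable_def by blast
  have "cmod (c * f z - poly (Polynomial.smult c p) z) < \<epsilon>" if "z \<in> K" for z
  proof -
    have "cmod (c * f z - poly (Polynomial.smult c p) z) = cmod c * cmod (f z - poly p z)"
      by (simp add: norm_mult flip: right_diff_distrib)
    also have "\<dots> \<le> cmod c * (\<epsilon> / (cmod c + 1))"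
      using p[OF that] by (intro mult_left_mono) auto
    also have "\<dots> < \<epsilon>" using e pos by (simp add: pos_divide_less_eq field_simps)
    finally show ?thesis .
  qed
  then show "\<exists>p. \<forall>z\<in>K. cmod (c * f z - poly p z) < \<epsilon>" by blast
qed

lemma poly_approximable_sum:
  "(\<And>i. i \<in> I \<Longrightarrow> poly_approximable K (f i)) \<Longrightarrow> poly_approximable K (\<lambda>z. \<Sum>i\<in>I. f i z)"
proof (induction I rule: infinite_finite_induct)
  case (insert x I)
  then show ?case by (simp add: poly_approximable_add)
qed (auto simp: poly_approximable_def intro!: exI[of _ 0])

text \<open>
  A line separates \<open>w\<close> from \<open>K\<close>. A disc with its centre \<open>c\<close> far out on the side of \<open>K\<close> is nearly a half-plane, so
  it can contain \<open>K\<close> but not \<open>w\<close>, and the geometric series of \<open>1 / (w - z)\<close> around \<open>c\<close> converges uniformly on \<open>K\<close>.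
\<close>

lemma poly_approximable_pole:
  assumes K: "compact K" "convex K" and w: "w \<notin> K"
  shows "poly_approximable K (\<lambda>z. 1 / (w - z))"
proof (cases "K = {}")
  case True then show ?thesis by (simp add: poly_approximable_def)
next
  case ne: False
  from separating_hyperplane_closed_point[OF K(2) compact_imp_closed[OF K(1)] w]
  obtain a b where a: "inner a w < b" and b: "\<forall>x\<in>K. inner a x > b" by blast
  define \<eta> where "\<eta> = b - inner a w"
  have \<eta>: "\<eta> > 0" using a by (simp add: \<eta>_def)
  have az: "inner a (z - w) \<ge> \<eta>" if "z \<in> K" for z
    using b that by (auto simp: inner_diff_right \<eta>_def intro: less_imp_le)
  obtain M where M: "\<And>z. z \<in> K \<Longrightarrow> cmod (z - w) \<le> M"
    using compact_imp_bounded[OF compact_translation[OF K(1), of "-w"]] by (auto simp: bounded_iff)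
  \<comment> \<open>large enough that the squared distance to c is on K at least 1 smaller than at w\<close>
  define R where "R = (M\<^sup>2 + 1) / (2 * \<eta>)"
  define c where "c = w + R *\<^sub>R a"
  define A where "A = (cmod (w - c))\<^sup>2"
  have A: "A = R\<^sup>2 * (norm a)\<^sup>2" by (simp add: A_def c_def power_mult_distrib)
  have R: "R \<ge> 0" using \<eta> by (simp add: R_def)
  have le: "(cmod (z - c))\<^sup>2 \<le> A - 1" if z: "z \<in> K" for z
  proof -
    have "(cmod (z - c))\<^sup>2 = (norm ((z - w) - R *\<^sub>R a))\<^sup>2" by (simp add: c_def algebra_simps)
    also have "\<dots> = (cmod (z - w))\<^sup>2 - 2 * (R * inner a (z - w)) + A"
      unfolding A power2_norm_eq_inner
      by (simp add: inner_diff_left inner_diff_right inner_commute power2_eq_square)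
    also have "(cmod (z - w))\<^sup>2 \<le> M\<^sup>2" using M[OF z] by (intro power_mono) auto
    also have "R * \<eta> \<le> R * inner a (z - w)" using az[OF z] R by (rule mult_left_mono)
    then have "M\<^sup>2 - 2 * (R * inner a (z - w)) + A \<le> M\<^sup>2 - 2 * (R * \<eta>) + A" by simp
    also have "2 * (R * \<eta>) = M\<^sup>2 + 1" using \<eta> by (simp add: R_def)
    finally show ?thesis by simp
  qed
  obtain z0 where "z0 \<in> K" using ne by blast
  from le[OF this] have A1: "A \<ge> 1" by (smt (verit) zero_le_power2)
  \<comment> \<open>the ratio of the geometric series\<close>
  define q where "q = sqrt ((A - 1) / A)"
  have q: "0 \<le> q" "q < 1" using A1 by (auto simp: q_def)
  have wc: "cmod (w - c) > 0" "w - c \<noteq> 0" using A1 by (auto simp: A_def)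
  have t: "cmod ((z - c) / (w - c)) \<le> q" if "z \<in> K" for z
  proof -
    have "(cmod ((z - c) / (w - c)))\<^sup>2 \<le> (A - 1) / A"
      using le[OF that] A1 by (simp add: norm_divide power_divide divide_right_mono flip: A_def)
    then show ?thesis unfolding q_def by (rule real_le_rsqrt)
  qed
  show ?thesis unfolding poly_approximable_def
  proof (intro allI impI)
    fix \<epsilon> :: real assume e: "\<epsilon> > 0"
    obtain m where m: "q ^ m < \<epsilon> * (cmod (w - c) * (1 - q))"
      using real_arch_pow_inv[of "\<epsilon> * (cmod (w - c) * (1 - q))" q] e wc q by auto
    define p where "p = (\<Sum>n<m. Polynomial.smult (1 / (w - c) ^ Suc n) ([:- c, 1:] ^ n))"
    have "cmod (1 / (w - z) - poly p z) < \<epsilon>" if z: "z \<in> K" for z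
    proof -
      define s where "s = (z - c) / (w - c)"
      have s: "cmod s \<le> q" unfolding s_def by (rule t[OF z])
      then have s1: "s \<noteq> 1" using q by auto
      have 1: "1 - q \<le> cmod (1 - s)" using norm_triangle_ineq2[of 1 s] s by simp
      have "(w - c) * s = z - c" using wc by (simp add: s_def)
      then have wz: "w - z = (w - c) * (1 - s)" by (simp add: right_diff_distrib)
      have "poly p z = (\<Sum>n<m. s ^ n) / (w - c)"
        by (simp add: p_def poly_sum s_def power_divide sum_divide_distrib mult.commute)
      also have "(\<Sum>n<m. s ^ n) = (1 - s ^ m) / (1 - s)" using s1 by (simp add: sum_gp_strict)
      finally have "1 / (w - z) - poly p z = s ^ m / ((w - c) * (1 - s))"
        unfolding wz using wc s1 by (simp add: divide_simps mult_ac)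
      then have "cmod (1 / (w - z) - poly p z) = cmod s ^ m / (cmod (w - c) * cmod (1 - s))"
        by (simp add: norm_divide norm_mult norm_power)
      also have "\<dots> \<le> q ^ m / (cmod (w - c) * (1 - q))"
        using s q wc 1 by (intro frac_le power_mono mult_left_mono mult_pos_pos) auto
      also have "\<dots> < \<epsilon>" using m wc q by (simp add: pos_divide_less_eq)
      finally show ?thesis .
    qed
    then show "\<exists>p. \<forall>z\<in>K. cmod (1 / (w - z) - poly p z) < \<epsilon>" by blast
  qed
qed

text \<open>
  Uniform continuity on the compact product bounds the error on every cell by \<open>\<epsilon> / 2\<close> times its length, for all \<open>z\<close>
  at once.
\<close>

lemma riemann_sum_uniform:
  fixes G :: "real \<Rightarrow> complex \<Rightarrow> complex"
  assumes G: "continuous_on ({0..1} \<times> K) (\<lambda>x. G (fst x) (snd x))" and K: "compact K" and e: "\<epsilon> > 0"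
  shows "\<exists>n>0. \<forall>z\<in>K. cmod (integral {0..1} (\<lambda>t. G t z) - (\<Sum>i<n. G (real i / real n) z / of_nat n)) < \<epsilon>"
proof -
  have "uniformly_continuous_on ({0..1} \<times> K) (\<lambda>x. G (fst x) (snd x))"
    by (rule compact_uniformly_continuous[OF G]) (intro compact_Times K compact_Icc)
  then obtain \<delta> where \<delta>: "\<delta> > 0" and unif: "\<And>x y. x \<in> {0..1} \<times> K \<Longrightarrow> y \<in> {0..1} \<times> K \<Longrightarrow> dist y x < \<delta> \<Longrightarrow>
      dist (G (fst y) (snd y)) (G (fst x) (snd x)) < \<epsilon> / 2"
    using e unfolding uniformly_continuous_on_def by (meson half_gt_zero)
  obtain n :: nat where n: "n > 0" "1 / real n < \<delta>"
    using real_arch_inverse[of \<delta>] \<delta> by (auto simp: inverse_eq_divide)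
  have "cmod (integral {0..1} (\<lambda>t. G t z) - (\<Sum>i<n. G (real i / real n) z / of_nat n)) < \<epsilon>" if z: "z \<in> K" for z
  proof -
    let ?g = "\<lambda>t. G t z"
    have cont: "continuous_on {0..1} ?g"
    proof -
      have "continuous_on {0..1} (\<lambda>t::real. (t, z))" by (intro continuous_intros)
      from continuous_on_compose2[OF G this] z show ?thesis by auto
    qed
    have claim: "k \<le> n \<Longrightarrow> cmod (integral {0..real k / real n} ?g - (\<Sum>i<k. ?g (real i / real n) / of_nat n)) \<le> \<epsilon> / 2 * (real k / real n)" for k
    proof (induction k)
      case (Suc k)
      let ?a = "real k / real n" and ?b = "real (Suc k) / real n"
      have ab: "0 \<le> ?a" "?a \<le> ?b" "?b \<le> 1" "?b - ?a = 1 / real n"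
        using Suc.prems n by (auto simp: divide_simps)
      have sub: "{0..?b} \<subseteq> {0..1}" "{?a..?b} \<subseteq> {0..1}"
        using ab(3) order_trans[OF ab(1)] by auto
      note c = continuous_on_subset[OF cont sub(1)] continuous_on_subset[OF cont sub(2)]
      have i1: "integral {0..?a} ?g + integral {?a..?b} ?g = integral {0..?b} ?g"
        by (rule Henstock_Kurzweil_Integration.integral_combine) (use ab c in \<open>auto intro!: integrable_continuous_real\<close>)
      have i2: "integral {?a..?b} (\<lambda>t. ?g t - ?g ?a) = integral {?a..?b} ?g - ?g ?a / of_nat n"
      proof -
        have "integral {?a..?b} (\<lambda>t. ?g t - ?g ?a) = integral {?a..?b} ?g - integral {?a..?b} (\<lambda>t. ?g ?a)"
          using c by (intro Henstock_Kurzweil_Integration.integral_diff integrable_continuous_real) auto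
        also have "integral {?a..?b} (\<lambda>t. ?g ?a) = ?g ?a / of_nat n"
          using ab by (simp add: scaleR_conv_of_real)
        finally show ?thesis .
      qed
      have i3: "norm (integral {?a..?b} (\<lambda>t. ?g t - ?g ?a)) \<le> \<epsilon> / 2 * (?b - ?a)"
      proof (rule integral_bound[OF ab(2)])
        show "continuous_on {?a..?b} (\<lambda>t. ?g t - ?g ?a)" by (intro continuous_intros c)
        fix t assume t: "t \<in> {?a..?b}"
        have "?a \<in> {?a..?b}" using ab(2) by (simp only: atLeastAtMost_iff order_refl)
        with t have t01: "t \<in> {0..1}" "?a \<in> {0..1}" using sub(2) by blast+
        have "dist (t, z) (?a, z) < \<delta>" using t ab n by (auto simp: dist_Pair_Pair dist_real_def)
        then have "dist (G t z) (G ?a z) < \<epsilon> / 2" using unif[of "(?a, z)" "(t, z)"] t01 z by simp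
        then show "norm (?g t - ?g ?a) \<le> \<epsilon> / 2" by (simp add: dist_norm)
      qed
      have i4: "cmod (integral {0..?a} ?g - (\<Sum>i<k. ?g (real i / real n) / of_nat n)) \<le> \<epsilon> / 2 * ?a"
        using Suc by simp
      have eq1: "integral {0..?b} ?g - (\<Sum>i<Suc k. ?g (real i / real n) / of_nat n)
          = (integral {0..?a} ?g - (\<Sum>i<k. ?g (real i / real n) / of_nat n)) + integral {?a..?b} (\<lambda>t. ?g t - ?g ?a)"
        unfolding i1[symmetric] i2 sum.lessThan_Suc by simp
      have "\<epsilon> / 2 * ?a + \<epsilon> / 2 * (?b - ?a) = \<epsilon> / 2 * ?b" by (simp only: right_diff_distrib)
      with norm_triangle_mono[OF i4 i3] show ?case by (simp only: eq1)
    qed simp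
    from claim[of n] n have "cmod (integral {0..1} ?g - (\<Sum>i<n. ?g (real i / real n) / of_nat n)) \<le> \<epsilon> / 2" by simp
    with e show ?thesis by linarith
  qed
  with n show ?thesis by blast
qed

text \<open>
  The closed \<open>r / 2\<close>-neighbourhood of \<open>K\<close> is a convex body, and its frontier is homeomorphic to the circle. The resulting
  simple loop winds around \<open>K\<close> once, in one direction or the other, so \<open>c\<close> is \<open>1\<close> or \<open>-1\<close>. A polynomial path closer to it than
  \<open>r / 2\<close> is smooth, misses \<open>K\<close>, has the same winding numbers there, and remains in the convex \<open>r\<close>-neighbourhood \<open>S\<close>,
  in which Cauchy's formula is available.
\<close>

lemma loop_around_compact_convex:
  assumes K: "compact K" "convex K" "K \<noteq> {}" and U: "open U" "K \<subseteq> U"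
  obtains p S c where "polynomial_function p" "pathfinish p = pathstart p" "path_image p \<subseteq> S - K"
    "convex S" "K \<subseteq> interior S" "S \<subseteq> U" "c \<noteq> 0" "\<And>z. z \<in> K \<Longrightarrow> winding_number p z = c"
proof -
  obtain r where r: "r > 0" "{x. infdist x K \<le> r} \<subseteq> U"
    using compact_in_open_separated[OF K(3,1) U] by blast
  \<comment> \<open>the closed \<open>\<delta>\<close>-neighbourhood as a Minkowski sum, which is visibly compact and convex\<close>
  define nb where "nb \<delta> = (\<Union>x\<in>K. \<Union>y\<in>cball 0 \<delta>. {x + y})" for \<delta> :: real
  have nbI: "y \<in> nb \<delta>" if "x \<in> K" "dist x y \<le> \<delta>" for x y \<delta>
  proof -
    have "y = x + (y - x)" "y - x \<in> cball 0 \<delta>" using that by (auto simp: dist_norm norm_minus_commute)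
    then show ?thesis unfolding nb_def using that(1) by blast
  qed
  have nbE: "\<exists>x\<in>K. dist x y \<le> \<delta>" if "y \<in> nb \<delta>" for y \<delta>
  proof -
    from that obtain x u where "x \<in> K" "cmod u \<le> \<delta>" "y = x + u" by (auto simp: nb_def)
    then show ?thesis by (intro bexI[of _ x]) (simp_all add: dist_norm)
  qed
  have nb: "convex (nb \<delta>)" "compact (nb \<delta>)" for \<delta>
    unfolding nb_def using K by (auto intro!: convex_sums compact_sums')
  have ball: "ball x \<delta> \<subseteq> interior (nb \<delta>)" if "x \<in> K" for x \<delta>
    by (rule interior_maximal) (use that in \<open>auto intro!: nbI[OF that]\<close>)
  define \<delta> where "\<delta> = r / 2"
  have \<delta>: "\<delta> > 0" using r by (simp add: \<delta>_def)
  define D where "D = nb \<delta>"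
  have D: "convex D" "compact D" unfolding D_def by (rule nb)+
  have KD: "K \<subseteq> interior D" unfolding D_def using ball[of _ \<delta>] \<delta> centre_in_ball by blast
  with K(3) have Dne: "interior D \<noteq> {}" by blast
  have aff: "aff_dim D = aff_dim (cball (0::complex) 1)"
    using Dne by (simp add: aff_dim_nonempty_interior)
  have "rel_frontier (cball (0::complex) 1) homeomorphic rel_frontier D"
    by (rule homeomorphic_rel_frontiers_convex_bounded_sets)
       (use D aff in \<open>auto intro: compact_imp_bounded\<close>)
  then have "sphere (0::complex) 1 homeomorphic frontier D"
    using Dne by (simp add: rel_frontier_nonempty_interior)
  then obtain h h' where h: "homeomorphism (sphere (0::complex) 1) (frontier D) h h'"
    by (auto simp: homeomorphic_def)
  define \<gamma> where "\<gamma> = h \<circ> circlepath 0 1"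
  have im: "path_image \<gamma> = frontier D"
    using h by (simp add: \<gamma>_def path_image_compose homeomorphism_image1)
  have "inj_on h (sphere 0 1)" using h by (auto simp: homeomorphism_def intro: inj_on_inverseI)
  then have sp: "simple_path \<gamma>"
    unfolding \<gamma>_def using h
    by (intro simple_path_continuous_image) (auto simp: simple_path_circlepath homeomorphism_cont1)
  have loop: "pathfinish \<gamma> = pathstart \<gamma>" by (simp add: \<gamma>_def pathfinish_compose pathstart_compose)
  have "inside (path_image \<gamma>) = interior D"
    unfolding im by (rule inside_frontier_eq_interior) (use D in \<open>auto intro: compact_imp_bounded\<close>)
  then obtain c where c: "c \<noteq> 0" "\<And>z. z \<in> interior D \<Longrightarrow> winding_number \<gamma> z = c"
    using simple_closed_path_winding_number_inside[OF sp, of thesis] that[of 1] that[of "-1"] by auto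
  have far: "dist x (\<gamma> t) \<ge> \<delta>" if "x \<in> K" "t \<in> {0..1}" for x t
  proof (rule ccontr)
    assume "\<not> dist x (\<gamma> t) \<ge> \<delta>"
    then have "\<gamma> t \<in> interior D" using ball[OF that(1), of \<delta>] by (auto simp: D_def)
    moreover have "\<gamma> t \<in> frontier D" using im that(2) by (auto simp: path_image_def)
    ultimately show False by (simp add: frontier_def)
  qed
  obtain p where p: "polynomial_function p" "pathstart p = pathstart \<gamma>" "pathfinish p = pathfinish \<gamma>"
    "\<And>t. t \<in> {0..1} \<Longrightarrow> norm (p t - \<gamma> t) < \<delta>"
    using path_approx_polynomial_function[OF simple_path_imp_path[OF sp] \<delta>] by blast
  show ?thesis
  proof (rule that[of p "nb r" c])
    show "pathfinish p = pathstart p" using p loop by simp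
    show "path_image p \<subseteq> nb r - K"
    proof
      fix y assume "y \<in> path_image p"
      then obtain t where t: "t \<in> {0..1}" "y = p t" by (auto simp: path_image_def)
      have d: "dist (\<gamma> t) y < \<delta>" using p(4)[OF t(1)] t(2) by (simp add: dist_norm norm_minus_commute)
      have "\<gamma> t \<in> frontier D" using im t(1) by (auto simp: path_image_def)
      then have "\<gamma> t \<in> D" using frontier_subset_closed[OF compact_imp_closed[OF D(2)]] by auto
      then obtain x where x: "x \<in> K" "dist x (\<gamma> t) \<le> \<delta>" using nbE unfolding D_def by blast
      have "dist x y \<le> r" using dist_triangle[of x y "\<gamma> t"] x d by (simp add: \<delta>_def)
      then have "y \<in> nb r" by (rule nbI[OF x(1)])
      moreover have "y \<notin> K" using far[of y t] t d by (auto simp: dist_commute)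
      ultimately show "y \<in> nb r - K" by blast
    qed
    show "K \<subseteq> interior (nb r)" using ball[of _ r] r(1) centre_in_ball by blast
    show "nb r \<subseteq> U"
    proof
      fix y assume "y \<in> nb r"
      then obtain x where "x \<in> K" "dist x y \<le> r" using nbE by blast
      then have "infdist y K \<le> r" using infdist_le[of x K y] by (simp add: dist_commute)
      then show "y \<in> U" using r(2) by blast
    qed
    fix z assume z: "z \<in> K"
    have "winding_number p z = winding_number \<gamma> z"
    proof (rule winding_number_nearby_loops_eq)
      show "path \<gamma>" using sp by (rule simple_path_imp_path)
      show "path p" using valid_path_polynomial_function[OF p(1)] by (rule valid_path_imp_path)
      fix t :: real assume "t \<in> {0..1}"
      then show "norm (p t - \<gamma> t) < norm (\<gamma> t - z)"
        using p(4)[of t] far[OF z, of t] by (simp add: dist_norm norm_minus_commute)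
    qed (use p loop in auto)
    also have "\<dots> = c"
      by (rule c(2)) (use KD z in blast)
    finally show "winding_number p z = c" .
  qed (use p c nb in auto)
qed

text \<open>
  Cauchy's formula represents \<open>f\<close> on \<open>K\<close> as an integral along the loop, and its Riemann sums are combinations of functions
  \<open>1 / (w - z)\<close> with \<open>w\<close> on the loop, hence outside \<open>K\<close>.
\<close>

theorem runge_compact_convex:
  assumes K: "compact K" "convex K" "K \<noteq> {}" and U: "open U" "K \<subseteq> U" and f: "f holomorphic_on U"
  shows "poly_approximable K f"
proof -
  obtain p S c where p: "polynomial_function p" "pathfinish p = pathstart p" "path_image p \<subseteq> S - K"
    and S: "convex S" "K \<subseteq> interior S" "S \<subseteq> U"
    and c: "c \<noteq> 0" "\<And>z. z \<in> K \<Longrightarrow> winding_number p z = c"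
    using loop_around_compact_convex[OF K U] by metis
  obtain p' where p': "polynomial_function p'" "\<And>x. (p has_vector_derivative (p' x)) (at x)"
    using has_vector_derivative_polynomial_function[OF p(1)] by blast
  define G where "G t z = f (p t) * p' t / (2 * pi * \<i> * c) * (1 / (p t - z))" for t z
  have pt: "p t \<in> S" "p t \<notin> K" if "t \<in> {0..1}" for t
  proof -
    have "p t \<in> path_image p" using that by (auto simp: path_image_def)
    with p(3) show "p t \<in> S" "p t \<notin> K" by auto
  qed
  have fz: "f z = integral {0..1} (\<lambda>t. G t z)" if z: "z \<in> K" for z
  proof -
    have "((\<lambda>w. f w / (w - z)) has_contour_integral (2*pi * \<i> * winding_number p z * f z)) p"
      by (rule Cauchy_integral_formula_convex_simple[OF S(1)])
         (use f S z p valid_path_polynomial_function[OF p(1)] in \<open>auto intro: holomorphic_on_subset\<close>)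
    then have "2 * pi * \<i> * c * f z = contour_integral p (\<lambda>w. f w / (w - z))"
      using c(2)[OF z] by (simp add: contour_integral_unique)
    also have "\<dots> = integral {0..1} (\<lambda>t. f (p t) / (p t - z) * p' t)"
      unfolding contour_integral_integral by (simp add: vector_derivative_at[OF p'(2)])
    finally have eq: "2 * pi * \<i> * c * f z = integral {0..1} (\<lambda>t. f (p t) / (p t - z) * p' t)" .
    have "f z = 2 * pi * \<i> * c * f z / (2 * pi * \<i> * c)" using c(1) by simp
    also have "\<dots> = integral {0..1} (\<lambda>t. f (p t) / (p t - z) * p' t) / (2 * pi * \<i> * c)"
      unfolding eq ..
    also have "\<dots> = integral {0..1} (\<lambda>t. f (p t) / (p t - z) * p' t / (2 * pi * \<i> * c))"
      by (rule integral_divide[symmetric])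
    also have "\<dots> = integral {0..1} (\<lambda>t. G t z)" by (simp add: G_def mult_ac)
    finally show ?thesis .
  qed
  have "continuous_on ({0..1} \<times> K) (\<lambda>x. G (fst x) (snd x))"
  proof -
    have cp: "continuous_on ({0..1} \<times> K) (\<lambda>x. p (fst x))" "continuous_on ({0..1} \<times> K) (\<lambda>x. p' (fst x))"
      by (rule continuous_on_compose2[OF continuous_on_polymonial_function[OF p(1)] continuous_on_fst[OF continuous_on_id] subset_UNIV],
          rule continuous_on_compose2[OF continuous_on_polymonial_function[OF p'(1)] continuous_on_fst[OF continuous_on_id] subset_UNIV])
    have cf: "continuous_on ({0..1} \<times> K) (\<lambda>x. f (p (fst x)))"
      by (rule continuous_on_compose2[OF holomorphic_on_imp_continuous_on[OF f] cp(1)])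
         (use pt S(3) in auto)
    show ?thesis unfolding G_def
      by (intro continuous_intros cp cf) (use pt c in auto)
  qed
  note riemann = riemann_sum_uniform[OF this K(1)]
  show ?thesis
  proof (rule poly_approximable_limit)
    fix \<epsilon> :: real assume "\<epsilon> > 0"
    from riemann[OF this] obtain n where n: "n > 0"
      "\<And>z. z \<in> K \<Longrightarrow> cmod (f z - (\<Sum>i<n. G (real i / real n) z / of_nat n)) < \<epsilon>"
      using fz by auto
    have "poly_approximable K (\<lambda>z. G (real i / real n) z / of_nat n)" if "i < n" for i
    proof -
      let ?t = "real i / real n"
      have "p ?t \<notin> K" using that by (intro pt) (auto simp: divide_simps)
      from poly_approximable_cmult[OF poly_approximable_pole[OF K(1,2) this], of "f (p ?t) * p' ?t / (2 * pi * \<i> * c) / of_nat n"]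
      show ?thesis by (simp add: G_def mult_ac)
    qed
    then have "poly_approximable K (\<lambda>z. \<Sum>i<n. G (real i / real n) z / of_nat n)"
      by (intro poly_approximable_sum) auto
    with n(2) show "\<exists>g. poly_approximable K g \<and> (\<forall>z\<in>K. cmod (f z - g z) < \<epsilon>)" by blast
  qed
qed

section \<open>Convergence of the normalized traces\<close>

context disc_sequence
begin

sublocale tms: orthonormal_sequence tm
  by unfold_locales (rule orthonormal_tm)

text \<open>
  Only \<open>tm 0\<close> is moved out of the model space by the backward shift, and it contributes at most its norm.
\<close>

lemma negligible_cnj:
  assumes 0: "\<Lambda> 0 = 0"
  shows "tms.negligible_defect cnj"
proof (rule tms.negligible_defectI[where b = "\<lambda>_. 1"])
  show "cnj \<in> Linf" by (rule Linf_continuous) (intro continuous_intros)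
  show "(\<lambda>N. 1 / real N) \<longlonglongrightarrow> 0" by (rule lim_1_over_n)
  fix N
  have "tms.defect N cnj = (\<Sum>j<N. l2_sq (tms.coproj N (\<lambda>\<zeta>. cnj \<zeta> * tm j \<zeta>)))"
    by (simp add: tms.defect_def)
  also have "\<dots> \<le> (\<Sum>j<N. if j = 0 then 1 else 0)"
  proof (rule sum_mono)
    fix j assume j: "j \<in> {..<N}"
    have L: "(\<lambda>\<zeta>. cnj \<zeta> * tm j \<zeta>) \<in> L2"
      by (intro L2_mult tm_L2 Linf_continuous continuous_intros)
    show "l2_sq (tms.coproj N (\<lambda>\<zeta>. cnj \<zeta> * tm j \<zeta>)) \<le> (if j = 0 then 1 else 0)"
    proof (cases "j = 0")
      case True
      have "l2_sq (tms.coproj N (\<lambda>\<zeta>. cnj \<zeta> * tm j \<zeta>)) \<le> l2_sq (\<lambda>\<zeta>. cnj \<zeta> * tm j \<zeta>)" by (rule tms.coproj_le[OF L])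
      also have "\<dots> = l2_sq (tm j)" unfolding l2_sq_def by (rule integral_circ_cong) (simp add: norm_mult)
      finally show ?thesis using True tms.e_sq[of j] by simp
    next
      case False
      then show ?thesis using backward_shift_tm[OF 0, of j N] j by (simp add: tms.coproj_def[abs_def])
    qed
  qed
  also have "\<dots> \<le> 1" by (cases "N = 0") auto
  finally show "tms.defect N cnj \<le> 1" .
qed

lemma negligible_ident:
  assumes "\<Lambda> 0 = 0"
  shows "tms.negligible_defect (\<lambda>\<zeta>. \<zeta>)"
  using negligible_cnj[OF assms] tms.defect_cnj_unimodular[of "\<lambda>\<zeta>. \<zeta>"] Linf_continuous[of "\<lambda>\<zeta>. \<zeta>"]
  by (simp add: tms.negligible_defect_def continuous_on_id)

lemma l2_sq_mult_tm:
  "l2_sq (\<lambda>\<zeta>. h \<zeta> * tm j \<zeta>) = (LINT \<zeta>|circ. (cmod (tm j \<zeta>))\<^sup>2 *\<^sub>R (cmod (h \<zeta>))\<^sup>2)"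
  by (simp add: l2_sq_def norm_mult power_mult_distrib mult.commute)

text \<open>
  This turns the norms that define \<^const>\<open>Lambda_norm\<close> into the sums used in \<open>negligible_approx\<close>.
\<close>

lemma integral_nu_norm_sq:
  assumes h: "h \<in> Linf"
  shows "(LINT \<zeta>|nu \<Lambda> N. (cmod (h \<zeta>))\<^sup>2) = (\<Sum>j<N. l2_sq (\<lambda>\<zeta>. h \<zeta> * tm j \<zeta>)) / real N"
proof -
  obtain C where C: "AE \<zeta> in circ. cmod (h \<zeta>) \<le> C" using h by (auto simp: Linf_def)
  have "AE \<zeta> in circ. norm ((cmod (h \<zeta>))\<^sup>2) \<le> C\<^sup>2"
    using C by eventually_elim (simp add: power_mono)
  moreover have "(\<lambda>\<zeta>. (cmod (h \<zeta>))\<^sup>2) \<in> borel_measurable circ" using Linf_measurable[OF h] by measurable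
  ultimately show ?thesis by (subst integral_nu) (simp_all add: l2_sq_mult_tm)
qed

lemma negligible_X_space:
  assumes 0: "\<Lambda> 0 = 0" and \<phi>: "\<phi> \<in> Linf \<inter> X_space \<Lambda>"
  shows "tms.negligible_defect \<phi>"
proof (rule tms.negligible_approx)
  show L: "\<phi> \<in> Linf" using \<phi> by simp
  fix \<epsilon> :: real assume e: "\<epsilon> > 0"
  then obtain g where g: "continuous_on (sphere 0 1) g" and n: "Lambda_norm \<Lambda> (\<lambda>\<zeta>. \<phi> \<zeta> - g \<zeta>) < ereal (sqrt \<epsilon>)"
    using \<phi> unfolding X_space_def by (auto dest!: spec[of _ "sqrt \<epsilon>"])
  have dL: "(\<lambda>\<zeta>. \<phi> \<zeta> - g \<zeta>) \<in> Linf" using L Linf_continuous[OF g] by (rule Linf_diff)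
  have "(\<Sum>j<N. l2_sq (\<lambda>\<zeta>. (\<phi> \<zeta> - g \<zeta>) * tm j \<zeta>)) \<le> \<epsilon> * real N" if N: "N \<ge> 1" for N
  proof -
    have "ereal (l2_norm (nu \<Lambda> N) (\<lambda>\<zeta>. \<phi> \<zeta> - g \<zeta>)) \<le> Lambda_norm \<Lambda> (\<lambda>\<zeta>. \<phi> \<zeta> - g \<zeta>)"
      unfolding Lambda_norm_def by (rule SUP_upper) (use N in simp)
    then have "ereal (l2_norm (nu \<Lambda> N) (\<lambda>\<zeta>. \<phi> \<zeta> - g \<zeta>)) < ereal (sqrt \<epsilon>)" using n by (rule order_le_less_trans)
    then have "(LINT \<zeta>|nu \<Lambda> N. (cmod (\<phi> \<zeta> - g \<zeta>))\<^sup>2) < \<epsilon>" by (simp add: l2_norm_def)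
    then show ?thesis unfolding integral_nu_norm_sq[OF dL] using N by (simp add: pos_divide_less_eq)
  qed
  with tms.negligible_continuous[OF negligible_ident[OF 0] negligible_cnj[OF 0] g]
  show "\<exists>g. tms.negligible_defect g \<and> (\<forall>N\<ge>1. (\<Sum>j<N. l2_sq (\<lambda>\<zeta>. (\<phi> \<zeta> - g \<zeta>) * tm j \<zeta>)) \<le> \<epsilon> * real N)"
    by blast
qed

lemma tm_density_sum: "(\<Sum>j<N. LINT \<zeta>|circ. (cmod (tm j \<zeta>))\<^sup>2) = real N"
  using tms.e_sq by (simp add: l2_sq_def)

lemma integral_nu_bound:
  fixes g :: "complex \<Rightarrow> complex"
  assumes g: "g \<in> borel_measurable circ" and C: "AE \<zeta> in circ. norm (g \<zeta>) \<le> C" and N: "N \<ge> 1"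
  shows "norm (LINT \<zeta>|nu \<Lambda> N. g \<zeta>) \<le> C"
proof -
  have "norm (LINT \<zeta>|circ. (cmod (tm j \<zeta>))\<^sup>2 *\<^sub>R g \<zeta>) \<le> C * (LINT \<zeta>|circ. (cmod (tm j \<zeta>))\<^sup>2)" for j
  proof -
    have "norm (LINT \<zeta>|circ. (cmod (tm j \<zeta>))\<^sup>2 *\<^sub>R g \<zeta>) \<le> (LINT \<zeta>|circ. norm ((cmod (tm j \<zeta>))\<^sup>2 *\<^sub>R g \<zeta>))"
      by (rule integral_norm_bound)
    also have "\<dots> \<le> (LINT \<zeta>|circ. C * (cmod (tm j \<zeta>))\<^sup>2)"
    proof (rule integral_mono_AE)
      show "integrable circ (\<lambda>\<zeta>. norm ((cmod (tm j \<zeta>))\<^sup>2 *\<^sub>R g \<zeta>))"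
        by (rule integrable_norm[OF integrable_tm_weight[OF g C]])
      show "integrable circ (\<lambda>\<zeta>. C * (cmod (tm j \<zeta>))\<^sup>2)" using L2_integrable[OF tm_L2] by simp
      show "AE \<zeta> in circ. norm ((cmod (tm j \<zeta>))\<^sup>2 *\<^sub>R g \<zeta>) \<le> C * (cmod (tm j \<zeta>))\<^sup>2"
        using C by eventually_elim (auto simp: mult.commute intro!: mult_right_mono)
    qed
    finally show ?thesis by simp
  qed
  then have "norm (\<Sum>j<N. LINT \<zeta>|circ. (cmod (tm j \<zeta>))\<^sup>2 *\<^sub>R g \<zeta>) \<le> (\<Sum>j<N. C * (LINT \<zeta>|circ. (cmod (tm j \<zeta>))\<^sup>2))"
    by (rule sum_norm_le)
  also have "\<dots> = C * real N" unfolding sum_distrib_left[symmetric] tm_density_sum ..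
  finally show ?thesis unfolding integral_nu[OF g C] using N by (simp add: pos_divide_le_eq)
qed

lemma integral_nu_add:
  fixes g h :: "complex \<Rightarrow> complex"
  assumes g: "g \<in> Linf" and h: "h \<in> Linf"
  shows "(LINT \<zeta>|nu \<Lambda> N. g \<zeta> + h \<zeta>) = (LINT \<zeta>|nu \<Lambda> N. g \<zeta>) + (LINT \<zeta>|nu \<Lambda> N. h \<zeta>)"
proof -
  obtain C D E where C: "AE \<zeta> in circ. norm (g \<zeta>) \<le> C" and D: "AE \<zeta> in circ. norm (h \<zeta>) \<le> D"
    and E: "AE \<zeta> in circ. norm (g \<zeta> + h \<zeta>) \<le> E"
    using g h Linf_add[OF g h] by (auto simp: Linf_def)
  note m = Linf_measurable[OF g] Linf_measurable[OF h] Linf_measurable[OF Linf_add[OF g h]]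
  show ?thesis
    unfolding integral_nu[OF m(1) C] integral_nu[OF m(2) D] integral_nu[OF m(3) E]
    by (simp add: scaleR_add_right integrable_tm_weight[OF m(1) C] integrable_tm_weight[OF m(2) D]
        sum.distrib del: scaleR_scaleR flip: scaleR_sum_right)
qed

text \<open>
  An exact trace formula: the integral is the normalized trace of the compression with symbol \<open>h\<close>, with no error term.
\<close>

lemma integral_nu_symbol:
  assumes h: "h \<in> Linf"
  shows "(LINT \<zeta>|nu \<Lambda> N. h \<zeta>) = (\<Sum>j<N. l2_inner (\<lambda>\<zeta>. h \<zeta> * tm j \<zeta>) (tm j)) / of_nat N"
proof -
  obtain C where C: "AE \<zeta> in circ. norm (h \<zeta>) \<le> C" using h by (auto simp: Linf_def)
  have "l2_inner (\<lambda>\<zeta>. h \<zeta> * tm j \<zeta>) (tm j) = (LINT \<zeta>|circ. (cmod (tm j \<zeta>))\<^sup>2 *\<^sub>R h \<zeta>)" for j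
    unfolding l2_inner_def
    by (intro Bochner_Integration.integral_cong refl)
       (simp add: scaleR_conv_of_real complex_norm_square mult_ac del: of_real_power)
  then show ?thesis
    unfolding integral_nu[OF Linf_measurable[OF h] C] by (simp add: scaleR_conv_of_real)
qed

lemma compression_model_space:
  assumes "\<phi> \<in> Linf"
  shows "compression (K N) \<phi> N"
proof unfold_locales
  show "\<exists>e. orthonormal_basis (K N) N e" using orthonormal_basis_tm by blast
qed (use model_space_L2 model_space_add model_space_cmult model_space_zero assms in auto)

text \<open>
  Everything that has to be known about the operators, expressed by \<open>N\<close> numbers: the traces of both calculi, a location
  that does not depend on \<open>N\<close>, and the power sums. The power sums are written in the Takenaka-Malmquist basis, in which
  the defects are computed, although the numbers come from a Schur basis.
\<close>

definition trace_eigenvalues :: "(complex \<Rightarrow> complex) \<Rightarrow> nat \<Rightarrow> (nat \<Rightarrow> complex) \<Rightarrow> bool" where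
  "trace_eigenvalues \<phi> N \<mu> \<longleftrightarrow>
     (\<forall>U F. open U \<longrightarrow> F holomorphic_on U \<longrightarrow> (\<forall>i<N. \<mu> i \<in> U) \<longrightarrow>
        op_trace (K N) (hol_calculus (K N) (tto (B N) \<phi>) F) = (\<Sum>i<N. F (\<mu> i)))
     \<and> ((AE \<zeta> in circ. \<phi> \<zeta> \<in> \<real>) \<longrightarrow>
         (\<forall>F. op_trace (K N) (cont_calculus (K N) (tto (B N) \<phi>) F) = (\<Sum>i<N. F (Re (\<mu> i)))))
     \<and> (\<forall>C. closed C \<longrightarrow> convex C \<longrightarrow> (AE \<zeta> in circ. \<phi> \<zeta> \<in> C) \<longrightarrow> (\<forall>i<N. \<mu> i \<in> C))
     \<and> (\<forall>k. (\<Sum>i<N. \<mu> i ^ k) = (\<Sum>j<N. l2_inner ((tms.compress N \<phi> ^^ k) (tm j)) (tm j)))"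

lemma trace_eigenvalues_exist:
  assumes \<phi>: "\<phi> \<in> Linf"
  shows "\<exists>\<mu>. trace_eigenvalues \<phi> N \<mu>"
proof -
  interpret c: compression "K N" \<phi> N by (rule compression_model_space[OF \<phi>])
  obtain f where f: "orthonormal_basis (K N) N f" "\<And>i j. i < N \<Longrightarrow> j < i \<Longrightarrow> c.mat_of f i j = 0"
    using c.schur_basis by blast
  interpret t: triangular_compression "K N" \<phi> N f by unfold_locales (use f in auto)
  have T: "tto (B N) \<phi> = c.T" by (rule ext) (simp add: tto_def c.T_def)
  define \<mu> where "\<mu> i = t.\<mu> i" for i
  \<comment> \<open>the truncated Toeplitz operator involves a choice of representatives, \<open>compress\<close> does not\<close>
  have pow: "AE \<zeta> in circ. (c.T ^^ k) (tm j) \<zeta> = (tms.compress N \<phi> ^^ k) (tm j) \<zeta>" if j: "j < N" for k j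
  proof (induction k)
    case (Suc k)
    let ?g = "(c.T ^^ k) (tm j)" and ?g' = "(tms.compress N \<phi> ^^ k) (tm j)"
    have g: "?g \<in> K N" by (rule t.T_power_V[OF tm_in_model_space[OF j]])
    have "l2_inner (c.T ?g) (tm i) = l2_inner (\<lambda>\<zeta>. \<phi> \<zeta> * ?g' \<zeta>) (tm i)" if i: "i < N" for i
    proof -
      have "l2_inner (c.T ?g) (tm i) = l2_inner (\<lambda>\<zeta>. \<phi> \<zeta> * ?g \<zeta>) (tm i)"
        by (rule c.T_inner[OF g tm_in_model_space[OF i]])
      also have "\<dots> = l2_inner (\<lambda>\<zeta>. \<phi> \<zeta> * ?g' \<zeta>) (tm i)"
        by (rule l2_inner_cong_AE) (use Suc c.symbol_mult_L2[OF g] tm_L2 in \<open>auto elim!: eventually_mono\<close>)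
      finally show ?thesis .
    qed
    then have e: "(\<Sum>i<N. l2_inner (c.T ?g) (tm i) * tm i \<zeta>) = tms.compress N \<phi> ?g' \<zeta>" for \<zeta>
      unfolding tms.compress_def[of N \<phi> ?g'] proj_def by (intro sum.cong refl) simp
    show ?case
      using model_space_expansion[OF c.T_in_V[OF g]] unfolding funpow.simps comp_apply e .
  qed simp
  have "(\<Sum>i<N. \<mu> i ^ k) = (\<Sum>j<N. l2_inner ((tms.compress N \<phi> ^^ k) (tm j)) (tm j))" for k
  proof -
    have "(\<Sum>i<N. \<mu> i ^ k) = (\<Sum>j<N. l2_inner ((c.T ^^ k) (tm j)) (tm j))"
      unfolding \<mu>_def by (rule t.trace_T_power[OF orthonormal_basis_tm, symmetric])
    also have "\<dots> = (\<Sum>j<N. l2_inner ((tms.compress N \<phi> ^^ k) (tm j)) (tm j))"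
    proof (rule sum.cong[OF refl])
      fix j assume "j \<in> {..<N}"
      then have j: "j < N" by simp
      show "l2_inner ((c.T ^^ k) (tm j)) (tm j) = l2_inner ((tms.compress N \<phi> ^^ k) (tm j)) (tm j)"
        by (rule l2_inner_cong_AE[OF model_space_L2[OF t.T_power_V[OF tm_in_model_space[OF j]]] tm_L2 pow[OF j]]) simp
    qed
    finally show ?thesis .
  qed
  moreover have "\<mu> i \<in> C" if "closed C" "convex C" "AE \<zeta> in circ. \<phi> \<zeta> \<in> C" "i < N" for C i
    unfolding \<mu>_def
    by (rule weighted_mean_in_closed_convex[OF that(1,2) \<phi> that(3)])
       (use t.on that(4) in \<open>auto simp: orthonormal_L2 orthonormal_inner\<close>)
  moreover have "op_trace (K N) (hol_calculus (K N) (tto (B N) \<phi>) F) = (\<Sum>i<N. F (\<mu> i))"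
    if "open U" "F holomorphic_on U" "\<forall>i<N. \<mu> i \<in> U" for U F
    unfolding T \<mu>_def
    by (rule t.trace_hol_calculus[OF that(2,1)]) (use that(3) in \<open>auto simp: t.spectrum_eq \<mu>_def\<close>)
  moreover have "op_trace (K N) (cont_calculus (K N) (tto (B N) \<phi>) F) = (\<Sum>i<N. F (Re (\<mu> i)))"
    if "AE \<zeta> in circ. \<phi> \<zeta> \<in> \<real>" for F
    unfolding T \<mu>_def by (rule t.trace_cont_calculus[OF that])
  ultimately have "trace_eigenvalues \<phi> N \<mu>" unfolding trace_eigenvalues_def by (intro conjI allI impI)
  then show ?thesis by (intro exI[of _ \<mu>])
qed

end

text \<open>
  Nothing is known about \<open>g\<close> outside \<open>K\<close>. It is replaced by 0 there, which changes the composition on a null set.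
\<close>

lemma symbol_calculus_Linf:
  assumes \<phi>: "\<phi> \<in> Linf" and K: "compact K" "AE \<zeta> in circ. \<phi> \<zeta> \<in> K" and g: "continuous_on K g"
  shows "(\<lambda>\<zeta>. g (\<phi> \<zeta>)) \<in> Linf"
proof -
  have "(\<lambda>z. if z \<in> K then g z else 0) \<in> borel_measurable borel"
    by (rule borel_measurable_continuous_on_if)
       (use g compact_imp_closed[OF K(1)] in auto)
  from measurable_compose[OF Linf_measurable[OF \<phi>] this]
  have "(\<lambda>\<zeta>. if \<phi> \<zeta> \<in> K then g (\<phi> \<zeta>) else 0) \<in> borel_measurable circ" .
  then have m: "(\<lambda>\<zeta>. g (\<phi> \<zeta>)) \<in> borel_measurable circ"
    by (rule measurable_circ_AE_cong) (use K(2) in \<open>auto elim!: eventually_mono\<close>)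
  obtain C where "\<And>z. z \<in> K \<Longrightarrow> cmod (g z) \<le> C"
    using compact_imp_bounded[OF compact_continuous_image[OF g K(1)]] by (auto simp: bounded_iff)
  then have "AE \<zeta> in circ. cmod (g (\<phi> \<zeta>)) \<le> C" using K(2) by (auto elim!: eventually_mono)
  with m show ?thesis by (auto simp: Linf_def)
qed

text \<open>
  The power sums of the \<open>\<mu> N i\<close> and the negligible defect of the symbol are what links the eigenvalues to the integrals
  as \<open>N\<close> grows.
\<close>

locale szego_limit = disc_sequence +
  fixes \<phi> :: "complex \<Rightarrow> complex" and \<mu> :: "nat \<Rightarrow> nat \<Rightarrow> complex"
  assumes symbol: "\<phi> \<in> Linf" and negligible: "tms.negligible_defect \<phi>"
    and moments: "\<And>N k. (\<Sum>i<N. \<mu> N i ^ k) = (\<Sum>j<N. l2_inner ((tms.compress N \<phi> ^^ k) (tm j)) (tm j))"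
begin

definition gap :: "(complex \<Rightarrow> complex) \<Rightarrow> nat \<Rightarrow> complex" where
  "gap g N = (\<Sum>i<N. g (\<mu> N i)) / of_nat N - (LINT \<zeta>|nu \<Lambda> N. g (\<phi> \<zeta>))"

lemma gap_power: "gap (\<lambda>z. z ^ k) \<longlonglongrightarrow> 0"
  using tms.compress_power_trace_limit[OF negligible, of k]
  by (simp add: gap_def[abs_def] moments integral_nu_symbol[OF Linf_power[OF symbol]] diff_divide_distrib)

lemma gap_add:
  assumes "(\<lambda>\<zeta>. g (\<phi> \<zeta>)) \<in> Linf" "(\<lambda>\<zeta>. h (\<phi> \<zeta>)) \<in> Linf"
  shows "gap (\<lambda>z. g z + h z) N = gap g N + gap h N"
  by (simp add: gap_def integral_nu_add[OF assms] sum.distrib add_divide_distrib)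

lemma gap_cmult: "gap (\<lambda>z. c * g z) N = c * gap g N"
  by (simp add: gap_def sum_distrib_left[symmetric] right_diff_distrib)

lemma poly_symbol_Linf: "(\<lambda>\<zeta>. poly p (\<phi> \<zeta>)) \<in> Linf"
  by (induction p) (auto intro!: Linf_add Linf_mult symbol)

lemma gap_poly: "gap (poly p) \<longlonglongrightarrow> 0"
proof -
  have "gap (\<lambda>z. \<Sum>k\<in>I. coeff p k * z ^ k) \<longlonglongrightarrow> 0 \<and> (\<lambda>\<zeta>. \<Sum>k\<in>I. coeff p k * \<phi> \<zeta> ^ k) \<in> Linf" if "finite I" for I
    using that
  proof (induction I rule: finite_induct)
    case empty
    show ?case by (simp add: gap_def[abs_def])
  next
    case (insert x I)
    have L: "(\<lambda>\<zeta>. coeff p x * \<phi> \<zeta> ^ x) \<in> Linf" by (intro Linf_mult Linf_const Linf_power symbol)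
    have "(\<lambda>N. coeff p x * gap (\<lambda>z. z ^ x) N + gap (\<lambda>z. \<Sum>k\<in>I. coeff p k * z ^ k) N) \<longlonglongrightarrow> coeff p x * 0 + 0"
      using insert.IH by (intro tendsto_intros gap_power) auto
    moreover have "gap (\<lambda>z. \<Sum>k\<in>insert x I. coeff p k * z ^ k)
        = (\<lambda>N. coeff p x * gap (\<lambda>z. z ^ x) N + gap (\<lambda>z. \<Sum>k\<in>I. coeff p k * z ^ k) N)"
    proof (rule ext)
      fix N
      have "gap (\<lambda>z. coeff p x * z ^ x + (\<Sum>k\<in>I. coeff p k * z ^ k)) N
          = gap (\<lambda>z. coeff p x * z ^ x) N + gap (\<lambda>z. \<Sum>k\<in>I. coeff p k * z ^ k) N"
        by (rule gap_add[OF L]) (use insert.IH in blast)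
      then show "gap (\<lambda>z. \<Sum>k\<in>insert x I. coeff p k * z ^ k) N
        = coeff p x * gap (\<lambda>z. z ^ x) N + gap (\<lambda>z. \<Sum>k\<in>I. coeff p k * z ^ k) N"
        using insert.hyps by (simp add: gap_cmult)
    qed
    moreover have "(\<lambda>\<zeta>. \<Sum>k\<in>insert x I. coeff p k * \<phi> \<zeta> ^ k) \<in> Linf"
      using Linf_add[OF L conjunct2[OF insert.IH]] insert.hyps by simp
    ultimately show ?case by simp
  qed
  from this[of "{..degree p}"] show ?thesis unfolding poly_altdef[abs_def] by simp
qed

text \<open>
  Both terms are means of \<open>g\<close>, with respect to a counting measure and to \<open>\<nu>\<^sub>N\<close>.
\<close>

lemma gap_bound:
  assumes g: "(\<lambda>\<zeta>. g (\<phi> \<zeta>)) \<in> Linf" and N: "N \<ge> 1"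
    and \<mu>: "\<And>i. i < N \<Longrightarrow> cmod (g (\<mu> N i)) \<le> C" and \<phi>: "AE \<zeta> in circ. cmod (g (\<phi> \<zeta>)) \<le> C"
  shows "cmod (gap g N) \<le> 2 * C"
proof -
  have "cmod (\<Sum>i<N. g (\<mu> N i)) \<le> (\<Sum>i<N. C)" by (rule sum_norm_le) (use \<mu> in auto)
  then have "cmod ((\<Sum>i<N. g (\<mu> N i)) / of_nat N) \<le> C"
    using N by (simp add: norm_divide pos_divide_le_eq mult.commute)
  moreover have "cmod (LINT \<zeta>|nu \<Lambda> N. g (\<phi> \<zeta>)) \<le> C"
    by (rule integral_nu_bound[OF Linf_measurable[OF g] \<phi> N])
  ultimately show ?thesis unfolding gap_def using norm_triangle_ineq4 [of "(\<Sum>i<N. g (\<mu> N i)) / of_nat N" "LINT \<zeta>|nu \<Lambda> N. g (\<phi> \<zeta>)"]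
    by linarith
qed

text \<open>
  A bounded linear functional that tends to zero on polynomials tends to zero on their uniform limits.
\<close>

lemma gap_limit:
  assumes S: "compact S" "AE \<zeta> in circ. \<phi> \<zeta> \<in> S" "\<And>N i. i < N \<Longrightarrow> \<mu> N i \<in> S"
    and g: "continuous_on S g" "poly_approximable S g"
  shows "gap g \<longlonglongrightarrow> 0"
proof (unfold LIMSEQ_iff, intro allI impI)
  fix \<epsilon> :: real assume e: "\<epsilon> > 0"
  then have "\<epsilon> / 4 > 0" by simp
  then obtain p where p: "\<And>z. z \<in> S \<Longrightarrow> cmod (g z - poly p z) < \<epsilon> / 4"
    using g(2) unfolding poly_approximable_def by blast
  obtain N0 where N0: "\<And>N. N \<ge> N0 \<Longrightarrow> norm (gap (poly p) N - 0) < \<epsilon> / 2"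
    using LIMSEQ_D[OF gap_poly, of "\<epsilon> / 2" p] e by auto
  have gL: "(\<lambda>\<zeta>. g (\<phi> \<zeta>)) \<in> Linf" by (rule symbol_calculus_Linf[OF symbol S(1,2) g(1)])
  have dL: "(\<lambda>\<zeta>. g (\<phi> \<zeta>) - poly p (\<phi> \<zeta>)) \<in> Linf" by (intro Linf_diff gL poly_symbol_Linf)
  show "\<exists>no. \<forall>N\<ge>no. norm (gap g N - 0) < \<epsilon>"
  proof (intro exI[of _ "max 1 N0"] allI impI)
    fix N assume N: "N \<ge> max 1 N0"
    have "gap g N = gap (\<lambda>z. (g z - poly p z) + poly p z) N" by simp
    also have "\<dots> = gap (\<lambda>z. g z - poly p z) N + gap (poly p) N" by (rule gap_add[OF dL poly_symbol_Linf])
    finally have "cmod (gap g N) \<le> cmod (gap (\<lambda>z. g z - poly p z) N) + cmod (gap (poly p) N)"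
      by (simp only: norm_triangle_ineq)
    moreover have "cmod (gap (\<lambda>z. g z - poly p z) N) \<le> 2 * (\<epsilon> / 4)"
    proof (rule gap_bound[OF dL])
      show "AE \<zeta> in circ. cmod (g (\<phi> \<zeta>) - poly p (\<phi> \<zeta>)) \<le> \<epsilon> / 4"
        using S(2) by eventually_elim (rule less_imp_le[OF p])
    qed (use N S(3) p in \<open>auto intro: less_imp_le\<close>)
    ultimately show "norm (gap g N - 0) < \<epsilon>" using N0[of N] N by simp
  qed
qed

end

lemma real_poly_as_complex_poly:
  fixes h :: "real \<Rightarrow> real"
  assumes "real_polynomial_function h"
  shows "\<exists>P :: complex poly. \<forall>x. poly P (complex_of_real x) = complex_of_real (h x)"
proof -
  obtain a n where "h = (\<lambda>x. \<Sum>i\<le>n. a i * x ^ i)"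
    using assms unfolding real_polynomial_function_iff_sum by blast
  then have "\<forall>x. poly (\<Sum>i\<le>n. Polynomial.monom (complex_of_real (a i)) i) (complex_of_real x) = complex_of_real (h x)"
    by (simp add: poly_sum poly_monom)
  then show ?thesis by blast
qed

lemma weierstrass_real_interval:
  fixes f :: "real \<Rightarrow> complex"
  assumes f: "continuous_on {l..u} f"
  shows "poly_approximable (complex_of_real ` {l..u}) (\<lambda>z. f (Re z))"
  unfolding poly_approximable_def
proof (intro allI impI)
  fix \<epsilon> :: real assume "\<epsilon> > 0"
  from Stone_Weierstrass_polynomial_function[OF compact_Icc f this]
  obtain q where q: "polynomial_function q" "\<And>x. x \<in> {l..u} \<Longrightarrow> norm (f x - q x) < \<epsilon>"
    by (elim exE conjE) simp
  have "real_polynomial_function (\<lambda>x. Re (q x))" "real_polynomial_function (\<lambda>x. Im (q x))"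
    using q(1) bounded_linear_Re bounded_linear_Im unfolding polynomial_function_def comp_def by blast+
  note c = this[THEN real_poly_as_complex_poly]
  from c(1) obtain P where P: "\<forall>x. poly P (complex_of_real x) = complex_of_real (Re (q x))" by (rule exE)
  from c(2) obtain Q where Q: "\<forall>x. poly Q (complex_of_real x) = complex_of_real (Im (q x))" by (rule exE)
  have "poly (P + Polynomial.smult \<i> Q) (complex_of_real x) = q x" for x
    by (simp add: P Q flip: complex_eq)
  then show "\<exists>p. \<forall>z\<in>complex_of_real ` {l..u}. cmod (f (Re z) - poly p z) < \<epsilon>"
    using q(2) by (intro exI[of _ "P + Polynomial.smult \<i> Q"]) auto
qed

theorem theorem2p1:
  fixes \<Lambda> :: "nat \<Rightarrow> complex" and \<phi> :: "complex \<Rightarrow> complex"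
  assumes "\<And>j. cmod (\<Lambda> j) < 1"
    and "\<Lambda> 0 = 0"
    and "\<phi> \<in> Linf \<inter> X_space \<Lambda>"
  shows "(\<forall>(f :: complex \<Rightarrow> complex) U.
            open U \<longrightarrow> conv_ess_range \<phi> \<subseteq> U \<longrightarrow> f holomorphic_on U \<longrightarrow>
            (\<lambda>N. cmod (1 / of_nat N *
                   op_trace (model_space (blaschke \<Lambda> N))
                     (hol_calculus (model_space (blaschke \<Lambda> N)) (tto (blaschke \<Lambda> N) \<phi>) f)
                 - (LINT \<zeta>|nu \<Lambda> N. f (\<phi> \<zeta>)))) \<longlonglongrightarrow> 0)
       \<and> ((AE \<zeta> in circ. \<phi> \<zeta> \<in> \<real>) \<longrightarrow>
          (\<forall>f :: real \<Rightarrow> complex.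
            continuous_on {ess_inf (\<lambda>\<zeta>. Re (\<phi> \<zeta>)) .. ess_sup (\<lambda>\<zeta>. Re (\<phi> \<zeta>))} f \<longrightarrow>
            (\<lambda>N. cmod (1 / of_nat N *
                   op_trace (model_space (blaschke \<Lambda> N))
                     (cont_calculus (model_space (blaschke \<Lambda> N)) (tto (blaschke \<Lambda> N) \<phi>) f)
                 - (LINT \<zeta>|nu \<Lambda> N. f (Re (\<phi> \<zeta>))))) \<longlonglongrightarrow> 0))"
proof -
  interpret disc_sequence \<Lambda> by unfold_locales (rule assms(1))
  have L: "\<phi> \<in> Linf" using assms(3) by simp
  have "\<forall>N. \<exists>\<mu>. trace_eigenvalues \<phi> N \<mu>" using trace_eigenvalues_exist[OF L] by blast
  from choice[OF this] obtain \<mu> where "\<forall>N. trace_eigenvalues \<phi> N (\<mu> N)" by (rule exE)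
  then have \<mu>: "trace_eigenvalues \<phi> N (\<mu> N)" for N by blast
  note D = \<mu>[unfolded trace_eigenvalues_def]
  note hol = D[THEN conjunct1, rule_format]
  note cont = D[THEN conjunct2, THEN conjunct1, rule_format]
  note range = D[THEN conjunct2, THEN conjunct2, THEN conjunct1, rule_format]
  note mom = D[THEN conjunct2, THEN conjunct2, THEN conjunct2, rule_format]
  interpret szego_limit \<Lambda> \<phi> \<mu>
    by unfold_locales (rule L, rule negligible_X_space[OF assms(2,3)], rule mom)
  show ?thesis
  proof (intro conjI allI impI)
    fix f :: "complex \<Rightarrow> complex" and U
    assume U: "open U" "conv_ess_range \<phi> \<subseteq> U" and f: "f holomorphic_on U"
    note C = compact_conv_ess_range[OF L]
    have in_conv: "\<mu> N i \<in> conv_ess_range \<phi>" if "i < N" for N i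
      by (rule range[OF compact_imp_closed[OF C(1)] C(2,4) that])
    have "gap f \<longlonglongrightarrow> 0"
      by (rule gap_limit[OF C(1,4) in_conv])
         (use holomorphic_on_imp_continuous_on[OF f] U runge_compact_convex[OF C(1-3) U f] continuous_on_subset in blast)+
    moreover have "op_trace (K N) (hol_calculus (K N) (tto (B N) \<phi>) f) = (\<Sum>i<N. f (\<mu> N i))" for N
      by (rule hol[OF U(1) f]) (use in_conv U(2) in blast)
    ultimately show "(\<lambda>N. cmod (1 / of_nat N * op_trace (K N) (hol_calculus (K N) (tto (B N) \<phi>) f)
        - (LINT \<zeta>|nu \<Lambda> N. f (\<phi> \<zeta>)))) \<longlonglongrightarrow> 0"
      using tendsto_norm_zero[of "gap f" sequentially] by (simp add: gap_def[abs_def])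
  next
    assume real: "AE \<zeta> in circ. \<phi> \<zeta> \<in> \<real>"
    fix f :: "real \<Rightarrow> complex"
    let ?l = "ess_inf (\<lambda>\<zeta>. Re (\<phi> \<zeta>))" and ?u = "ess_sup (\<lambda>\<zeta>. Re (\<phi> \<zeta>))"
    let ?I = "complex_of_real ` {?l..?u}"
    assume f: "continuous_on {?l..?u} f"
    obtain C where C: "AE \<zeta> in circ. cmod (\<phi> \<zeta>) \<le> C" using L by (auto simp: Linf_def)
    have "AE \<zeta> in circ. Re (\<phi> \<zeta>) \<in> {?l..?u}"
    proof (rule AE_in_ess_interval)
      show "(\<lambda>\<zeta>. Re (\<phi> \<zeta>)) \<in> borel_measurable circ" using Linf_measurable[OF L] by measurable
      show "AE \<zeta> in circ. \<bar>Re (\<phi> \<zeta>)\<bar> \<le> C"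
        using C by eventually_elim (rule order_trans[OF abs_Re_le_cmod])
    qed
    then have I: "AE \<zeta> in circ. \<phi> \<zeta> \<in> ?I"
      using real by eventually_elim (metis image_eqI of_real_Re)
    have cI: "compact ?I" by (intro compact_continuous_image continuous_intros) auto
    have "convex ?I" by (intro convex_linear_image bounded_linear.linear[OF bounded_linear_of_real]) auto
    note in_I = range[OF compact_imp_closed[OF cI] this I]
    have "continuous_on ?I (\<lambda>z. f (Re z))"
      by (rule continuous_on_compose2[OF f]) (auto intro!: continuous_intros)
    from gap_limit[OF cI I in_I this weierstrass_real_interval[OF f]]
    have "gap (\<lambda>z. f (Re z)) \<longlonglongrightarrow> 0" .
    then show "(\<lambda>N. cmod (1 / of_nat N * op_trace (K N) (cont_calculus (K N) (tto (B N) \<phi>) f)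
        - (LINT \<zeta>|nu \<Lambda> N. f (Re (\<phi> \<zeta>))))) \<longlonglongrightarrow> 0"
      using tendsto_norm_zero[of "gap (\<lambda>z. f (Re z))" sequentially] by (simp add: gap_def[abs_def] cont[OF real])
  qed
qed

end
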